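(* Let $\Omega\subset\mathbb{R}^n$ be open, $n\ge 2$, $p\ge 2$, and let $f:\Omega\times\mathbb{R}\to\mathbb{R}$ satisfy (F1) and (F2). Let $u\in W^{1,p}_{loc}(\Omega)\cap L^\infty_{loc}(\Omega)$ be a local weak solution of $$-\operatorname{div}\Big((|Du|-1)_+^{p-1}\frac{Du}{|Du|}\Big)=f(x,u)\quad\text{in }\Omega .$$ Then $H_{p/2}(Du)\in W^{1,2}_{loc}(\Omega)$.
   Context: $(s)_+=\max\{s,0\}$. For $\gamma>0$, $H_\gamma:\mathbb{R}^n\to\mathbb{R}^n$ is defined by $H_\gamma(\xi)=(|\xi|-1)_+^{\gamma}\frac{\xi}{|\xi|}$ for $\xi\ne0$, $H_\gamma(0)=0$. Assumptions on $f$: for every open set $\Omega'\Subset\Omega$ and every $K>0$ there exist constants $L,M>0$ such that (F1) $|f(x,s)-f(x,t)|\le L|s-t|$ and (F2) $|f(x,s)-f(y,s)|\le M|x-y|$ for all $x,y\in\Omega'$ and all $s,t\in\mathbb{R}$ with $|s|,|t|\le K$. A function $u\in W^{1,p}_{loc}(\Omega)$ is a local weak solution of the equation if for every open $\tilde\Omega\Subset\Omega$ and every $\varphi\in W^{1,p}_0(\tilde\Omega)$, $\int_\Omega\langle H_{p-1}(Du),D\varphi\rangle\,dx=\int_\Omega f(x,u)\varphi\,dx$. *)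

theory Defs
  imports "HOL-Analysis.Analysis"
begin

definition H :: "real \<Rightarrow> 'a::euclidean_space \<Rightarrow> 'a" where
  "H \<gamma> \<xi> = (if \<xi> = 0 then 0
              else (max (norm \<xi> - 1) 0) powr \<gamma> *\<^sub>R (\<xi> /\<^sub>R norm \<xi>))"

fun Ck :: "nat \<Rightarrow> ('a::euclidean_space \<Rightarrow> real) \<Rightarrow> bool" where
  "Ck 0 \<phi> = continuous_on UNIV \<phi>"
| "Ck (Suc k) \<phi> = ((\<forall>x. \<phi> differentiable (at x)) \<and>
      (\<forall>b\<in>Basis. Ck k (\<lambda>x. frechet_derivative \<phi> (at x) b)))"

definition smooth :: "('a::euclidean_space \<Rightarrow> real) \<Rightarrow> bool" where
  "smooth \<phi> \<longleftrightarrow> (\<forall>k. Ck k \<phi>)"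

definition test_fun :: "'a::euclidean_space set \<Rightarrow> ('a \<Rightarrow> real) \<Rightarrow> bool" where
  "test_fun U \<phi> \<longleftrightarrow> smooth \<phi> \<and> compact (closure {x. \<phi> x \<noteq> 0})
      \<and> closure {x. \<phi> x \<noteq> 0} \<subseteq> U"

definition cgrad :: "('a::euclidean_space \<Rightarrow> real) \<Rightarrow> 'a \<Rightarrow> 'a" where
  "cgrad \<phi> x = (\<Sum>b\<in>Basis. frechet_derivative \<phi> (at x) b *\<^sub>R b)"

definition Lp_on :: "real \<Rightarrow> 'a::euclidean_space set \<Rightarrow> ('a \<Rightarrow> 'b::{real_normed_vector, second_countable_topology}) \<Rightarrow> bool" where
  "Lp_on p K f \<longleftrightarrow> f \<in> borel_measurable (lebesgue_on K) \<and>
      integrable (lebesgue_on K) (\<lambda>x. norm (f x) powr p)"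

definition Lp_loc :: "real \<Rightarrow> 'a::euclidean_space set \<Rightarrow> ('a \<Rightarrow> 'b::{real_normed_vector, second_countable_topology}) \<Rightarrow> bool" where
  "Lp_loc p U f \<longleftrightarrow> (\<forall>K. compact K \<and> K \<subseteq> U \<longrightarrow> Lp_on p K f)"

definition Linf_loc :: "'a::euclidean_space set \<Rightarrow> ('a \<Rightarrow> real) \<Rightarrow> bool" where
  "Linf_loc U f \<longleftrightarrow> (\<forall>K. compact K \<and> K \<subseteq> U \<longrightarrow>
      f \<in> borel_measurable (lebesgue_on K) \<and> (\<exists>C. AE x in lebesgue_on K. \<bar>f x\<bar> \<le> C))"

definition weak_grad :: "'a::euclidean_space set \<Rightarrow> ('a \<Rightarrow> real) \<Rightarrow> ('a \<Rightarrow> 'a) \<Rightarrow> bool" where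
  "weak_grad U u g \<longleftrightarrow> Lp_loc 1 U u \<and> Lp_loc 1 U g \<and>
     (\<forall>\<phi>. test_fun U \<phi> \<longrightarrow> (\<forall>b\<in>Basis.
        (LINT x|lebesgue_on U. u x * frechet_derivative \<phi> (at x) b)
          = - (LINT x|lebesgue_on U. (g x \<bullet> b) * \<phi> x)))"

definition W1p_loc :: "real \<Rightarrow> 'a::euclidean_space set \<Rightarrow> ('a \<Rightarrow> real) \<Rightarrow> ('a \<Rightarrow> 'a) \<Rightarrow> bool" where
  "W1p_loc p U u g \<longleftrightarrow> weak_grad U u g \<and> Lp_loc p U u \<and> Lp_loc p U g"

definition W1p :: "real \<Rightarrow> 'a::euclidean_space set \<Rightarrow> ('a \<Rightarrow> real) \<Rightarrow> ('a \<Rightarrow> 'a) \<Rightarrow> bool" where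
  "W1p p U u g \<longleftrightarrow> weak_grad U u g \<and> Lp_on p U u \<and> Lp_on p U g"

definition W0p :: "real \<Rightarrow> 'a::euclidean_space set \<Rightarrow> ('a \<Rightarrow> real) \<Rightarrow> ('a \<Rightarrow> 'a) \<Rightarrow> bool" where
  "W0p p U \<phi> g \<longleftrightarrow> W1p p U \<phi> g \<and>
     (\<exists>\<psi>. (\<forall>k. test_fun U (\<psi> k)) \<and>
        ((\<lambda>k. (LINT x|lebesgue_on U. \<bar>\<psi> k x - \<phi> x\<bar> powr p)
             + (LINT x|lebesgue_on U. norm (cgrad (\<psi> k) x - g x) powr p)) \<longlonglongrightarrow> 0))"

definition cc_open :: "'a::euclidean_space set \<Rightarrow> 'a set \<Rightarrow> bool" where
  "cc_open V U \<longleftrightarrow> open V \<and> compact (closure V) \<and> closure V \<subseteq> U"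

definition F1_F2 :: "'a::euclidean_space set \<Rightarrow> ('a \<Rightarrow> real \<Rightarrow> real) \<Rightarrow> bool" where
  "F1_F2 \<Omega> f \<longleftrightarrow> (\<forall>\<Omega>'. cc_open \<Omega>' \<Omega> \<longrightarrow> (\<forall>K>0. \<exists>L>0. \<exists>M>0.
     (\<forall>x\<in>\<Omega>'. \<forall>y\<in>\<Omega>'. \<forall>s t. \<bar>s\<bar> \<le> K \<and> \<bar>t\<bar> \<le> K \<longrightarrow>
        \<bar>f x s - f x t\<bar> \<le> L * \<bar>s - t\<bar> \<and> \<bar>f x s - f y s\<bar> \<le> M * dist x y)))"

text \<open>u (with weak gradient Du) is a local weak solution of
  -div(H_{p-1}(Du)) = f(x,u) in Omega.  The test function phi in W_0^{1,p}(V)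
  is extended by zero outside V, so the integrals over Omega reduce to V.\<close>
definition local_weak_solution ::
  "real \<Rightarrow> 'a::euclidean_space set \<Rightarrow> ('a \<Rightarrow> real \<Rightarrow> real) \<Rightarrow> ('a \<Rightarrow> real) \<Rightarrow> ('a \<Rightarrow> 'a) \<Rightarrow> bool" where
  "local_weak_solution p \<Omega> f u Du \<longleftrightarrow> W1p_loc p \<Omega> u Du \<and>
     (\<forall>V. cc_open V \<Omega> \<longrightarrow> (\<forall>\<phi> g. W0p p V \<phi> g \<longrightarrow>
        (LINT x|lebesgue_on V. H (p - 1) (Du x) \<bullet> g x)
          = (LINT x|lebesgue_on V. f x (u x) * \<phi> x)))"

end

theory Submission
  imports Defs "HOL-Real_Asymp.Real_Asymp"
begin

text \<open>The second-order regularity comes from the method of difference quotients. After cutting off,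
  \<open>u\<close> and \<open>Du\<close> become Borel functions on the whole space whose mollifications are smooth, so
  \<open>\<eta>\<^sup>2 (u (x + h e) - u x)\<close>, mollified and differenced once more, is an admissible test function; letting the
  mollification parameter tend to zero gives the differenced equation. The inequalities
  \<open>(4 / p\<^sup>2) |V \<xi> - V \<eta>|\<^sup>2 \<le> (A \<xi> - A \<eta>) \<bullet> (\<xi> - \<eta>)\<close> and
  \<open>|A \<xi> - A \<eta>| \<le> 2 max |\<xi>| |\<eta>| powr (p / 2 - 1) |V \<xi> - V \<eta>|\<close>, for \<open>A = H (p - 1)\<close> and \<open>V = H (p / 2)\<close>,
  turn it into a Caccioppoli estimate: the difference quotients of \<open>V (Du)\<close> are bounded in \<open>L\<^sup>2\<close> locally.
  Hence the distributional derivatives of \<open>V (Du)\<close> are represented by local \<open>L\<^sup>2\<close> functions, which agree on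
  overlaps and are glued along an exhaustion of \<open>\<Omega>\<close>.\<close>

section \<open>Smooth functions and mollifiers\<close>

text \<open>The cut-off is sharp: \<open>u\<close>, \<open>Du\<close> and \<open>f x (u x)\<close>
  are set to zero outside \<open>nbhd S (4 * r)\<close>, which creates jumps there. Each step
  therefore spends one layer of a collar: \<open>\<eta>\<close> lives in \<open>nbhd S r\<close>,
  right-hand sides are compared in \<open>nbhd S (2 * r)\<close>, mollification commutes with the
  weak gradient in \<open>nbhd S (3 * r)\<close>, and the equation holds against test functions in
  \<open>nbhd S (4 * r)\<close>. Only smooth test functions are inserted in the equation, so
  membership in \<open>W0p\<close> is witnessed by a constant sequence; an approximation argument in
  Sobolev spaces becomes a limit in one integral identity. The hypothesis \<open>p \<ge> 2\<close>
  enters through scaling: the growth bound costs the weight \<open>m powr (p / 2 - 1)\<close>;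
  multiplied by a difference quotient \<open>t\<close> of \<open>u\<close> and squared, it has
  degree exactly \<open>p\<close>, so the available \<open>p\<close>-th powers control it. Hoelder's
  inequality is replaced by Young's inequality with a free parameter. This additive form suits the
  limits, the absorption and the representation of functionals alike.\<close>

lemma Ck_Suc_imp: "Ck (Suc k) \<phi> \<Longrightarrow> Ck k \<phi>"
proof (induction k arbitrary: \<phi>)
  case 0
  then show ?case
    by (auto intro: differentiable_imp_continuous_on simp: differentiable_on_def differentiable_at_withinI)
next
  case (Suc k)
  then show ?case by simp
qed

lemma Ck_Suc_has_derivative:
  "Ck (Suc k) \<phi> \<Longrightarrow> (\<phi> has_derivative frechet_derivative \<phi> (at x)) (at x)"
  by (simp add: frechet_derivative_works[symmetric])

text \<open>\<open>frechet_derivative\<close> is a choice; uniqueness of the derivative lets any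
  explicit candidate stand in for it, so that the smoothness proofs below work with
  \<open>has_derivative\<close> alone.\<close>

lemma Ck_SucI:
  assumes "\<And>x. (\<phi> has_derivative D x) (at x)" "\<And>b. b \<in> Basis \<Longrightarrow> Ck k (\<lambda>x. D x b)"
  shows "Ck (Suc k) \<phi>"
proof -
  have "frechet_derivative \<phi> (at x) = D x" for x
    using frechet_derivative_at[OF assms(1)[of x]] by simp
  with assms show ?thesis by (auto simp: differentiable_def)
qed

lemma Ck_const: "Ck k (\<lambda>x. c)"
proof (induction k arbitrary: c)
  case (Suc k)
  show ?case by (rule Ck_SucI[where D="\<lambda>_ _. 0"]) (auto intro: Suc)
qed simp

lemma Ck_add: "Ck k \<phi> \<Longrightarrow> Ck k \<psi> \<Longrightarrow> Ck k (\<lambda>x. \<phi> x + \<psi> x)"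
proof (induction k arbitrary: \<phi> \<psi>)
  case (Suc k)
  show ?case
    by (rule Ck_SucI[OF has_derivative_add[OF Ck_Suc_has_derivative[OF Suc.prems(1)]
          Ck_Suc_has_derivative[OF Suc.prems(2)]]])
      (use Suc in auto)
qed (auto intro: continuous_intros)

lemma Ck_mult: "Ck k \<phi> \<Longrightarrow> Ck k \<psi> \<Longrightarrow> Ck k (\<lambda>x. \<phi> x * \<psi> x)"
proof (induction k arbitrary: \<phi> \<psi>)
  case (Suc k)
  \<comment> \<open>The product rule keeps one factor undifferentiated, so each factor is also
    needed one order lower.\<close>
  have "Ck k \<phi>" "Ck k \<psi>" using Suc.prems Ck_Suc_imp by blast+
  then show ?case
    by (intro Ck_SucI[OF has_derivative_mult[OF Ck_Suc_has_derivative[OF Suc.prems(1)]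
          Ck_Suc_has_derivative[OF Suc.prems(2)]]] Ck_add Suc.IH)
      (use Suc.prems in auto)
qed (auto intro: continuous_intros)

text \<open>One affine family serves three purposes: scaling of the bump, translation, and the
  reflection \<open>x - y\<close> of kernels.\<close>

lemma Ck_affine:
  assumes "Ck k \<phi>" shows "Ck k (\<lambda>x. \<phi> (a + c *\<^sub>R x))"
  using assms
proof (induction k arbitrary: \<phi>)
  case 0
  then show ?case
    by (auto intro!: continuous_on_compose2[OF 0[simplified]] continuous_intros)
next
  case (Suc k)
  have d: "((\<lambda>x. \<phi> (a + c *\<^sub>R x)) has_derivative
      (\<lambda>h. c * frechet_derivative \<phi> (at (a + c *\<^sub>R x)) h)) (at x)" for x
  proof -
    note D = Ck_Suc_has_derivative[OF Suc.prems, of "a + c *\<^sub>R x"]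
    have "((\<lambda>x. a + c *\<^sub>R x) has_derivative (\<lambda>h. c *\<^sub>R h)) (at x)"
      by (auto intro!: derivative_eq_intros)
    from has_derivative_compose[OF this D] show ?thesis
      by (simp add: linear_cmul[OF has_derivative_linear[OF D]])
  qed
  show ?case
    by (rule Ck_SucI[OF d]) (use Suc in \<open>auto intro!: Ck_mult Ck_const Suc.IH\<close>)
qed

lemma smooth_Ck: "smooth \<phi> \<Longrightarrow> Ck k \<phi>"
  by (simp add: smooth_def)

lemma smooth_has_derivative:
  "smooth \<phi> \<Longrightarrow> (\<phi> has_derivative frechet_derivative \<phi> (at x)) (at x)"
  using Ck_Suc_has_derivative smooth_Ck by blast

lemma smooth_frechet: "smooth \<phi> \<Longrightarrow> b \<in> Basis \<Longrightarrow> smooth (\<lambda>x. frechet_derivative \<phi> (at x) b)"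
  unfolding smooth_def using Ck.simps(2) by blast

lemma smooth_continuous: "smooth \<phi> \<Longrightarrow> continuous_on UNIV \<phi>"
  using smooth_Ck[of \<phi> 0] by simp

lemma smooth_continuous_frechet:
  "smooth \<phi> \<Longrightarrow> b \<in> Basis \<Longrightarrow> continuous_on UNIV (\<lambda>x. frechet_derivative \<phi> (at x) b)"
  by (intro smooth_continuous smooth_frechet)

lemma smooth_const: "smooth (\<lambda>x. c)"
  by (simp add: smooth_def Ck_const)

lemma smooth_add: "smooth \<phi> \<Longrightarrow> smooth \<psi> \<Longrightarrow> smooth (\<lambda>x. \<phi> x + \<psi> x)"
  by (simp add: smooth_def Ck_add)

lemma smooth_mult: "smooth \<phi> \<Longrightarrow> smooth \<psi> \<Longrightarrow> smooth (\<lambda>x. \<phi> x * \<psi> x)"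
  by (simp add: smooth_def Ck_mult)

lemma smooth_diff: "smooth \<phi> \<Longrightarrow> smooth \<psi> \<Longrightarrow> smooth (\<lambda>x. \<phi> x - \<psi> x)"
  using smooth_add[of \<phi> "\<lambda>x. (-1) * \<psi> x"] smooth_mult[OF smooth_const[of "-1"], of \<psi>] by simp

lemma smooth_affine: "smooth \<phi> \<Longrightarrow> smooth (\<lambda>x. \<phi> (a + c *\<^sub>R x))"
  by (simp add: smooth_def Ck_affine)

text \<open>The span of the functions \<open>t\<^sup>-\<^sup>m exp (- 1 / t)\<close>, extended by zero, is closed under
  differentiation, which makes the standard bump smooth without a formula for its derivatives.\<close>

definition flat :: "nat \<Rightarrow> real \<Rightarrow> real" where
  "flat m t = (if t > 0 then exp (- (1/t)) / t ^ m else 0)"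

lemma flat_has_derivative:
  "(flat m has_field_derivative flat (m + 2) t - m * flat (m + 1) t) (at t)"
proof -
  consider "t > 0" | "t < 0" | "t = 0" by linarith
  then show ?thesis
  proof cases
    case 1
    have "((\<lambda>t. exp (- (1/t)) / t ^ m) has_field_derivative flat (m + 2) t - m * flat (m + 1) t) (at t)"
    proof (cases m)
      case 0
      then show ?thesis using 1
        by (auto intro!: derivative_eq_intros simp: flat_def field_simps power2_eq_square)
    next
      case (Suc n)
      then show ?thesis using 1
        by (auto intro!: derivative_eq_intros simp: flat_def)
          (cases n; simp add: field_simps power2_eq_square)
    qed
    then show ?thesis
      by (rule has_field_derivative_transform_within_open[of _ _ _ "{0<..}"])
        (use 1 in \<open>auto simp: flat_def\<close>)
  next
    case 2
    have "((\<lambda>t. 0) has_field_derivative flat (m + 2) t - m * flat (m + 1) t) (at t)"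
      using 2 by (auto intro!: derivative_eq_intros simp: flat_def)
    then show ?thesis
      by (rule has_field_derivative_transform_within_open[of _ _ _ "{..<0}"])
        (use 2 in \<open>auto simp: flat_def\<close>)
  next
    case 3
    \<comment> \<open>At the origin both one-sided difference quotients tend to 0: on the right the
      quotient is \<open>flat (m + 1)\<close>, where the exponential beats every power, and on the
      left it is identically 0.\<close>
    have "((\<lambda>y. flat m y / y) \<longlongrightarrow> 0) (at_right 0)"
    proof (rule Lim_transform_eventually)
      show "((\<lambda>y. exp (- (1/y)) / y ^ m / y) \<longlongrightarrow> 0) (at_right (0::real))"
        by real_asymp
    qed (auto simp: eventually_at_right_less flat_def intro!: eventually_mono[OF eventually_at_right_less])
    moreover have "((\<lambda>y. flat m y / y) \<longlongrightarrow> 0) (at_left 0)"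
      by (rule Lim_transform_eventually[OF tendsto_const])
        (auto simp: flat_def eventually_at_filter)
    ultimately have "((\<lambda>y. flat m y / y) \<longlongrightarrow> 0) (at 0)"
      by (simp add: filterlim_split_at)
    then show ?thesis using 3
      by (simp add: has_field_derivative_iff flat_def)
  qed
qed

lemma Ck_flat_comp:
  fixes q :: "'a::euclidean_space \<Rightarrow> real"
  assumes "smooth q" shows "Ck k (\<lambda>x. flat m (q x))"
proof (induction k arbitrary: m)
  case 0
  have "continuous_on UNIV (flat m)"
    using flat_has_derivative DERIV_isCont by (blast intro: continuous_at_imp_continuous_on)
  then show ?case using smooth_continuous[OF assms]
    by (auto intro: continuous_on_compose2)
next
  case (Suc k)
  have "((\<lambda>x. flat m (q x)) has_derivative
     (\<lambda>h. (flat (m + 2) (q x) + (- real m) * flat (m + 1) (q x)) * frechet_derivative q (at x) h)) (at x)" for x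
    using has_derivative_compose[OF smooth_has_derivative[OF assms]
        flat_has_derivative[unfolded has_field_derivative_def]]
    by simp
  then show ?case
    by (rule Ck_SucI, intro Ck_mult Ck_add Ck_const Suc.IH)
      (rule smooth_Ck[OF smooth_frechet[OF assms]])
qed

lemma smooth_inner_left: "smooth (\<lambda>x. x \<bullet> b)"
proof -
  have "Ck k (\<lambda>x. x \<bullet> b)" for k
  proof (cases k)
    case (Suc n)
    show ?thesis unfolding Suc
      by (rule Ck_SucI[where D="\<lambda>_ h. h \<bullet> b"]) (auto intro!: derivative_eq_intros Ck_const)
  qed (auto intro: continuous_intros)
  then show ?thesis by (simp add: smooth_def)
qed

lemma smooth_sum: "finite A \<Longrightarrow> (\<And>i. i \<in> A \<Longrightarrow> smooth (\<phi> i)) \<Longrightarrow> smooth (\<lambda>x. \<Sum>i\<in>A. \<phi> i x)"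
  by (induction A rule: finite_induct) (auto intro: smooth_const smooth_add)

text \<open>Using \<open>x \<bullet> x\<close> instead of the norm keeps the inner function
  polynomial, hence smooth at the origin too.\<close>

definition bump :: "'a::euclidean_space \<Rightarrow> real" where
  "bump x = flat 0 (1 - x \<bullet> x)"

lemma smooth_bump: "smooth (bump :: 'a::euclidean_space \<Rightarrow> real)"
proof -
  have "smooth (\<lambda>x::'a. x \<bullet> x)"
    by (subst euclidean_inner) (auto intro!: smooth_sum smooth_mult smooth_inner_left)
  then have "smooth (\<lambda>x::'a. 1 - x \<bullet> x)" by (intro smooth_diff smooth_const)
  from Ck_flat_comp[OF this] show ?thesis unfolding bump_def smooth_def by blast
qed

lemma bump_nonneg: "bump x \<ge> 0"
  by (simp add: bump_def flat_def)

lemma bump_pos_iff: "bump x > 0 \<longleftrightarrow> norm x < 1"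
  by (simp add: bump_def flat_def dot_square_norm power_less_one_iff abs_square_less_1)

lemma frechet_derivative_outside_support:
  assumes "closed S" "\<And>x. x \<notin> S \<Longrightarrow> \<phi> x = 0" "x \<notin> S"
  shows "frechet_derivative \<phi> (at x) = (\<lambda>_. 0)"
proof -
  have "(\<phi> has_derivative (\<lambda>_. 0)) (at x)"
    by (rule has_derivative_transform_within_open[of "\<lambda>_. 0" _ _ _ "-S"]) (use assms in auto)
  then show ?thesis using frechet_derivative_at by metis
qed

text \<open>Closures of supports are avoided from here on: any compact set off which the function
  vanishes will do.\<close>

lemma test_funI:
  assumes "smooth \<phi>" "compact S" "S \<subseteq> U" "\<And>x. x \<notin> S \<Longrightarrow> \<phi> x = 0"
  shows "test_fun U \<phi>"
proof -
  have "closure {x. \<phi> x \<noteq> 0} \<subseteq> S"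
    using assms by (intro closure_minimal) (auto intro: compact_imp_closed)
  moreover from this have "compact (closure {x. \<phi> x \<noteq> 0})"
    using assms(2) by (meson bounded_subset closed_closure compact_eq_bounded_closed)
  ultimately show ?thesis using assms unfolding test_fun_def by blast
qed

lemma test_funE:
  assumes "test_fun U \<phi>"
  obtains S where "smooth \<phi>" "compact S" "S \<subseteq> U" "\<And>x. x \<notin> S \<Longrightarrow> \<phi> x = 0"
  using assms closure_subset[of "{x. \<phi> x \<noteq> 0}"] unfolding test_fun_def by blast

lemma test_fun_smooth: "test_fun U \<phi> \<Longrightarrow> smooth \<phi>"
  by (simp add: test_fun_def)

lemma test_fun_outside: "test_fun U \<phi> \<Longrightarrow> x \<notin> U \<Longrightarrow> \<phi> x = 0"
  by (elim test_funE) blast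

lemma test_fun_mono: "test_fun U \<phi> \<Longrightarrow> U \<subseteq> W \<Longrightarrow> test_fun W \<phi>"
  by (auto simp: test_fun_def)

lemma test_fun_zero: "test_fun U (\<lambda>x. 0)"
  by (rule test_funI[where S="{}"]) (auto intro: smooth_const)

lemma test_fun_mult: "smooth \<psi> \<Longrightarrow> test_fun U \<phi> \<Longrightarrow> test_fun U (\<lambda>x. \<psi> x * \<phi> x)"
  by (erule test_funE, rule test_funI) (auto intro: smooth_mult)

lemma test_fun_add: 
  assumes "test_fun U \<phi>" "test_fun U \<psi>" shows "test_fun U (\<lambda>x. \<phi> x + \<psi> x)"
proof -
  obtain S where "smooth \<phi>" "compact S" "S \<subseteq> U" "\<And>x. x \<notin> S \<Longrightarrow> \<phi> x = 0"
    by (rule test_funE[OF assms(1)]) blast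
  moreover obtain T where "smooth \<psi>" "compact T" "T \<subseteq> U" "\<And>x. x \<notin> T \<Longrightarrow> \<psi> x = 0"
    by (rule test_funE[OF assms(2)]) blast
  ultimately show ?thesis
    by (intro test_funI[where S="S \<union> T"]) (auto intro: smooth_add)
qed

lemma test_fun_frechet:
  assumes "test_fun U \<phi>" "b \<in> Basis" shows "test_fun U (\<lambda>x. frechet_derivative \<phi> (at x) b)"
proof -
  obtain S where "smooth \<phi>" "compact S" "S \<subseteq> U" "\<And>x. x \<notin> S \<Longrightarrow> \<phi> x = 0"
    by (rule test_funE[OF assms(1)]) blast
  then show ?thesis
    by (intro test_funI[where S=S] smooth_frechet assms(2))
      (auto simp: frechet_derivative_outside_support[of S] compact_imp_closed)
qed

lemma compact_support_bounded:
  fixes \<phi> :: "'a::euclidean_space \<Rightarrow> real"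
  assumes "continuous_on UNIV \<phi>" "compact S" "\<And>x. x \<notin> S \<Longrightarrow> \<phi> x = 0"
  obtains B where "B > 0" "\<And>x. \<bar>\<phi> x\<bar> \<le> B"
proof -
  have "bounded (\<phi> ` S)"
    using assms by (intro compact_imp_bounded compact_continuous_image) (auto intro: continuous_on_subset)
  then obtain B where "B > 0" "\<And>x. x \<in> S \<Longrightarrow> \<bar>\<phi> x\<bar> \<le> B" by (auto simp: bounded_pos)
  then show ?thesis using assms(3) by (intro that[of B]) (auto, metis abs_zero less_imp_le)
qed

lemma compact_support_integrable:
  fixes \<phi> :: "'a::euclidean_space \<Rightarrow> real"
  assumes "continuous_on UNIV \<phi>" "compact S" "\<And>x. x \<notin> S \<Longrightarrow> \<phi> x = 0"
  shows "integrable lborel \<phi>"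
proof -
  have "integrable lborel (\<lambda>x. indicator S x *\<^sub>R \<phi> x)"
    by (rule borel_integrable_compact[OF assms(2)]) (use assms in \<open>auto intro: continuous_on_subset\<close>)
  also have "(\<lambda>x. indicator S x *\<^sub>R \<phi> x) = \<phi>" using assms(3) by (force simp: indicator_def)
  finally show ?thesis .
qed

lemma test_fun_bounded:
  assumes "test_fun U \<phi>" obtains B where "B > 0" "\<And>x. \<bar>\<phi> x\<bar> \<le> B"
  using assms compact_support_bounded smooth_continuous by (metis test_funE)

lemma test_fun_integrable: "test_fun U \<phi> \<Longrightarrow> integrable lborel \<phi>"
  using compact_support_integrable smooth_continuous by (metis test_funE)

lemma test_fun_measurable [measurable_dest]:
  "test_fun U \<phi> \<Longrightarrow> \<phi> \<in> borel_measurable borel"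
  by (intro borel_measurable_continuous_onI smooth_continuous test_fun_smooth)

text \<open>A predicate on kernels and not a fixed rescaled one: later arguments see only
  smoothness, sign, radius and mass, so no power of \<open>\<epsilon>\<close> has to be carried
  along.\<close>

definition mollifier :: "real \<Rightarrow> ('a::euclidean_space \<Rightarrow> real) \<Rightarrow> bool" where
  "mollifier \<epsilon> \<rho> \<longleftrightarrow> smooth \<rho> \<and> (\<forall>x. 0 \<le> \<rho> x) \<and> (\<forall>x. \<epsilon> \<le> norm x \<longrightarrow> \<rho> x = 0) \<and> integral\<^sup>L lborel \<rho> = 1"

lemma mollifier_test_fun: "mollifier \<epsilon> \<rho> \<Longrightarrow> test_fun UNIV \<rho>"
  by (rule test_funI[where S="cball 0 \<epsilon>"]) (auto simp: mollifier_def)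

text \<open>Rescale the bump and divide by its integral. The integral is not zero, since a
  nonnegative function with zero integral vanishes almost everywhere, whereas this one is positive
  on a ball of positive measure.\<close>

lemma mollifier_exists:
  assumes "\<epsilon> > 0" shows "\<exists>\<rho> :: 'a::euclidean_space \<Rightarrow> real. mollifier \<epsilon> \<rho>"
proof -
  define r :: "'a \<Rightarrow> real" where "r x = bump (0 + (1/\<epsilon>) *\<^sub>R x)" for x
  have sm: "smooth r" unfolding r_def by (rule smooth_affine[OF smooth_bump])
  have nn: "r x \<ge> 0" for x by (simp add: r_def bump_nonneg)
  have pos: "r x > 0 \<longleftrightarrow> norm x < \<epsilon>" for x using assms by (simp add: r_def bump_pos_iff)
  have z: "\<epsilon> \<le> norm x \<Longrightarrow> r x = 0" for x using pos[of x] nn[of x] by linarith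
  have "integrable lborel r"
    by (rule compact_support_integrable[OF smooth_continuous[OF sm] compact_cball[of 0 \<epsilon>]]) (auto intro: z)
  have "integral\<^sup>L lborel r \<noteq> 0"
  proof
    assume "integral\<^sup>L lborel r = 0"
    then have "AE x in lborel. r x = 0"
      using integral_nonneg_eq_0_iff_AE[OF \<open>integrable lborel r\<close>] nn by simp
    then have "AE x::'a in lborel. x \<notin> ball 0 \<epsilon>"
      by (rule eventually_mono) (metis mem_ball_0 less_irrefl pos)
    then have "emeasure lborel (ball (0::'a) \<epsilon>) = 0"
      by (subst (asm) AE_iff_measurable[OF _ refl]) (auto simp: ball_def)
    then show False using content_ball_pos[OF assms, of "0::'a"] by (simp add: measure_def)
  qed
  moreover have "integral\<^sup>L lborel r \<ge> 0" using nn by simp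
  ultimately have I: "integral\<^sup>L lborel r > 0" by simp
  have "mollifier \<epsilon> (\<lambda>x. 1 / integral\<^sup>L lborel r * r x)"
    unfolding mollifier_def using smooth_mult[OF smooth_const[of "1 / integral\<^sup>L lborel r"] sm] nn I z by simp
  then show ?thesis by blast
qed

section \<open>Convolution with a smooth kernel\<close>

lemma frechet_derivative_components:
  assumes "smooth \<phi>"
  shows "frechet_derivative \<phi> (at x) h = (\<Sum>b\<in>Basis. (h \<bullet> b) * frechet_derivative \<phi> (at x) b)"
proof -
  interpret linear "frechet_derivative \<phi> (at x)"
    using smooth_has_derivative[OF assms] has_derivative_linear by blast
  have "frechet_derivative \<phi> (at x) (\<Sum>b\<in>Basis. (h \<bullet> b) *\<^sub>R b) = (\<Sum>b\<in>Basis. (h \<bullet> b) * frechet_derivative \<phi> (at x) b)"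
    by (simp add: sum scale)
  then show ?thesis by (simp add: euclidean_representation)
qed

lemma test_fun_derivative_bounded:
  fixes \<phi> :: "'a::euclidean_space \<Rightarrow> real"
  assumes "test_fun U \<phi>"
  obtains B where "B > 0" "\<And>x h. \<bar>frechet_derivative \<phi> (at x) h\<bar> \<le> B * norm h"
    "\<And>x y. \<bar>\<phi> x - \<phi> y\<bar> \<le> B * norm (x - y)"
proof -
  have "\<forall>b\<in>Basis. \<exists>B>0. \<forall>x. \<bar>frechet_derivative \<phi> (at x) b\<bar> \<le> B"
    using test_fun_bounded[OF test_fun_frechet[OF assms]] by metis
  then obtain B where B: "\<And>b. b \<in> Basis \<Longrightarrow> B b > 0" "\<And>b x. b \<in> Basis \<Longrightarrow> \<bar>frechet_derivative \<phi> (at x) b\<bar> \<le> B b"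
    by metis
  define C where "C = (\<Sum>b\<in>Basis. B b)"
  have C: "C > 0" unfolding C_def using B by (intro sum_pos) auto
  have bd: "\<bar>frechet_derivative \<phi> (at x) h\<bar> \<le> C * norm h" for x h
  proof -
    have "\<bar>frechet_derivative \<phi> (at x) h\<bar> \<le> (\<Sum>b\<in>Basis. \<bar>(h \<bullet> b) * frechet_derivative \<phi> (at x) b\<bar>)"
      by (subst frechet_derivative_components[OF test_fun_smooth[OF assms]]) (rule sum_abs)
    also have "\<dots> \<le> (\<Sum>b\<in>Basis. norm h * B b)"
      using B by (intro sum_mono) (auto simp: abs_mult intro!: mult_mono Basis_le_norm)
    finally show ?thesis by (simp add: C_def sum_distrib_left mult.commute)
  qed
  have "norm (\<phi> x - \<phi> y) \<le> C * norm (x - y)" for x y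
    by (rule differentiable_bound[of UNIV \<phi> "\<lambda>x. frechet_derivative \<phi> (at x)"])
      (use bd smooth_has_derivative[OF test_fun_smooth[OF assms]] in \<open>auto intro!: onorm_le\<close>)
  with C bd show ?thesis by (intro that[of C]) auto
qed

text \<open>Differentiation under the integral sign, by dominated convergence of the difference
  quotients along sequences. The free map \<open>T\<close> covers both the argument
  \<open>x - y\<close> of a convolution and the argument \<open>y + x\<close> of a translated test
  function.\<close>

lemma has_derivative_integral_translate:
  fixes U :: "'a::euclidean_space \<Rightarrow> real" and T :: "'a \<Rightarrow> 'a"
  assumes U: "integrable lborel U" and \<psi>: "test_fun UNIV \<psi>" and T[measurable]: "T \<in> borel_measurable borel"
  shows "((\<lambda>x. \<integral>y. U y * \<psi> (x + T y) \<partial>lborel) has_derivative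
          (\<lambda>h. \<integral>y. U y * frechet_derivative \<psi> (at (x + T y)) h \<partial>lborel)) (at x)"
proof -
  note sm = test_fun_smooth[OF \<psi>]
  note [measurable] = borel_measurable_integrable[OF U, simplified] test_fun_measurable[OF \<psi>]
  obtain B where B: "B > 0" "\<And>x h. \<bar>frechet_derivative \<psi> (at x) h\<bar> \<le> B * norm h"
    "\<And>x y. \<bar>\<psi> x - \<psi> y\<bar> \<le> B * norm (x - y)"
    using test_fun_derivative_bounded[OF \<psi>] by blast
  obtain B0 where B0: "B0 > 0" "\<And>x. \<bar>\<psi> x\<bar> \<le> B0" using test_fun_bounded[OF \<psi>] by blast
  have meas[measurable]: "(\<lambda>x. frechet_derivative \<psi> (at x) h) \<in> borel_measurable borel" for h
  proof -
    have "(\<lambda>x. \<Sum>b\<in>Basis. (h \<bullet> b) * frechet_derivative \<psi> (at x) b) \<in> borel_measurable borel"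
      by (intro borel_measurable_sum borel_measurable_times)
        (auto intro!: borel_measurable_continuous_onI smooth_continuous_frechet[OF sm])
    then show ?thesis by (subst frechet_derivative_components[OF sm])
  qed
  have i1: "integrable lborel (\<lambda>y. U y * \<psi> (x + T y))" for x
    by (rule Bochner_Integration.integrable_bound[of _ "\<lambda>y. U y * B0"])
      (use U B0 in \<open>auto simp: abs_mult intro!: mult_left_mono\<close>)
  have i2: "integrable lborel (\<lambda>y. U y * frechet_derivative \<psi> (at (x + T y)) h)" for h
    by (rule Bochner_Integration.integrable_bound[of _ "\<lambda>y. U y * (B * norm h)"])
      (use U B in \<open>auto simp: abs_mult intro!: mult_left_mono\<close>)
  let ?F' = "\<lambda>h. \<integral>y. U y * frechet_derivative \<psi> (at (x + T y)) h \<partial>lborel"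
  \<comment> \<open>Boundedness of the candidate derivative is read off from its finite expansion in
    coordinates.\<close>
  have lin: "?F' = (\<lambda>h. \<Sum>b\<in>Basis. (h \<bullet> b) * ?F' b)"
  proof
    fix h
    have "?F' h = (\<integral>y. (\<Sum>b\<in>Basis. (h \<bullet> b) * (U y * frechet_derivative \<psi> (at (x + T y)) b)) \<partial>lborel)"
      by (subst frechet_derivative_components[OF sm]) (simp add: sum_distrib_left mult_ac)
    also have "\<dots> = (\<Sum>b\<in>Basis. (h \<bullet> b) * ?F' b)"
      using i2 by simp
    finally show "?F' h = (\<Sum>b\<in>Basis. (h \<bullet> b) * ?F' b)" .
  qed
  show ?thesis
    unfolding has_derivative_iff_norm tendsto_at_iff_sequentially comp_def
  proof (intro conjI allI impI)
    show "bounded_linear ?F'"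
      by (subst lin) (intro bounded_linear_sum bounded_linear_mult_left
        bounded_linear_compose[OF bounded_linear_mult_left] bounded_linear_inner_left)
  next
    fix X :: "nat \<Rightarrow> 'a" assume X: "\<forall>i. X i \<in> UNIV - {x}" "X \<longlonglongrightarrow> x"
    define q where "q i y = U y * ((\<psi> (X i + T y) - \<psi> (x + T y) - frechet_derivative \<psi> (at (x + T y)) (X i - x)) / norm (X i - x))" for i y
    have [measurable]: "q i \<in> borel_measurable lborel" for i
      unfolding q_def by measurable
    have "(\<lambda>i. \<integral>y. q i y \<partial>lborel) \<longlonglongrightarrow> (\<integral>y. 0 \<partial>(lborel::'a measure))"
    proof (rule integral_dominated_convergence[where w="\<lambda>y. 2 * B * \<bar>U y\<bar>"])
      show "AE y in lborel. (\<lambda>i. q i y) \<longlonglongrightarrow> 0"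
      proof (rule AE_I2)
        fix y
        have lim: "(\<lambda>i. X i + T y) \<longlonglongrightarrow> x + T y" and ne: "\<forall>i. X i + T y \<in> UNIV - {x + T y}"
          using X by (auto intro!: tendsto_intros)
        note * = smooth_has_derivative[OF sm, of "x + T y", unfolded has_derivative_iff_norm tendsto_at_iff_sequentially comp_def]
        have "(\<lambda>i. norm (\<psi> (X i + T y) - \<psi> (x + T y) - frechet_derivative \<psi> (at (x + T y)) (X i + T y - (x + T y))) / norm (X i + T y - (x + T y))) \<longlonglongrightarrow> 0"
          using mp[OF mp[OF spec[OF conjunct2[OF *], of "\<lambda>i. X i + T y"] ne] lim] .
        then have "(\<lambda>i. norm ((\<psi> (X i + T y) - \<psi> (x + T y) - frechet_derivative \<psi> (at (x + T y)) (X i - x)) / norm (X i - x))) \<longlonglongrightarrow> 0"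
          by simp
        then show "(\<lambda>i. q i y) \<longlonglongrightarrow> 0" unfolding q_def
          by (intro tendsto_mult_right_zero) (simp only: tendsto_norm_zero_iff)
      qed
      \<comment> \<open>One \<open>B\<close> bounds the increment of \<open>\<psi>\<close> by the
        mean value inequality, the other bounds its linear part.\<close>
      show "AE y in lborel. norm (q i y) \<le> 2 * B * \<bar>U y\<bar>" for i
      proof (rule AE_I2)
        fix y
        have "\<bar>\<psi> (X i + T y) - \<psi> (x + T y)\<bar> \<le> B * norm (X i - x)"
          using B(3)[of "X i + T y" "x + T y"] by simp
        with B(2)[of "x + T y" "X i - x"]
        have "\<bar>\<psi> (X i + T y) - \<psi> (x + T y) - frechet_derivative \<psi> (at (x + T y)) (X i - x)\<bar> \<le> 2 * B * norm (X i - x)"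
          by linarith
        then have "\<bar>(\<psi> (X i + T y) - \<psi> (x + T y) - frechet_derivative \<psi> (at (x + T y)) (X i - x)) / norm (X i - x)\<bar> \<le> 2 * B"
          using X by (simp add: abs_divide divide_le_eq)
        from mult_left_mono[OF this abs_ge_zero[of "U y"]]
        show "norm (q i y) \<le> 2 * B * \<bar>U y\<bar>"
          unfolding q_def by (simp add: abs_mult mult_ac)
      qed
    qed (use U in auto)
    then have "(\<lambda>i. \<integral>y. q i y \<partial>lborel) \<longlonglongrightarrow> 0" by simp
    then have "(\<lambda>i. norm (\<integral>y. q i y \<partial>lborel)) \<longlonglongrightarrow> 0"
      by (rule tendsto_norm_zero)
    moreover have "norm (\<integral>y. q i y \<partial>lborel) = norm ((\<integral>y. U y * \<psi> (X i + T y) \<partial>lborel) - (\<integral>y. U y * \<psi> (x + T y) \<partial>lborel) - ?F' (X i - x)) / norm (X i - x)" for i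
    proof -
      have "(\<integral>y. q i y \<partial>lborel) = (\<integral>y. (U y * \<psi> (X i + T y) - U y * \<psi> (x + T y) - U y * frechet_derivative \<psi> (at (x + T y)) (X i - x)) / norm (X i - x) \<partial>lborel)"
        unfolding q_def by (simp add: algebra_simps)
      then show ?thesis using i1 i2 by (simp add: abs_divide)
    qed
    ultimately show "(\<lambda>i. norm ((\<integral>y. U y * \<psi> (X i + T y) \<partial>lborel) - (\<integral>y. U y * \<psi> (x + T y) \<partial>lborel) - ?F' (X i - x)) / norm (X i - x)) \<longlonglongrightarrow> 0"
      by simp
  qed
qed

text \<open>The kernel carries the variable \<open>x\<close>, so derivatives fall on it and
  integrability of \<open>g\<close> suffices. The function \<open>g\<close> may be vector valued,
  which allows a gradient to be mollified at once.\<close>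

definition conv :: "('a::euclidean_space \<Rightarrow> 'b::euclidean_space) \<Rightarrow> ('a \<Rightarrow> real) \<Rightarrow> 'a \<Rightarrow> 'b" where
  "conv g \<rho> x = (\<integral>y. \<rho> (x - y) *\<^sub>R g y \<partial>lborel)"

lemma conv_has_derivative:
  fixes g :: "'a::euclidean_space \<Rightarrow> real"
  assumes "integrable lborel g" "test_fun UNIV \<rho>"
  shows "(conv g \<rho> has_derivative (\<lambda>h. conv g (\<lambda>z. frechet_derivative \<rho> (at z) h) x)) (at x)"
  using has_derivative_integral_translate[OF assms, of uminus x]
  by (simp add: conv_def[abs_def] mult.commute)

lemma frechet_derivative_conv:
  fixes g :: "'a::euclidean_space \<Rightarrow> real"
  assumes "integrable lborel g" "test_fun UNIV \<rho>"
  shows "frechet_derivative (conv g \<rho>) (at x) h = conv g (\<lambda>z. frechet_derivative \<rho> (at z) h) x"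
  using frechet_derivative_at[OF conv_has_derivative[OF assms]] by metis

text \<open>Partial derivatives of a convolution are convolutions of the same \<open>g\<close> with
  derivative kernels; the induction therefore has to run over all test kernels.\<close>

lemma smooth_conv:
  fixes g :: "'a::euclidean_space \<Rightarrow> real"
  assumes "integrable lborel g" "test_fun UNIV \<rho>" shows "smooth (conv g \<rho>)"
proof -
  have "Ck k (conv g \<rho>)" for k using assms(2)
  proof (induction k arbitrary: \<rho>)
    case 0
    then show ?case
      using conv_has_derivative[OF assms(1) 0] has_derivative_continuous
      by (force intro: continuous_at_imp_continuous_on)
  next
    case (Suc k)
    then show ?case
      by (intro Ck_SucI[OF conv_has_derivative[OF assms(1)]]) (auto intro!: Suc.IH test_fun_frechet)
  qed
  then show ?thesis by (simp add: smooth_def)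
qed

lemma conv_eq_0:
  assumes "\<And>y. g y \<noteq> 0 \<Longrightarrow> \<rho> (x - y) = 0" shows "conv g \<rho> x = 0"
proof -
  have "(\<lambda>y. \<rho> (x - y) *\<^sub>R g y) = (\<lambda>y. 0)" using assms by (auto simp: fun_eq_iff)
  then show ?thesis by (simp add: conv_def)
qed

lemma integrable_mult_test_fun:
  fixes g :: "'a::euclidean_space \<Rightarrow> 'b::euclidean_space"
  assumes "integrable lborel g" "test_fun U \<rho>" "T \<in> borel_measurable borel"
  shows "integrable lborel (\<lambda>y. \<rho> (T y) *\<^sub>R g y)"
proof -
  obtain B where B: "B > 0" "\<And>x. \<bar>\<rho> x\<bar> \<le> B" using test_fun_bounded[OF assms(2)] by blast
  note [measurable] = borel_measurable_integrable[OF assms(1), simplified] test_fun_measurable[OF assms(2)] assms(3)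
  show ?thesis
    by (rule Bochner_Integration.integrable_bound[of _ "\<lambda>y. B *\<^sub>R g y"])
      (use B assms(1) in \<open>auto intro!: mult_right_mono\<close>)
qed

lemma conv_inner:
  fixes g :: "'a::euclidean_space \<Rightarrow> 'b::euclidean_space"
  assumes "integrable lborel g" "test_fun U \<rho>"
  shows "conv g \<rho> x \<bullet> b = conv (\<lambda>y. g y \<bullet> b) \<rho> x"
  using integrable_mult_test_fun[OF assms, of "\<lambda>y. x - y"]
  by (simp add: conv_def flip: integral_inner_left)

section \<open>Translations and mollification in Lebesgue spaces\<close>

text \<open>The values \<open>c = 1\<close> and \<open>c = -1\<close> are translation and point
  reflection, both of Jacobian modulus 1.\<close>

lemma lborel_distr_affine:
  fixes t :: "'a::euclidean_space"
  assumes "\<bar>c\<bar> = 1" shows "distr lborel borel (\<lambda>x. t + c *\<^sub>R x) = lborel"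
proof -
  have "c \<noteq> 0" using assms by auto
  from lborel_affine[OF this, of t] show ?thesis using assms by (simp add: density_1)
qed

lemma nn_integral_lborel_affine:
  fixes t :: "'a::euclidean_space"
  assumes "\<bar>c\<bar> = 1" "f \<in> borel_measurable borel"
  shows "(\<integral>\<^sup>+x. f (t + c *\<^sub>R x) \<partial>lborel) = (\<integral>\<^sup>+x. f x \<partial>lborel)"
  by (subst (2) lborel_distr_affine[OF assms(1), of t, symmetric])
    (use assms(2) in \<open>simp add: nn_integral_distr\<close>)

lemma integral_lborel_affine:
  fixes t :: "'a::euclidean_space" and f :: "'a \<Rightarrow> 'b::{banach, second_countable_topology}"
  assumes "\<bar>c\<bar> = 1" "f \<in> borel_measurable borel"
  shows "(\<integral>x. f (t + c *\<^sub>R x) \<partial>lborel) = (\<integral>x. f x \<partial>lborel)"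
  by (subst (2) lborel_distr_affine[OF assms(1), of t, symmetric])
    (use assms(2) in \<open>simp add: integral_distr\<close>)

lemma integrable_lborel_affine:
  fixes t :: "'a::euclidean_space" and f :: "'a \<Rightarrow> 'b::{banach, second_countable_topology}"
  assumes "\<bar>c\<bar> = 1" "integrable lborel f"
  shows "integrable lborel (\<lambda>x. f (t + c *\<^sub>R x))"
proof -
  have "integrable (distr lborel borel (\<lambda>x. t + c *\<^sub>R x)) f"
    using lborel_distr_affine[OF assms(1), of t] assms(2) by metis
  then show ?thesis
    by (subst (asm) integrable_distr_eq) (use borel_measurable_integrable[OF assms(2)] in auto)
qed

lemmas integral_lborel_shift = integral_lborel_affine[where c=1, simplified]
lemmas integrable_lborel_shift = integrable_lborel_affine[where c=1, simplified]
lemmas nn_integral_lborel_shift = nn_integral_lborel_affine[where c=1, simplified]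

text \<open>Outer regularity: take an open \<open>T\<close> around \<open>A\<close> with little
  excess measure. Each point of \<open>A\<close> stays in \<open>T\<close> under small shifts, so by
  dominated convergence the part leaving \<open>T\<close> becomes negligible; a point that leaves
  \<open>A\<close> but not \<open>T\<close> lands in \<open>T - A\<close>, which is small.\<close>

lemma indicator_translation_tendsto:
  fixes A :: "'a::euclidean_space set" and X :: "nat \<Rightarrow> 'a"
  assumes A: "A \<in> sets borel" "emeasure lborel A < \<infinity>" and X: "X \<longlonglongrightarrow> 0"
  shows "(\<lambda>n. \<integral>x. indicat_real A x * (1 - indicator A (X n + x)) \<partial>lborel) \<longlonglongrightarrow> 0"
proof (rule LIMSEQ_I)
  fix e :: real assume e: "e > 0"
  obtain T where T: "open T" "A \<subseteq> T" "T - A \<in> lmeasurable" "emeasure lebesgue (T - A) < ennreal (e/2)"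
    using sets_lebesgue_outer_open[of A "e/2"] e A by auto
  have TA: "T - A \<in> sets borel" using T(1) A(1) by auto
  have mTA: "measure lborel (T - A) < e/2" "emeasure lborel (T - A) < \<infinity>"
  proof -
    have "emeasure lborel (T - A) < ennreal (e/2)" using T(4) TA by simp
    then show "emeasure lborel (T - A) < \<infinity>"
      using order.strict_trans by fastforce
    with \<open>emeasure lborel (T - A) < ennreal (e/2)\<close> e show "measure lborel (T - A) < e/2"
      by (simp add: emeasure_eq_ennreal_measure ennreal_less_iff)
  qed
  have [measurable]: "A \<in> sets borel" "T \<in> sets borel" using A T by auto
  have iA: "integrable lborel (indicat_real A)" and iTA: "integrable lborel (indicat_real (T - A))"
    using A TA mTA by (auto simp: integrable_real_indicator)
  have "(\<lambda>n. \<integral>x. indicat_real A x * (1 - indicator T (X n + x)) \<partial>lborel) \<longlonglongrightarrow> (\<integral>x. 0 \<partial>(lborel::'a measure))"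
  proof (rule integral_dominated_convergence[where w="indicat_real A"])
    show "AE x in lborel. (\<lambda>n. indicat_real A x * (1 - indicator T (X n + x))) \<longlonglongrightarrow> 0"
    proof (rule AE_I2)
      fix x
      show "(\<lambda>n. indicat_real A x * (1 - indicator T (X n + x))) \<longlonglongrightarrow> 0"
      proof (cases "x \<in> A")
        case True
        have "(\<lambda>n. X n + x) \<longlonglongrightarrow> x" using tendsto_add[OF X tendsto_const[of x]] by simp
        then have "eventually (\<lambda>n. X n + x \<in> T) sequentially"
          using T(1,2) True topological_tendstoD by blast
        then show ?thesis
          by (intro Lim_transform_eventually[OF tendsto_const]) (erule eventually_mono, simp)
      qed simp
    qed
  qed (use iA in \<open>auto simp: indicator_def\<close>)
  then have "(\<lambda>n. \<integral>x. indicat_real A x * (1 - indicator T (X n + x)) \<partial>lborel) \<longlonglongrightarrow> 0" by simp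
  from LIMSEQ_D[OF this, of "e/2"] e
  obtain N where N: "\<And>n. n \<ge> N \<Longrightarrow> norm (\<integral>x. indicat_real A x * (1 - indicator T (X n + x)) \<partial>lborel) < e/2" by auto
  show "\<exists>N. \<forall>n\<ge>N. norm ((\<integral>x. indicat_real A x * (1 - indicator A (X n + x)) \<partial>lborel) - 0) < e"
  proof (intro exI allI impI)
    fix n assume n: "n \<ge> N"
    have i1: "integrable lborel (\<lambda>x. indicat_real A x * (1 - indicator T (X n + x)))"
      by (rule Bochner_Integration.integrable_bound[OF iA]) (auto simp: indicator_def)
    have i2: "integrable lborel (\<lambda>x. indicat_real (T - A) (X n + x))"
      by (rule integrable_lborel_shift[OF iTA])
    have "(\<integral>x. indicat_real A x * (1 - indicator A (X n + x)) \<partial>lborel) \<le>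
        (\<integral>x. indicat_real A x * (1 - indicator T (X n + x)) + indicat_real (T - A) (X n + x) \<partial>lborel)"
      by (rule integral_mono_AE')
        (use i1 i2 T(2) in \<open>auto simp: indicator_def intro!: AE_I2 Bochner_Integration.integrable_add\<close>)
    also have "\<dots> = (\<integral>x. indicat_real A x * (1 - indicator T (X n + x)) \<partial>lborel) + measure lborel (T - A)"
      using i1 i2 TA by (simp add: integral_lborel_shift[of "indicat_real (T - A)"])
    also have "\<dots> < e" using N[OF n] mTA by auto
    finally show "norm ((\<integral>x. indicat_real A x * (1 - indicator A (X n + x)) \<partial>lborel) - 0) < e"
      by (simp add: indicator_def)
  qed
qed

text \<open>A density argument cast as induction over integrable functions. In the limit case the
  approximation error occurs at \<open>x\<close> and at the shifted point, and invariance of the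
  measure makes both contributions equal.\<close>

lemma L1_translation_tendsto:
  fixes f :: "'a::euclidean_space \<Rightarrow> 'b::euclidean_space"
  assumes "integrable lborel f" "X \<longlonglongrightarrow> 0"
  shows "(\<lambda>n. \<integral>x. norm (f (X n + x) - f x) \<partial>lborel) \<longlonglongrightarrow> 0"
  using assms(1)
proof (induct rule: integrable_induct)
  case (base A c)
  then have A[measurable]: "A \<in> sets borel" by simp
  have X': "(\<lambda>n. - X n) \<longlonglongrightarrow> 0" using tendsto_minus[OF assms(2)] by simp
  \<comment> \<open>The symmetric difference of \<open>A\<close> and its translate splits into two
    one-sided parts; a shift turns the second into \<open>?F (- h)\<close>.\<close>
  let ?F = "\<lambda>h. \<integral>x. indicat_real A x * (1 - indicator A (h + x)) \<partial>lborel"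
  have iA: "integrable lborel (indicat_real A)" using base by (auto simp: integrable_real_indicator)
  have eq: "(\<integral>x. norm (indicat_real A (h + x) *\<^sub>R c - indicator A x *\<^sub>R c) \<partial>lborel) = norm c * (?F h + ?F (- h))" for h
  proof -
    have i: "integrable lborel (\<lambda>x. indicat_real A x * (1 - indicator A (h + x)))" for h
      by (rule Bochner_Integration.integrable_bound[OF iA]) (auto simp: indicator_def)
    have "?F (- h) = (\<integral>x. indicat_real A (h + x) * (1 - indicator A x) \<partial>lborel)"
      by (subst integral_lborel_shift[of _ h, symmetric]) simp_all
    moreover have "integrable lborel (\<lambda>x. indicat_real A (h + x) * (1 - indicator A x))"
      using integrable_lborel_shift[OF i[of "-h"], of h] by simp
    moreover have "norm (indicat_real A (h + x) *\<^sub>R c - indicator A x *\<^sub>R c) =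
        norm c * (indicat_real A x * (1 - indicator A (h + x)) + indicat_real A (h + x) * (1 - indicator A x))" for x
      by (auto simp: indicator_def)
    ultimately show ?thesis using i by simp
  qed
  have "(\<lambda>n. norm c * (?F (X n) + ?F (- X n))) \<longlonglongrightarrow> norm c * (0 + 0)"
    by (intro tendsto_intros indicator_translation_tendsto A base assms(2) X')
  then show ?case by (simp add: eq)
next
  case (add f g)
  note [measurable] = borel_measurable_integrable[OF add(1), simplified] borel_measurable_integrable[OF add(3), simplified]
  have lim: "(\<lambda>n. (\<integral>x. norm (f (X n + x) - f x) \<partial>lborel) + (\<integral>x. norm (g (X n + x) - g x) \<partial>lborel)) \<longlonglongrightarrow> 0"
    using tendsto_add[OF add(2,4)] by simp
  show ?case
  proof (rule tendsto_sandwich[OF _ _ tendsto_const lim])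
    have "integrable lborel (\<lambda>x. norm (f (X n + x) - f x))" "integrable lborel (\<lambda>x. norm (g (X n + x) - g x))" for n
      using add(1,3) integrable_lborel_shift[OF add(1), of "X n"] integrable_lborel_shift[OF add(3), of "X n"]
      by auto
    note i = this
    have "(\<integral>x. norm (f (X n + x) + g (X n + x) - (f x + g x)) \<partial>lborel) \<le>
      (\<integral>x. norm (f (X n + x) - f x) \<partial>lborel) + (\<integral>x. norm (g (X n + x) - g x) \<partial>lborel)" for n
    proof -
      have "(\<integral>x. norm (f (X n + x) + g (X n + x) - (f x + g x)) \<partial>lborel) \<le>
        (\<integral>x. norm (f (X n + x) - f x) + norm (g (X n + x) - g x) \<partial>lborel)"
        by (rule integral_mono_AE')
          (auto intro!: AE_I2 norm_diff_triangle_ineq Bochner_Integration.integrable_add i)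
      then show ?thesis using i[of n] by simp
    qed
    then show "\<forall>\<^sub>F n in sequentially. (\<integral>x. norm (f (X n + x) + g (X n + x) - (f x + g x)) \<partial>lborel)
      \<le> (\<integral>x. norm (f (X n + x) - f x) \<partial>lborel) + (\<integral>x. norm (g (X n + x) - g x) \<partial>lborel)" by simp
  qed simp
next
  case (lim f s)
  note [measurable] = borel_measurable_integrable[OF lim(5), simplified] borel_measurable_integrable[OF lim(1), simplified]
  have "(\<lambda>i. \<integral>x. norm (s i x - f x) \<partial>lborel) \<longlonglongrightarrow> (\<integral>x. 0 \<partial>(lborel::'a measure))"
  proof (rule integral_dominated_convergence[where w="\<lambda>x. 3 * norm (f x)"])
    show "AE x in lborel. (\<lambda>i. norm (s i x - f x)) \<longlonglongrightarrow> 0"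
      using lim(3) by (auto intro!: AE_I2 tendsto_norm_zero LIM_zero)
    show "AE x in lborel. norm (norm (s i x - f x)) \<le> 3 * norm (f x)" for i
    proof (rule AE_I2)
      fix x show "norm (norm (s i x - f x)) \<le> 3 * norm (f x)"
        using lim(4)[of x i] norm_triangle_ineq4[of "s i x" "f x"] by simp
    qed
  qed (use lim(5) in auto)
  then have s: "(\<lambda>i. \<integral>x. norm (s i x - f x) \<partial>lborel) \<longlonglongrightarrow> 0" by simp
  show ?case
  proof (rule LIMSEQ_I)
    fix e :: real assume e: "e > 0"
    obtain i where i: "(\<integral>x. norm (s i x - f x) \<partial>lborel) < e/4"
      using LIMSEQ_D[OF s, of "e/4"] e by auto
    obtain N where N: "\<And>n. n \<ge> N \<Longrightarrow> (\<integral>x. norm (s i (X n + x) - s i x) \<partial>lborel) < e/4"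
      using LIMSEQ_D[OF lim(2)[of i], of "e/4"] e by auto
    have "(\<integral>x. norm (f (X n + x) - f x) \<partial>lborel) < e" if "n \<ge> N" for n
    proof -
      have ii: "integrable lborel (\<lambda>x. norm (s i x - f x))" using lim by auto
      have "norm (f (X n + x) - f x) \<le> norm (s i (X n + x) - f (X n + x)) + norm (s i (X n + x) - s i x) + norm (s i x - f x)" for x
        using norm_triangle_ineq4[of "s i (X n + x) - f (X n + x)" "s i (X n + x) - s i x"]
          norm_triangle_ineq4[of "s i (X n + x) - f (X n + x) - (s i (X n + x) - s i x)" "s i x - f x"]
        by (simp add: algebra_simps) (smt (verit) norm_minus_commute diff_diff_eq2 add.commute add_diff_cancel_left')
      then have "(\<integral>x. norm (f (X n + x) - f x) \<partial>lborel) \<le>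
        (\<integral>x. norm (s i (X n + x) - f (X n + x)) + norm (s i (X n + x) - s i x) + norm (s i x - f x) \<partial>lborel)"
        using lim(1,5) integrable_lborel_shift[OF lim(1)[of i], of "X n"] integrable_lborel_shift[OF lim(5), of "X n"]
        by (intro integral_mono_AE') auto
      also have "\<dots> = (\<integral>x. norm (s i (X n + x) - f (X n + x)) \<partial>lborel) + (\<integral>x. norm (s i (X n + x) - s i x) \<partial>lborel) + (\<integral>x. norm (s i x - f x) \<partial>lborel)"
        using lim(1,5) integrable_lborel_shift[OF lim(1)[of i], of "X n"] integrable_lborel_shift[OF lim(5), of "X n"]
        by simp
      also have "(\<integral>x. norm (s i (X n + x) - f (X n + x)) \<partial>lborel) = (\<integral>x. norm (s i x - f x) \<partial>lborel)"
        by (rule integral_lborel_shift[of "\<lambda>x. norm (s i x - f x)"]) simp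
      finally show ?thesis using N[OF that] i e by simp
    qed
    then show "\<exists>N. \<forall>n\<ge>N. norm ((\<integral>x. norm (f (X n + x) - f x) \<partial>lborel) - 0) < e" by auto
  qed
qed

section \<open>Convexity inequalities for powers and Jensen's inequality\<close>

lemma powr_add_le:
  fixes a b :: real
  assumes "0 \<le> a" "0 \<le> b" "0 \<le> p"
  shows "(a + b) powr p \<le> 2 powr p * (a powr p + b powr p)"
proof -
  have "(a + b) powr p \<le> (2 * max a b) powr p"
    using assms by (intro powr_mono2) auto
  also have "\<dots> = 2 powr p * (max a b powr p)"
    using assms by (simp add: powr_mult)
  also have "\<dots> \<le> 2 powr p * (a powr p + b powr p)"
    by (intro mult_left_mono) (auto simp: max_def)
  finally show ?thesis .
qed

lemma norm_add_powr_le: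
  assumes "0 \<le> p"
  shows "norm (a + b) powr p \<le> 2 powr p * (norm a powr p + norm b powr p)"
  by (rule order_trans[OF powr_mono2 powr_add_le]) (use assms norm_triangle_ineq in auto)

lemma norm_diff_powr_le:
  assumes "0 \<le> p"
  shows "norm (a - b) powr p \<le> 2 powr p * (norm a powr p + norm b powr p)"
  using norm_add_powr_le[OF assms, of a "-b"] by simp

lemma le_1_plus_powr: "0 \<le> a \<Longrightarrow> 1 \<le> p \<Longrightarrow> a \<le> 1 + a powr p" for a :: real
  using powr_mono[of 1 p a] by (cases "a \<le> 1") (auto intro: add_increasing2)

text \<open>Convexity of the power in tangent form, obtained from Young's inequality with exponents
  \<open>p\<close> and \<open>p / (p - 1)\<close>. It drives Jensen's inequality and also produces
  the factor \<open>p / 2\<close> in the monotonicity of \<open>H\<close>.\<close>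

lemma powr_above_tangent:
  fixes c y :: real
  assumes "0 \<le> c" "0 \<le> y" "1 \<le> p"
  shows "c powr p + p * c powr (p - 1) * (y - c) \<le> y powr p"
proof (cases "p = 1 \<or> c = 0")
  case True
  then show ?thesis using assms by (cases "c = 0") (auto simp: powr_one)
next
  case False
  then have p: "p > 1" and c: "c > 0" using assms by auto
  have "y * c powr (p - 1) \<le> y powr p / p + (c powr (p - 1)) powr (p / (p - 1)) / (p / (p - 1))"
    using p assms by (intro Youngs_inequality) (auto simp: field_simps)
  then have "y * c powr (p - 1) \<le> y powr p / p + c powr p * (p - 1) / p"
    using p by (simp add: powr_powr)
  then have "p * (y * c powr (p - 1)) \<le> p * (y powr p / p + c powr p * (p - 1) / p)"
    using p by (intro mult_left_mono) auto
  also have "\<dots> = y powr p + c powr p * (p - 1)"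
    using p by (simp add: field_simps)
  finally have "p * (y * c powr (p - 1)) \<le> y powr p + c powr p * (p - 1)" .
  moreover have "c powr p = c * c powr (p - 1)"
    using c powr_mult_base[of c "p - 1"] by simp
  ultimately show ?thesis by (simp add: algebra_simps)
qed

text \<open>Integrate the tangent inequality at the mean value \<open>c\<close> against the
  probability density \<open>\<rho>\<close>; the linear term integrates to zero. With a nonnegative
  integral on the right, the case of infinite right-hand side is included, which is what the later
  use of Tonelli's theorem requires.\<close>

lemma jensen_powr:
  fixes \<rho> y :: "'a \<Rightarrow> real"
  assumes p: "1 \<le> p" and \<rho>: "integrable M \<rho>" "\<And>z. 0 \<le> \<rho> z" "integral\<^sup>L M \<rho> = 1"
    and y[measurable]: "y \<in> borel_measurable M" "\<And>z. 0 \<le> y z" "integrable M (\<lambda>z. \<rho> z * y z)"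
  shows "ennreal ((\<integral>z. \<rho> z * y z \<partial>M) powr p) \<le> (\<integral>\<^sup>+z. ennreal (\<rho> z * y z powr p) \<partial>M)"
proof (cases "(\<integral>\<^sup>+z. ennreal (\<rho> z * y z powr p) \<partial>M) = \<infinity>")
  case False
  note [measurable] = borel_measurable_integrable[OF \<rho>(1)]
  have i: "integrable M (\<lambda>z. \<rho> z * y z powr p)"
    using False \<rho> y by (intro integrableI_nonneg) (auto simp: top.not_eq_extremum)
  define c where "c = (\<integral>z. \<rho> z * y z \<partial>M)"
  have c: "c \<ge> 0" unfolding c_def using \<rho> y by simp
  have i2: "integrable M (\<lambda>z. p * c powr (p - 1) * (\<rho> z * y z))"
    "integrable M (\<lambda>z. (c powr p - p * c powr (p - 1) * c) * \<rho> z)"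
    using \<rho> y by auto
  have "c powr p = (\<integral>z. p * c powr (p - 1) * (\<rho> z * y z) + (c powr p - p * c powr (p - 1) * c) * \<rho> z \<partial>M)"
    using i2 \<rho>(3) by (simp add: c_def[symmetric])
  also have "\<dots> \<le> (\<integral>z. \<rho> z * y z powr p \<partial>M)"
  proof (rule integral_mono[OF Bochner_Integration.integrable_add[OF i2] i])
    fix z
    have "\<rho> z * (c powr p + p * c powr (p - 1) * (y z - c)) \<le> \<rho> z * y z powr p"
      by (intro mult_left_mono powr_above_tangent c y \<rho> p)
    then show "p * c powr (p - 1) * (\<rho> z * y z) + (c powr p - p * c powr (p - 1) * c) * \<rho> z \<le> \<rho> z * y z powr p"
      by (simp add: algebra_simps)
  qed
  finally show ?thesis unfolding c_def[symmetric]
    by (subst nn_integral_eq_integral[OF i]) (use \<rho> y in \<open>auto intro!: ennreal_leI\<close>)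
qed simp

lemma Lp_compact_support_integrable:
  fixes f :: "'a::euclidean_space \<Rightarrow> 'b::euclidean_space"
  assumes "1 \<le> p" and [measurable]: "f \<in> borel_measurable borel" and "integrable lborel (\<lambda>x. norm (f x) powr p)"
    and K: "compact K" "\<And>x. x \<notin> K \<Longrightarrow> f x = 0"
  shows "integrable lborel f"
proof (rule Bochner_Integration.integrable_bound)
  have "emeasure lborel K < \<infinity>" using K(1) by (rule emeasure_compact_finite)
  then show "integrable lborel (\<lambda>x. indicat_real K x + norm (f x) powr p)"
    using assms(3) K(1) by (auto simp: integrable_real_indicator borel_compact)
  show "AE x in lborel. norm (f x) \<le> norm (indicat_real K x + norm (f x) powr p)"
    using K(2) le_1_plus_powr[OF norm_ge_zero assms(1)] by (auto intro!: AE_I2 simp: indicator_def)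
qed simp

section \<open>Continuity of translations and convergence of mollifications in
  \<open>Lp\<close>\<close>

text \<open>Reduction to the \<open>L1\<close> case: approximate \<open>f\<close> by simple
  functions, which are bounded and, thanks to the compact support, integrable. For a function
  bounded by \<open>B\<close> the \<open>p\<close>-th power of a difference is at most
  \<open>(2 * B) powr (p - 1)\<close> times the difference itself.\<close>

lemma Lp_translation_tendsto:
  fixes f :: "'a::euclidean_space \<Rightarrow> 'b::euclidean_space"
  assumes p: "1 \<le> p" and [measurable]: "f \<in> borel_measurable borel" and f: "integrable lborel (\<lambda>x. norm (f x) powr p)"
    and K: "compact K" "\<And>x. x \<notin> K \<Longrightarrow> f x = 0" and X: "X \<longlonglongrightarrow> 0"
  shows "(\<lambda>n. \<integral>x. norm (f (X n + x) - f x) powr p \<partial>lborel) \<longlonglongrightarrow> 0"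
proof -
  obtain s where s: "\<And>i. simple_function lborel (s i)" "\<And>x. (\<lambda>i. s i x) \<longlonglongrightarrow> f x" "\<And>i x. norm (s i x) \<le> 2 * norm (f x)"
    using borel_measurable_implies_sequence_metric[of f lborel 0] by (auto simp: assms)
  have [measurable]: "s i \<in> borel_measurable borel" for i
    using borel_measurable_simple_function[OF s(1)[of i]] by simp
  have s0: "s i x = 0" if "x \<notin> K" for i x using s(3)[of i x] K(2)[OF that] by simp
  have "\<exists>B>0. \<forall>x. norm (s i x) \<le> B" for i
  proof -
    have "finite (range (s i))" using simple_functionD(1)[OF s(1)[of i]] by simp
    then have "bounded (range (s i))" by (rule finite_imp_bounded)
    then show ?thesis by (auto simp: bounded_pos)
  qed
  then obtain B where B: "\<And>i. B i > 0" "\<And>i x. norm (s i x) \<le> B i" by metis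
  have fin: "emeasure lborel K < \<infinity>" using K(1) by (rule emeasure_compact_finite)
  have iK: "integrable lborel (indicat_real K)"
    using fin K(1) by (auto simp: integrable_real_indicator borel_compact)
  have isi: "integrable lborel (s i)" for i
  proof (rule Bochner_Integration.integrable_bound)
    show "integrable lborel (\<lambda>x. B i * indicat_real K x)" using iK by simp
    show "AE x in lborel. norm (s i x) \<le> norm (B i * indicat_real K x)"
      using B(1)[of i] B(2)[of i] s0 by (auto simp: indicator_def intro!: AE_I2)
  qed simp
  have isp: "integrable lborel (\<lambda>x. norm (s i x - f x) powr p)" for i
  proof (rule Bochner_Integration.integrable_bound)
    show "integrable lborel (\<lambda>x. 3 powr p * norm (f x) powr p)" using f by simp
    show "AE x in lborel. norm (norm (s i x - f x) powr p) \<le> norm (3 powr p * norm (f x) powr p)"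
    proof (rule AE_I2)
      fix x
      have "norm (s i x - f x) \<le> 3 * norm (f x)"
        using s(3)[of i x] norm_triangle_ineq4[of "s i x" "f x"] by simp
      then have "norm (s i x - f x) powr p \<le> (3 * norm (f x)) powr p" using p by (intro powr_mono2) auto
      then show "norm (norm (s i x - f x) powr p) \<le> norm (3 powr p * norm (f x) powr p)"
        by (simp add: powr_mult)
    qed
  qed simp
  have "(\<lambda>i. \<integral>x. norm (s i x - f x) powr p \<partial>lborel) \<longlonglongrightarrow> (\<integral>x. 0 \<partial>(lborel::'a measure))"
  proof (rule integral_dominated_convergence[where w="\<lambda>x. 3 powr p * norm (f x) powr p"])
    show "AE x in lborel. (\<lambda>i. norm (s i x - f x) powr p) \<longlonglongrightarrow> 0"
    proof (rule AE_I2)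
      fix x
      have "(\<lambda>i. norm (s i x - f x)) \<longlonglongrightarrow> 0" using s(2) by (auto intro!: tendsto_norm_zero LIM_zero)
      then show "(\<lambda>i. norm (s i x - f x) powr p) \<longlonglongrightarrow> 0"
        using p by (intro tendsto_zero_powrI[where b=p]) auto
    qed
    show "AE x in lborel. norm (norm (s i x - f x) powr p) \<le> 3 powr p * norm (f x) powr p" for i
    proof (rule AE_I2)
      fix x
      have "norm (s i x - f x) \<le> 3 * norm (f x)"
        using s(3)[of i x] norm_triangle_ineq4[of "s i x" "f x"] by simp
      then have "norm (s i x - f x) powr p \<le> (3 * norm (f x)) powr p" using p by (intro powr_mono2) auto
      then show "norm (norm (s i x - f x) powr p) \<le> 3 powr p * norm (f x) powr p"
        by (simp add: powr_mult)
    qed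
  qed (use f in auto)
  then have lim_s: "(\<lambda>i. \<integral>x. norm (s i x - f x) powr p \<partial>lborel) \<longlonglongrightarrow> 0" by simp
  show ?thesis
  proof (rule LIMSEQ_I)
    fix e :: real assume e: "e > 0"
    define c where "c = (2::real) powr p"
    have c: "c > 0" by (simp add: c_def)
    \<comment> \<open>Splitting into three parts by two applications of the quasi-triangle
      inequality gives \<open>c * d + 2 * c * c * d\<close>, and this is at most
      \<open>2 * (c * c + c) * d = e / 2\<close>.\<close>
    define d where "d = e / (4 * (c * c + c))"
    have cc: "c * c + c > 0" using c by (simp add: add_pos_pos)
    have d: "d > 0" unfolding d_def using e cc by (intro divide_pos_pos mult_pos_pos) auto
    obtain i where i: "(\<integral>x. norm (s i x - f x) powr p \<partial>lborel) < d"
      using LIMSEQ_D[OF lim_s d] by auto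
    have b1: "norm (s i (h + x) - s i x) powr p \<le> (2 * B i) powr (p - 1) * norm (s i (h + x) - s i x)" for h x
    proof -
      have "norm (s i (h + x) - s i x) \<le> 2 * B i"
        using B(2)[of i "h + x"] B(2)[of i x] norm_triangle_ineq4[of "s i (h + x)" "s i x"] by linarith
      then have "norm (s i (h + x) - s i x) powr (p - 1) \<le> (2 * B i) powr (p - 1)"
        using p by (intro powr_mono2) auto
      from mult_right_mono[OF this norm_ge_zero[of "s i (h + x) - s i x"]]
      show ?thesis
        using powr_mult_base[of "norm (s i (h + x) - s i x)" "p - 1"] by (simp add: mult.commute)
    qed
    have ish: "integrable lborel (\<lambda>x. norm (s i (h + x) - s i x))" for h
      using isi integrable_lborel_shift[OF isi[of i], of h] by auto
    have iss: "integrable lborel (\<lambda>x. norm (s i (h + x) - s i x) powr p)" for h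
      by (rule Bochner_Integration.integrable_bound[of _ "\<lambda>x. (2 * B i) powr (p - 1) * norm (s i (h + x) - s i x)"])
        (use ish b1 in auto)
    have "(\<lambda>n. (2 * B i) powr (p - 1) * (\<integral>x. norm (s i (X n + x) - s i x) \<partial>lborel)) \<longlonglongrightarrow> 0"
      using tendsto_mult_right_zero[OF L1_translation_tendsto[OF isi X]] by simp
    from LIMSEQ_D[OF this d] obtain N where
      N: "\<And>n. n \<ge> N \<Longrightarrow> \<bar>(2 * B i) powr (p - 1) * (\<integral>x. norm (s i (X n + x) - s i x) \<partial>lborel)\<bar> < d" by auto
    have "(\<integral>x. norm (f (X n + x) - f x) powr p \<partial>lborel) < e" if "n \<ge> N" for n
    proof -
      let ?h = "X n"
      have "(\<integral>x. norm (s i (?h + x) - s i x) powr p \<partial>lborel) \<le> (\<integral>x. (2 * B i) powr (p - 1) * norm (s i (?h + x) - s i x) \<partial>lborel)"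
        using iss ish b1 by (intro integral_mono) auto
      also have "\<dots> < d" using N[OF that] by simp
      finally have 2: "(\<integral>x. norm (s i (?h + x) - s i x) powr p \<partial>lborel) < d" .
      have ish2: "integrable lborel (\<lambda>x. norm (s i (?h + x) - f (?h + x)) powr p)"
        by (rule integrable_lborel_shift[OF isp])
      have pw: "norm (f (?h + x) - f x) powr p \<le> c * (norm (s i (?h + x) - f (?h + x)) powr p) +
        (c * c * (norm (s i (?h + x) - s i x) powr p) + c * c * (norm (s i x - f x) powr p))" for x
      proof -
        have "norm (f (?h + x) - f x) powr p = norm ((f (?h + x) - s i (?h + x)) + ((s i (?h + x) - s i x) + (s i x - f x))) powr p" by simp
        also have "\<dots> \<le> c * (norm (f (?h + x) - s i (?h + x)) powr p + norm ((s i (?h + x) - s i x) + (s i x - f x)) powr p)"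
          unfolding c_def using p by (intro norm_add_powr_le) auto
        also have "\<dots> \<le> c * (norm (f (?h + x) - s i (?h + x)) powr p + c * (norm (s i (?h + x) - s i x) powr p + norm (s i x - f x) powr p))"
          using c p unfolding c_def by (intro mult_left_mono add_left_mono norm_add_powr_le) auto
        finally show ?thesis by (simp add: algebra_simps norm_minus_commute)
      qed
      have "(\<integral>x. norm (f (?h + x) - f x) powr p \<partial>lborel) \<le> (\<integral>x. c * (norm (s i (?h + x) - f (?h + x)) powr p) +
        (c * c * (norm (s i (?h + x) - s i x) powr p) + c * c * (norm (s i x - f x) powr p)) \<partial>lborel)"
        using ish2 iss isp pw c by (intro integral_mono_AE') (auto intro!: AE_I2)
      also have "\<dots> = c * (\<integral>x. norm (s i (?h + x) - f (?h + x)) powr p \<partial>lborel) +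
        (c * c * (\<integral>x. norm (s i (?h + x) - s i x) powr p \<partial>lborel) + c * c * (\<integral>x. norm (s i x - f x) powr p \<partial>lborel))"
        using ish2 iss isp by simp
      also have "(\<integral>x. norm (s i (?h + x) - f (?h + x)) powr p \<partial>lborel) = (\<integral>x. norm (s i x - f x) powr p \<partial>lborel)"
        by (rule integral_lborel_shift[of "\<lambda>x. norm (s i x - f x) powr p"]) simp
      also have "c * (\<integral>x. norm (s i x - f x) powr p \<partial>lborel) +
        (c * c * (\<integral>x. norm (s i (?h + x) - s i x) powr p \<partial>lborel) + c * c * (\<integral>x. norm (s i x - f x) powr p \<partial>lborel))
         \<le> c * d + (c * c * d + c * c * d)"
        using i 2 c by (intro add_mono mult_left_mono) auto
      also have "\<dots> \<le> 2 * (c * c + c) * d" using c d by (simp add: algebra_simps)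
      also have "\<dots> = e / 2"
      proof -
        have "4 * (c * c + c) \<noteq> 0" using cc by simp
        then have "4 * (c * c + c) * d = e" unfolding d_def by (metis nonzero_mult_div_cancel_left times_divide_eq_right)
        then show ?thesis by (simp add: algebra_simps)
      qed
      finally show ?thesis using e by simp
    qed
    then show "\<exists>N. \<forall>n\<ge>N. norm ((\<integral>x. norm (f (X n + x) - f x) powr p \<partial>lborel) - 0) < e" by auto
  qed
qed

lemma conv_alt:
  fixes g :: "'a::euclidean_space \<Rightarrow> 'b::euclidean_space"
  assumes [measurable]: "g \<in> borel_measurable borel" "\<rho> \<in> borel_measurable borel"
  shows "conv g \<rho> x = (\<integral>z. \<rho> z *\<^sub>R g (x - z) \<partial>lborel)"
  unfolding conv_def
  using integral_lborel_affine[of "-1" "\<lambda>y. \<rho> (x - y) *\<^sub>R g y" x] by simp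

lemma conv_measurable [measurable]:
  fixes g :: "'a::euclidean_space \<Rightarrow> 'b::euclidean_space"
  assumes [measurable]: "g \<in> borel_measurable borel" "\<rho> \<in> borel_measurable borel"
  shows "conv g \<rho> \<in> borel_measurable borel"
proof -
  have "(\<lambda>x. \<integral>y. \<rho> (x - y) *\<^sub>R g y \<partial>lborel) \<in> borel_measurable borel"
    by measurable
  then show ?thesis by (simp add: conv_def[abs_def])
qed

text \<open>A mollification is an average of translates. Jensen's inequality moves the power inside
  the average, Tonelli's theorem exchanges the integrals, and the error is at most the worst
  translation error among shifts shorter than \<open>\<epsilon>\<close>.\<close>

lemma conv_Lp_le:
  fixes g :: "'a::euclidean_space \<Rightarrow> 'b::euclidean_space"
  assumes p: "1 \<le> p" and \<rho>: "mollifier \<epsilon> \<rho>" and g: "integrable lborel g"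
    and \<omega>: "\<And>h. norm h < \<epsilon> \<Longrightarrow> (\<integral>\<^sup>+x. ennreal (norm (g (h + x) - g x) powr p) \<partial>lborel) \<le> c"
  shows "(\<integral>\<^sup>+x. ennreal (norm (conv g \<rho> x - g x) powr p) \<partial>lborel) \<le> c"
proof -
  note t = mollifier_test_fun[OF \<rho>]
  note [measurable] = test_fun_measurable[OF t] borel_measurable_integrable[OF g, simplified]
  have \<rho>0: "\<rho> z \<ge> 0" "\<epsilon> \<le> norm z \<Longrightarrow> \<rho> z = 0" "integral\<^sup>L lborel \<rho> = 1" for z
    using \<rho> by (auto simp: mollifier_def)
  have i\<rho>: "integrable lborel \<rho>" by (rule test_fun_integrable[OF t])
  have "ennreal (norm (conv g \<rho> x - g x) powr p) \<le> (\<integral>\<^sup>+z. ennreal (\<rho> z * norm (g (x - z) - g x) powr p) \<partial>lborel)" for x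
  proof -
    have "integrable lborel (\<lambda>z. \<rho> (x - (x + (-1) *\<^sub>R z)) *\<^sub>R g (x + (-1) *\<^sub>R z))"
      by (rule integrable_lborel_affine[of "-1" "\<lambda>y. \<rho> (x - y) *\<^sub>R g y"])
        (auto intro!: integrable_mult_test_fun[OF g t])
    then have i: "integrable lborel (\<lambda>z. \<rho> z *\<^sub>R g (x - z))" by simp
    have i2: "integrable lborel (\<lambda>z. \<rho> z *\<^sub>R (g (x - z) - g x))"
      using i i\<rho> by (simp add: scaleR_diff_right)
    have "conv g \<rho> x - g x = (\<integral>z. \<rho> z *\<^sub>R (g (x - z) - g x) \<partial>lborel)"
      using i i\<rho> \<rho>0(3) by (simp add: conv_alt scaleR_diff_right)
    then have "norm (conv g \<rho> x - g x) \<le> (\<integral>z. \<rho> z * norm (g (x - z) - g x) \<partial>lborel)"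
      using integral_norm_bound[of lborel "\<lambda>z. \<rho> z *\<^sub>R (g (x - z) - g x)"] \<rho>0(1) by simp
    then have "ennreal (norm (conv g \<rho> x - g x) powr p) \<le> ennreal ((\<integral>z. \<rho> z * norm (g (x - z) - g x) \<partial>lborel) powr p)"
      using p by (intro ennreal_leI powr_mono2) auto
    also have "\<dots> \<le> (\<integral>\<^sup>+z. ennreal (\<rho> z * norm (g (x - z) - g x) powr p) \<partial>lborel)"
      using integrable_norm[OF i2] \<rho>0 by (intro jensen_powr p i\<rho>) auto
    finally show ?thesis .
  qed
  then have "(\<integral>\<^sup>+x. ennreal (norm (conv g \<rho> x - g x) powr p) \<partial>lborel) \<le>
    (\<integral>\<^sup>+x. (\<integral>\<^sup>+z. ennreal (\<rho> z * norm (g (x - z) - g x) powr p) \<partial>lborel) \<partial>lborel)"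
    by (intro nn_integral_mono) auto
  also have "\<dots> = (\<integral>\<^sup>+z. (\<integral>\<^sup>+x. ennreal (\<rho> z * norm (g (x - z) - g x) powr p) \<partial>lborel) \<partial>lborel)"
    by (rule lborel_pair.Fubini'[symmetric]) measurable
  also have "\<dots> \<le> (\<integral>\<^sup>+z. ennreal (\<rho> z) * c \<partial>lborel)"
  proof (intro nn_integral_mono)
    fix z
    show "(\<integral>\<^sup>+x. ennreal (\<rho> z * norm (g (x - z) - g x) powr p) \<partial>lborel) \<le> ennreal (\<rho> z) * c"
    proof (cases "norm z < \<epsilon>")
      case True
      have "(\<integral>\<^sup>+x. ennreal (\<rho> z * norm (g (x - z) - g x) powr p) \<partial>lborel) = ennreal (\<rho> z) * (\<integral>\<^sup>+x. ennreal (norm (g (- z + x) - g x) powr p) \<partial>lborel)"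
        using \<rho>0(1) by (simp add: ennreal_mult nn_integral_cmult)
      then show ?thesis using \<omega>[of "-z"] True by (auto intro: mult_left_mono)
    qed (use \<rho>0(2)[of z] in simp)
  qed
  also have "\<dots> = c"
    using \<rho>0 by (simp add: nn_integral_multc nn_integral_eq_integral[OF i\<rho>])
  finally show ?thesis .
qed

lemma Lp_translation_le:
  fixes g :: "'a::euclidean_space \<Rightarrow> 'b::euclidean_space"
  assumes p: "0 \<le> p" and [measurable]: "g \<in> borel_measurable borel" and g: "integrable lborel (\<lambda>x. norm (g x) powr p)"
  shows "integrable lborel (\<lambda>x. norm (g (h + x) - g x) powr p)"
    "(\<integral>x. norm (g (h + x) - g x) powr p \<partial>lborel) \<le> 2 * 2 powr p * (\<integral>x. norm (g x) powr p \<partial>lborel)"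
proof -
  note gh = integrable_lborel_shift[OF g, of h]
  have i: "integrable lborel (\<lambda>x. 2 powr p * (norm (g (h + x)) powr p + norm (g x) powr p))"
    using g gh by auto
  note pw = norm_diff_powr_le[OF p]
  show 1: "integrable lborel (\<lambda>x. norm (g (h + x) - g x) powr p)"
    by (rule Bochner_Integration.integrable_bound[OF i]) (use pw in auto)
  have "(\<integral>x. norm (g (h + x) - g x) powr p \<partial>lborel) \<le> (\<integral>x. 2 powr p * (norm (g (h + x)) powr p + norm (g x) powr p) \<partial>lborel)"
    by (rule integral_mono[OF 1 i pw])
  also have "\<dots> = 2 powr p * ((\<integral>x. norm (g (h + x)) powr p \<partial>lborel) + (\<integral>x. norm (g x) powr p \<partial>lborel))"
    using g gh by simp
  also have "(\<integral>x. norm (g (h + x)) powr p \<partial>lborel) = (\<integral>x. norm (g x) powr p \<partial>lborel)"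
    by (rule integral_lborel_shift[of "\<lambda>x. norm (g x) powr p"]) simp
  finally show "(\<integral>x. norm (g (h + x) - g x) powr p \<partial>lborel) \<le> 2 * 2 powr p * (\<integral>x. norm (g x) powr p \<partial>lborel)"
    by simp
qed

lemma conv_Lp_tendsto:
  fixes g :: "'a::euclidean_space \<Rightarrow> 'b::euclidean_space"
  assumes p: "1 \<le> p" and gm[measurable]: "g \<in> borel_measurable borel" and g: "integrable lborel (\<lambda>x. norm (g x) powr p)"
    and K: "compact K" "\<And>x. x \<notin> K \<Longrightarrow> g x = 0"
    and \<rho>: "\<And>n. mollifier (\<epsilon> n) (\<rho> n)" and \<epsilon>: "\<epsilon> \<longlonglongrightarrow> 0"
  shows "\<And>n. integrable lborel (\<lambda>x. norm (conv g (\<rho> n) x - g x) powr p)"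
    "(\<lambda>n. \<integral>x. norm (conv g (\<rho> n) x - g x) powr p \<partial>lborel) \<longlonglongrightarrow> 0"
proof -
  note ig = Lp_compact_support_integrable[OF p gm g K]
  have [measurable]: "\<rho> n \<in> borel_measurable borel" for n
    using test_fun_measurable[OF mollifier_test_fun[OF \<rho>]] .
  have p0: "0 \<le> p" using p by simp
  note tr = Lp_translation_le[OF p0 gm g]
  have nn: "(\<integral>\<^sup>+x. ennreal (norm (g (h + x) - g x) powr p) \<partial>lborel) = ennreal (\<integral>x. norm (g (h + x) - g x) powr p \<partial>lborel)" for h
    by (rule nn_integral_eq_integral[OF tr(1)]) simp
  show I: "integrable lborel (\<lambda>x. norm (conv g (\<rho> n) x - g x) powr p)" for n
  proof (rule integrableI_nonneg)
    have "(\<integral>\<^sup>+x. ennreal (norm (conv g (\<rho> n) x - g x) powr p) \<partial>lborel) \<le> ennreal (2 * 2 powr p * (\<integral>x. norm (g x) powr p \<partial>lborel))"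
      by (rule conv_Lp_le[OF p \<rho> ig]) (use nn tr(2) in \<open>auto intro: ennreal_leI\<close>)
    then show "(\<integral>\<^sup>+x. ennreal (norm (conv g (\<rho> n) x - g x) powr p) \<partial>lborel) < \<infinity>"
      by (auto intro: le_less_trans)
  qed auto
  show "(\<lambda>n. \<integral>x. norm (conv g (\<rho> n) x - g x) powr p \<partial>lborel) \<longlonglongrightarrow> 0"
  proof (rule LIMSEQ_I)
    fix e :: real assume e: "e > 0"
    \<comment> \<open>The bound on the mollification error has to hold for all short shifts at once,
      so sequential continuity is converted into a statement about a neighbourhood of 0.\<close>
    have "\<forall>\<^sub>F h in nhds 0. (\<integral>x. norm (g (h + x) - g x) powr p \<partial>lborel) < e / 2"
    proof (rule sequentially_imp_eventually_nhds_within[where s=UNIV, simplified], intro allI impI)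
      fix X :: "nat \<Rightarrow> 'a" assume "X \<longlonglongrightarrow> 0"
      from Lp_translation_tendsto[OF p gm g K this]
      show "\<forall>\<^sub>F n in sequentially. (\<integral>x. norm (g (X n + x) - g x) powr p \<partial>lborel) < e / 2"
        by (rule order_tendstoD(2)[OF _ half_gt_zero[OF e]])
    qed
    then obtain d where d: "d > 0" "\<And>h. norm h < d \<Longrightarrow> (\<integral>x. norm (g (h + x) - g x) powr p \<partial>lborel) < e / 2"
      unfolding eventually_nhds_metric by (auto simp: dist_norm)
    obtain N where N: "\<And>n. n \<ge> N \<Longrightarrow> \<epsilon> n < d"
      using order_tendstoD(2)[OF \<epsilon> d(1)] unfolding eventually_sequentially by auto
    have "(\<integral>x. norm (conv g (\<rho> n) x - g x) powr p \<partial>lborel) < e" if "n \<ge> N" for n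
    proof -
      have "(\<integral>\<^sup>+x. ennreal (norm (conv g (\<rho> n) x - g x) powr p) \<partial>lborel) \<le> ennreal (e / 2)"
      proof (rule conv_Lp_le[OF p \<rho> ig])
        fix h :: 'a assume "norm h < \<epsilon> n"
        with N[OF that] have "norm h < d" by simp
        from d(2)[OF this] show "(\<integral>\<^sup>+x. ennreal (norm (g (h + x) - g x) powr p) \<partial>lborel) \<le> ennreal (e / 2)"
          unfolding nn by (intro ennreal_leI) simp
      qed
      then have "(\<integral>x. norm (conv g (\<rho> n) x - g x) powr p \<partial>lborel) \<le> e / 2"
        using nn_integral_eq_integral[OF I] e by (simp add: ennreal_le_iff)
      then show ?thesis using e by simp
    qed
    then show "\<exists>N. \<forall>n\<ge>N. norm ((\<integral>x. norm (conv g (\<rho> n) x - g x) powr p \<partial>lborel) - 0) < e" by auto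
  qed
qed

section \<open>Algebraic inequalities for the degenerate field\<close>

text \<open>The field \<open>H\<close> depends only on \<open>excess \<xi>\<close>, the difference of \<open>\<xi>\<close> and its projection to
  the closed unit ball.\<close>

definition excess :: "'a::euclidean_space \<Rightarrow> 'a" where
  "excess \<xi> = max (norm \<xi> - 1) 0 *\<^sub>R (\<xi> /\<^sub>R norm \<xi>)"

lemma norm_excess: "norm (excess \<xi>) = max (norm \<xi> - 1) 0"
  by (cases "\<xi> = 0") (auto simp: excess_def)

lemma norm_excess_le: "norm (excess \<xi>) \<le> norm \<xi>"
  by (simp add: norm_excess)

text \<open>This makes \<open>H\<close> the plain power field composed with \<open>excess\<close>,
  without any case distinction at the unit sphere or at the origin.\<close>

lemma H_eq_excess: "H \<gamma> \<xi> = norm (excess \<xi>) powr (\<gamma> - 1) *\<^sub>R excess \<xi>"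
proof (cases "norm \<xi> \<le> 1")
  case True
  then show ?thesis by (auto simp: H_def norm_excess excess_def)
next
  case False
  define s where "s = norm \<xi> - 1"
  have s: "s > 0" "max (norm \<xi> - 1) 0 = s" using False by (auto simp: s_def)
  have "s powr \<gamma> = s powr (\<gamma> - 1) * s" using powr_mult_base[of s "\<gamma> - 1"] s by (simp add: mult.commute)
  moreover have "\<xi> \<noteq> 0" using False by auto
  ultimately show ?thesis unfolding H_def norm_excess unfolding excess_def by (simp add: s)
qed

lemma norm_H: "norm (H \<gamma> \<xi>) = norm (excess \<xi>) powr \<gamma>"
  using powr_mult_base[of "norm (excess \<xi>)" "\<gamma> - 1"] by (simp add: H_eq_excess mult.commute)

lemma norm_projection_le: "norm (\<xi> - excess \<xi>) \<le> 1"
proof (cases "\<xi> = 0")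
  case False
  define s where "s = max (norm \<xi> - 1) 0 / norm \<xi>"
  have "\<xi> - excess \<xi> = (1 - s) *\<^sub>R \<xi>"
    by (simp add: excess_def s_def scaleR_left_diff_distrib divide_inverse)
  moreover have "s * norm \<xi> = max (norm \<xi> - 1) 0" "s \<le> 1" using False by (auto simp: s_def)
  moreover from \<open>s \<le> 1\<close> have "norm ((1 - s) *\<^sub>R \<xi>) = norm \<xi> - s * norm \<xi>"
    by (simp add: left_diff_distrib)
  ultimately show ?thesis by simp
qed (simp add: excess_def)

text \<open>The variational inequality of the nearest-point projection: \<open>excess \<xi>\<close>
  is an outer normal of the unit ball at the projected point
  \<open>\<xi> - excess \<xi>\<close>.\<close>

lemma excess_inner_projection:
  assumes "norm z \<le> 1" shows "excess \<xi> \<bullet> z \<le> excess \<xi> \<bullet> (\<xi> - excess \<xi>)"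
proof -
  have "excess \<xi> \<bullet> z \<le> norm (excess \<xi>)"
    using norm_cauchy_schwarz[of "excess \<xi>" z] assms mult_left_mono[OF assms norm_ge_zero[of "excess \<xi>"]] by simp
  also have "\<dots> = excess \<xi> \<bullet> (\<xi> - excess \<xi>)"
  proof (cases "norm \<xi> \<le> 1")
    case False
    then have "\<xi> \<noteq> 0" by auto
    then have "excess \<xi> \<bullet> \<xi> = (norm \<xi> - 1) * norm \<xi>"
      using False by (simp add: excess_def dot_square_norm power2_eq_square divide_inverse)
    moreover have "excess \<xi> \<bullet> excess \<xi> = (norm \<xi> - 1)\<^sup>2"
      using False by (simp add: dot_square_norm norm_excess)
    ultimately show ?thesis using False by (simp add: inner_diff_right norm_excess power2_eq_square algebra_simps)
  qed (simp add: excess_def)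
  finally show ?thesis .
qed

text \<open>Both sides are affine in the inner product of \<open>X\<close> and \<open>Y\<close>, and
  the gap between them decreases in it. By Cauchy-Schwarz the worst case is that of parallel
  vectors, where the claim becomes a scalar inequality that follows by squaring the last
  hypothesis.\<close>

lemma scaled_vectors_monotone:
  fixes X Y :: "'a::real_inner"
  assumes p: "p \<ge> 2" and \<beta>: "0 \<le> \<beta>" "\<beta> \<le> \<alpha>" and n: "norm Y \<le> norm X"
    and d: "\<alpha> * norm X - \<beta> * norm Y \<le> p / 2 * \<alpha> * (norm X - norm Y)"
  shows "4 / p\<^sup>2 * (norm (\<alpha> *\<^sub>R X - \<beta> *\<^sub>R Y))\<^sup>2 \<le> (\<alpha>\<^sup>2 *\<^sub>R X - \<beta>\<^sup>2 *\<^sub>R Y) \<bullet> (X - Y)"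
proof -
  define a b m c where "a = norm X" "b = norm Y" "m = X \<bullet> Y" "c = 4 / p\<^sup>2"
  have ab: "0 \<le> b" "b \<le> a" using n by (auto simp: a_b_m_c_def)
  have m: "m \<le> a * b" unfolding a_b_m_c_def by (rule norm_cauchy_schwarz)
  have "4 \<le> p\<^sup>2" using power_mono[OF p, of 2] by simp
  then have c: "0 \<le> c" "c \<le> 1" using p by (auto simp: a_b_m_c_def divide_le_eq)
  have XX: "X \<bullet> X = a\<^sup>2" "Y \<bullet> Y = b\<^sup>2" "X \<bullet> Y = m" "Y \<bullet> X = m"
    by (auto simp: a_b_m_c_def dot_square_norm inner_commute)
  have L: "(\<alpha>\<^sup>2 *\<^sub>R X - \<beta>\<^sup>2 *\<^sub>R Y) \<bullet> (X - Y) = \<alpha>\<^sup>2 * a\<^sup>2 + \<beta>\<^sup>2 * b\<^sup>2 - (\<alpha>\<^sup>2 + \<beta>\<^sup>2) * m"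
    by (simp add: inner_diff_left inner_diff_right XX algebra_simps)
  have R: "(norm (\<alpha> *\<^sub>R X - \<beta> *\<^sub>R Y))\<^sup>2 = \<alpha>\<^sup>2 * a\<^sup>2 + \<beta>\<^sup>2 * b\<^sup>2 - 2 * (\<alpha> * \<beta>) * m"
    unfolding power2_norm_eq_inner
    by (simp add: inner_diff_left inner_diff_right XX algebra_simps power2_eq_square)
  \<comment> \<open>This is the negative of the slope of the gap as a function of \<open>m\<close>;
    it is nonnegative because \<open>c \<le> 1\<close>.\<close>
  have co: "0 \<le> \<alpha>\<^sup>2 + \<beta>\<^sup>2 - 2 * c * (\<alpha> * \<beta>)"
  proof -
    have "2 * c * (\<alpha> * \<beta>) \<le> 2 * (\<alpha> * \<beta>)" using c \<beta> mult_right_mono[of c 1 "\<alpha> * \<beta>"] by simp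
    also have "\<dots> \<le> \<alpha>\<^sup>2 + \<beta>\<^sup>2" using sum_squares_bound[of \<alpha> \<beta>] by simp
    finally show ?thesis by simp
  qed
  have 1: "(\<alpha> * a - \<beta> * b)\<^sup>2 \<le> (p / 2 * \<alpha> * (a - b))\<^sup>2"
  proof (rule power_mono)
    show "\<alpha> * a - \<beta> * b \<le> p / 2 * \<alpha> * (a - b)" using d by (simp add: a_b_m_c_def)
    show "0 \<le> \<alpha> * a - \<beta> * b" using \<beta> ab by (auto intro: mult_mono)
  qed
  \<comment> \<open>The constant \<open>4 / p\<^sup>2\<close> is chosen to cancel the square of
    \<open>p / 2\<close> here.\<close>
  have "c * (\<alpha> * a - \<beta> * b)\<^sup>2 \<le> c * (p / 2 * \<alpha> * (a - b))\<^sup>2"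
    by (rule mult_left_mono[OF 1 c(1)])
  also have "\<dots> = \<alpha>\<^sup>2 * (a - b)\<^sup>2"
  proof -
    have "c * p\<^sup>2 = 4" using p by (simp add: a_b_m_c_def)
    moreover have "c * (p / 2 * \<alpha> * (a - b))\<^sup>2 = (c * p\<^sup>2) / 4 * (\<alpha>\<^sup>2 * (a - b)\<^sup>2)"
      by (simp add: power_mult_distrib power_divide)
    ultimately show ?thesis by simp
  qed
  also have "\<dots> \<le> (\<alpha>\<^sup>2 * a - \<beta>\<^sup>2 * b) * (a - b)"
  proof -
    have "\<beta>\<^sup>2 * b \<le> \<alpha>\<^sup>2 * b" using \<beta> ab by (intro mult_right_mono power_mono) auto
    from mult_right_mono[OF this, of "a - b"] ab show ?thesis by (simp add: power2_eq_square algebra_simps)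
  qed
  finally have 2: "c * (\<alpha> * a - \<beta> * b)\<^sup>2 \<le> (\<alpha>\<^sup>2 * a - \<beta>\<^sup>2 * b) * (a - b)" .
  have "(\<alpha>\<^sup>2 + \<beta>\<^sup>2 - 2 * c * (\<alpha> * \<beta>)) * m \<le> (\<alpha>\<^sup>2 + \<beta>\<^sup>2 - 2 * c * (\<alpha> * \<beta>)) * (a * b)"
    by (rule mult_left_mono[OF m co])
  with 2 have "c * (\<alpha>\<^sup>2 * a\<^sup>2 + \<beta>\<^sup>2 * b\<^sup>2 - 2 * (\<alpha> * \<beta>) * m) \<le> \<alpha>\<^sup>2 * a\<^sup>2 + \<beta>\<^sup>2 * b\<^sup>2 - (\<alpha>\<^sup>2 + \<beta>\<^sup>2) * m"
    by (simp add: power2_eq_square algebra_simps)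
  then show ?thesis unfolding L R by (simp add: a_b_m_c_def)
qed

lemma H_scaled:
  "H (p / 2) \<xi> = norm (excess \<xi>) powr (p / 2 - 1) *\<^sub>R excess \<xi>"
  "H (p - 1) \<xi> = (norm (excess \<xi>) powr (p / 2 - 1))\<^sup>2 *\<^sub>R excess \<xi>"
  by (auto simp: H_eq_excess powr_add[symmetric] power2_eq_square)

text \<open>Two layers. For the excesses this is the monotonicity of the power field, with weights
  \<open>\<alpha>\<close> and \<open>\<beta>\<close> equal to their norms to the power
  \<open>p / 2 - 1\<close>. Passing from \<open>excess \<xi> - excess \<eta>\<close> to
  \<open>\<xi> - \<eta>\<close> adds the differences of the projections, and these pair
  nonnegatively with \<open>H (p - 1)\<close> because the field points in a normal direction of the
  ball.\<close>

lemma H_monotone: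
  fixes \<xi> \<eta> :: "'a::euclidean_space"
  assumes p: "p \<ge> 2"
  shows "4 / p\<^sup>2 * (norm (H (p / 2) \<xi> - H (p / 2) \<eta>))\<^sup>2 \<le> (H (p - 1) \<xi> - H (p - 1) \<eta>) \<bullet> (\<xi> - \<eta>)"
proof -
  have *: "4 / p\<^sup>2 * (norm (H (p / 2) \<xi> - H (p / 2) \<eta>))\<^sup>2 \<le> (H (p - 1) \<xi> - H (p - 1) \<eta>) \<bullet> (excess \<xi> - excess \<eta>)"
    if n: "norm (excess \<eta>) \<le> norm (excess \<xi>)" for \<xi> \<eta> :: 'a
    unfolding H_scaled
  proof (rule scaled_vectors_monotone[OF p _ _ n])
    let ?a = "norm (excess \<xi>)" and ?b = "norm (excess \<eta>)"
    show "?b powr (p / 2 - 1) \<le> ?a powr (p / 2 - 1)" using p n by (intro powr_mono2) auto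
    \<comment> \<open>The tangent of the convex power \<open>p / 2\<close> at the larger norm,
      evaluated at the smaller one; this is where \<open>p \<ge> 2\<close> is used.\<close>
    have "?a powr (p / 2) + p / 2 * ?a powr (p / 2 - 1) * (?b - ?a) \<le> ?b powr (p / 2)"
      by (rule powr_above_tangent) (use p in auto)
    moreover have "x powr (p / 2) = x powr (p / 2 - 1) * x" if "x \<ge> 0" for x
      using powr_mult_base[OF that, of "p / 2 - 1"] by (simp add: mult.commute)
    ultimately show "?a powr (p / 2 - 1) * ?a - ?b powr (p / 2 - 1) * ?b \<le> p / 2 * ?a powr (p / 2 - 1) * (?a - ?b)"
      by (simp add: field_simps)
  qed simp
  have "4 / p\<^sup>2 * (norm (H (p / 2) \<xi> - H (p / 2) \<eta>))\<^sup>2 \<le> (H (p - 1) \<xi> - H (p - 1) \<eta>) \<bullet> (excess \<xi> - excess \<eta>)"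
  proof (cases "norm (excess \<eta>) \<le> norm (excess \<xi>)")
    case False
    then show ?thesis using *[of \<xi> \<eta>]
      by (simp add: norm_minus_commute[of "H (p/2) \<xi>"] inner_diff_left inner_diff_right algebra_simps)
  qed (rule *)
  also have "\<dots> \<le> (H (p - 1) \<xi> - H (p - 1) \<eta>) \<bullet> (\<xi> - \<eta>)"
  proof -
    have pr: "0 \<le> H (p - 1) \<xi> \<bullet> ((\<xi> - excess \<xi>) - (\<eta> - excess \<eta>))" for \<xi> \<eta> :: 'a
      using excess_inner_projection[OF norm_projection_le[of \<eta>], of \<xi>]
      by (simp add: H_scaled inner_diff_right[of "excess \<xi>" "\<xi> - excess \<xi>"])
    from pr[of \<xi> \<eta>] pr[of \<eta> \<xi>] show ?thesis
      by (simp add: inner_diff_left inner_diff_right algebra_simps)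
  qed
  finally show ?thesis .
qed

text \<open>With \<open>A\<close> equal to the weight times \<open>V\<close>, the difference is
  \<open>\<alpha> (v - w) + (\<alpha> - \<beta>) w\<close>. The second term is as good as the first
  because \<open>(\<alpha> - \<beta>) * b\<close> is at most
  \<open>\<alpha> * a - \<beta> * b\<close>, which is the difference of the norms of
  \<open>v\<close> and \<open>w\<close>.\<close>

lemma H_growth:
  fixes \<xi> \<eta> :: "'a::euclidean_space"
  assumes p: "p \<ge> 2"
  shows "norm (H (p - 1) \<xi> - H (p - 1) \<eta>) \<le>
    2 * max (norm (excess \<xi>)) (norm (excess \<eta>)) powr (p / 2 - 1) * norm (H (p / 2) \<xi> - H (p / 2) \<eta>)"
proof -
  have *: "norm (H (p - 1) \<xi> - H (p - 1) \<eta>) \<le> 2 * norm (excess \<xi>) powr (p / 2 - 1) * norm (H (p / 2) \<xi> - H (p / 2) \<eta>)"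
    if n: "norm (excess \<eta>) \<le> norm (excess \<xi>)" for \<xi> \<eta> :: 'a
  proof -
    define a b where "a = norm (excess \<xi>)" "b = norm (excess \<eta>)"
    define \<alpha> \<beta> where "\<alpha> = a powr (p / 2 - 1)" "\<beta> = b powr (p / 2 - 1)"
    define v w where "v = H (p / 2) \<xi>" "w = H (p / 2) \<eta>"
    have ab: "0 \<le> \<beta>" "\<beta> \<le> \<alpha>" "0 \<le> b" "b \<le> a"
      using p n by (auto simp: a_b_def \<alpha>_\<beta>_def intro!: powr_mono2)
    have vw: "norm v = \<alpha> * a" "norm w = \<beta> * b"
      by (auto simp: v_w_def H_scaled \<alpha>_\<beta>_def a_b_def)
    have A: "H (p - 1) \<xi> = \<alpha> *\<^sub>R v" "H (p - 1) \<eta> = \<beta> *\<^sub>R w"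
      by (auto simp: v_w_def H_scaled \<alpha>_\<beta>_def a_b_def power2_eq_square)
    have "\<alpha> *\<^sub>R v - \<beta> *\<^sub>R w = \<alpha> *\<^sub>R (v - w) + (\<alpha> - \<beta>) *\<^sub>R w"
      by (simp add: algebra_simps)
    then have "norm (\<alpha> *\<^sub>R v - \<beta> *\<^sub>R w) \<le> \<alpha> * norm (v - w) + (\<alpha> - \<beta>) * norm w"
      using norm_triangle_ineq[of "\<alpha> *\<^sub>R (v - w)" "(\<alpha> - \<beta>) *\<^sub>R w"] ab by simp
    also have "(\<alpha> - \<beta>) * norm w = \<beta> * ((\<alpha> - \<beta>) * b)" by (simp add: vw)
    also have "\<dots> \<le> \<beta> * norm (v - w)"
    proof (rule mult_left_mono[OF _ ab(1)])
      have "(\<alpha> - \<beta>) * b \<le> \<alpha> * a - \<beta> * b" using ab by (simp add: algebra_simps mult_left_mono)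
      also have "\<dots> \<le> norm (v - w)" using norm_triangle_ineq2[of v w] by (simp add: vw)
      finally show "(\<alpha> - \<beta>) * b \<le> norm (v - w)" .
    qed
    also have "\<beta> * norm (v - w) \<le> \<alpha> * norm (v - w)" using ab by (intro mult_right_mono) auto
    finally show ?thesis unfolding A by (simp add: v_w_def \<alpha>_\<beta>_def a_b_def)
  qed
  show ?thesis
  proof (cases "norm (excess \<eta>) \<le> norm (excess \<xi>)")
    case True
    then show ?thesis using *[OF True] by (simp add: max_def)
  next
    case False
    then show ?thesis using *[of \<xi> \<eta>] by (simp add: max_def norm_minus_commute)
  qed
qed

lemma excess_measurable [measurable]: "excess \<in> borel_measurable borel"
  unfolding excess_def[abs_def] by measurable

lemma H_measurable [measurable]: "H \<gamma> \<in> borel_measurable borel"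
  unfolding H_eq_excess[abs_def] by measurable

section \<open>Cut-offs, gradients and duality\<close>

text \<open>Written as a Minkowski sum with a closed ball, so that compactness is inherited from
  that of sums of compact sets.\<close>

definition nbhd :: "'a::euclidean_space set \<Rightarrow> real \<Rightarrow> 'a set" where
  "nbhd S s = {x + y |x y. x \<in> S \<and> y \<in> cball 0 s}"

lemma compact_nbhd: "compact S \<Longrightarrow> compact (nbhd S s)"
  unfolding nbhd_def by (intro compact_sums) auto

lemma nbhd_iff: "x \<in> nbhd S s \<longleftrightarrow> (\<exists>y\<in>S. norm (x - y) \<le> s)"
proof
  assume "\<exists>y\<in>S. norm (x - y) \<le> s"
  then obtain y where "y \<in> S" "norm (x - y) \<le> s" by blast
  then show "x \<in> nbhd S s"
    unfolding nbhd_def mem_Collect_eq by (intro exI[of _ y] exI[of _ "x - y"]) auto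
qed (force simp: nbhd_def)

lemma nbhd_step:
  assumes "x \<in> nbhd S s" "norm (x' - x) \<le> t" "s + t \<le> s'" shows "x' \<in> nbhd S s'"
proof -
  obtain y where "y \<in> S" "norm (x - y) \<le> s" using assms(1) by (auto simp: nbhd_iff)
  moreover have "norm (x' - y) \<le> norm (x' - x) + norm (x - y)"
    using norm_triangle_ineq[of "x' - x" "x - y"] by simp
  ultimately show ?thesis using assms by (auto simp: nbhd_iff intro!: bexI[of _ y])
qed

lemma nbhd_mono: "s \<le> t \<Longrightarrow> nbhd S s \<subseteq> nbhd S t"
  unfolding nbhd_iff subset_iff by (meson order_trans)

lemma subset_nbhd: "0 \<le> s \<Longrightarrow> S \<subseteq> nbhd S s"
  unfolding nbhd_iff subset_iff by (metis diff_self norm_zero)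

lemma compact_indicator_integrable: "compact S \<Longrightarrow> integrable lborel (indicat_real S)"
  using emeasure_compact_finite[of S] by (auto simp: integrable_real_indicator borel_compact)

text \<open>Mollify the indicator of \<open>nbhd S (r/2)\<close> with radius \<open>r/2\<close>:
  around a point of \<open>S\<close> the kernel sees only the value 1, and outside
  \<open>nbhd S r\<close> only the value 0.\<close>

lemma smooth_cutoff:
  fixes S :: "'a::euclidean_space set"
  assumes S: "compact S" and r: "r > 0"
  obtains \<eta> where "test_fun (nbhd S r) \<eta>" "\<And>x. 0 \<le> \<eta> x" "\<And>x. x \<in> S \<Longrightarrow> \<eta> x = 1"
proof -
  obtain \<rho> :: "'a \<Rightarrow> real" where \<rho>: "mollifier (r/2) \<rho>" using mollifier_exists[of "r/2"] r by auto
  note t = mollifier_test_fun[OF \<rho>]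
  let ?T = "nbhd S (r/2)"
  define \<eta> where "\<eta> = conv (indicat_real ?T) \<rho>"
  have \<rho>0: "\<rho> z \<ge> 0" "r/2 \<le> norm z \<Longrightarrow> \<rho> z = 0" "integral\<^sup>L lborel \<rho> = 1" for z
    using \<rho> by (auto simp: mollifier_def)
  have "smooth \<eta>" unfolding \<eta>_def
    by (rule smooth_conv[OF compact_indicator_integrable t]) (rule compact_nbhd[OF S])
  moreover have "\<eta> x = 0" if "x \<notin> nbhd S r" for x
    unfolding \<eta>_def
  proof (rule conv_eq_0)
    fix y assume "indicat_real ?T y \<noteq> 0"
    then have "y \<in> ?T" by (auto simp: indicator_def split: if_splits)
    then have "\<not> norm (x - y) \<le> r/2" using that nbhd_step[of y S "r/2" x "r/2" r] by auto
    then show "\<rho> (x - y) = 0" using \<rho>0(2) by auto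
  qed
  ultimately have "test_fun (nbhd S r) \<eta>"
    by (intro test_funI[where S="nbhd S r"] compact_nbhd S) auto
  moreover have "0 \<le> \<eta> x" for x
    unfolding \<eta>_def conv_def using \<rho>0(1) by (intro integral_nonneg_AE) auto
  moreover have "\<eta> x = 1" if "x \<in> S" for x
  proof -
    have "\<rho> (x - y) *\<^sub>R indicat_real ?T y = \<rho> (x - y)" for y
    proof (cases "y \<in> ?T")
      case False
      then have "\<not> norm (y - x) \<le> r/2" using that unfolding nbhd_iff by blast
      then show ?thesis using \<rho>0(2) by (simp add: norm_minus_commute)
    qed simp
    then have "\<eta> x = (\<integral>y. \<rho> (x + (-1) *\<^sub>R y) \<partial>lborel)"
      unfolding \<eta>_def conv_def by (intro Bochner_Integration.integral_cong) auto
    also have "\<dots> = integral\<^sup>L lborel \<rho>"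
      by (rule integral_lborel_affine) (auto intro: test_fun_measurable[OF t])
    finally show ?thesis using \<rho>0(3) by simp
  qed
  ultimately show ?thesis by (rule that)
qed

section \<open>Calculus of classical gradients\<close>

lemma cgrad_inner: "b \<in> Basis \<Longrightarrow> cgrad \<phi> x \<bullet> b = frechet_derivative \<phi> (at x) b"
  by (simp add: cgrad_def inner_sum_left inner_Basis if_distrib sum.delta cong: if_cong)

lemma frechet_derivative_cgrad:
  "smooth \<phi> \<Longrightarrow> frechet_derivative \<phi> (at x) h = cgrad \<phi> x \<bullet> h"
  by (subst frechet_derivative_components) (auto simp: cgrad_def inner_sum_left inner_commute[of h] mult.commute)

lemma smooth_has_derivative_cgrad: "smooth \<phi> \<Longrightarrow> (\<phi> has_derivative (\<lambda>h. cgrad \<phi> x \<bullet> h)) (at x)"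
  by (rule has_derivative_eq_rhs[OF smooth_has_derivative]) (auto simp: frechet_derivative_cgrad)

lemma cgrad_eqI:
  assumes "(\<phi> has_derivative (\<lambda>h. v \<bullet> h)) (at x)" shows "cgrad \<phi> x = v"
  unfolding cgrad_def frechet_derivative_at[OF assms, symmetric] by (rule euclidean_representation)

lemma cgrad_diff: "smooth \<phi> \<Longrightarrow> smooth \<psi> \<Longrightarrow> cgrad (\<lambda>x. \<phi> x - \<psi> x) x = cgrad \<phi> x - cgrad \<psi> x"
  by (rule cgrad_eqI, rule has_derivative_eq_rhs,
      rule has_derivative_diff[OF smooth_has_derivative_cgrad smooth_has_derivative_cgrad])
    (auto simp: inner_diff_left)

lemma cgrad_mult:
  "smooth \<phi> \<Longrightarrow> smooth \<psi> \<Longrightarrow> cgrad (\<lambda>x. \<phi> x * \<psi> x) x = \<psi> x *\<^sub>R cgrad \<phi> x + \<phi> x *\<^sub>R cgrad \<psi> x"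
  by (rule cgrad_eqI, rule has_derivative_eq_rhs,
      rule has_derivative_mult[OF smooth_has_derivative_cgrad smooth_has_derivative_cgrad])
    (auto simp: inner_add_left algebra_simps)

lemma cgrad_affine:
  assumes "smooth \<phi>" shows "cgrad (\<lambda>x. \<phi> (a + c *\<^sub>R x)) x = c *\<^sub>R cgrad \<phi> (a + c *\<^sub>R x)"
proof (rule cgrad_eqI)
  have "((\<lambda>x. a + c *\<^sub>R x) has_derivative (\<lambda>h. c *\<^sub>R h)) (at x)"
    by (auto intro!: derivative_eq_intros)
  from has_derivative_compose[OF this smooth_has_derivative_cgrad[OF assms]]
  show "((\<lambda>x. \<phi> (a + c *\<^sub>R x)) has_derivative (\<lambda>h. (c *\<^sub>R cgrad \<phi> (a + c *\<^sub>R x)) \<bullet> h)) (at x)"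
    by simp
qed

lemma cgrad_shift: "smooth \<phi> \<Longrightarrow> cgrad (\<lambda>x. \<phi> (a + x)) x = cgrad \<phi> (a + x)"
  using cgrad_affine[of \<phi> a 1 x] by simp

lemma smooth_shift: "smooth \<phi> \<Longrightarrow> smooth (\<lambda>x. \<phi> (a + x))"
  using smooth_affine[of \<phi> a 1] by simp

lemma cgrad_outside: "test_fun U \<phi> \<Longrightarrow> x \<notin> U \<Longrightarrow> cgrad \<phi> x = 0"
  unfolding cgrad_def using test_fun_outside[OF test_fun_frechet] by (intro sum.neutral) auto

lemma cgrad_bounded:
  assumes "test_fun U \<phi>" obtains B where "B > 0" "\<And>x. norm (cgrad \<phi> x) \<le> B"
proof -
  obtain B where B: "B > 0" "\<And>x h. \<bar>frechet_derivative \<phi> (at x) h\<bar> \<le> B * norm h"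
    using test_fun_derivative_bounded[OF assms] by metis
  have "norm (cgrad \<phi> x) \<le> B" for x
  proof (cases "cgrad \<phi> x = 0")
    case False
    have "cgrad \<phi> x \<bullet> cgrad \<phi> x \<le> B * norm (cgrad \<phi> x)"
      using B(2)[of x "cgrad \<phi> x"] frechet_derivative_cgrad[OF test_fun_smooth[OF assms]] by simp
    then show ?thesis using False by (simp add: dot_square_norm power2_eq_square)
  qed (use B in simp)
  with B that show ?thesis by blast
qed

lemma cgrad_measurable: "smooth \<phi> \<Longrightarrow> cgrad \<phi> \<in> borel_measurable borel"
  unfolding cgrad_def[abs_def]
  by (intro borel_measurable_continuous_onI continuous_intros smooth_continuous_frechet)

text \<open>Test the weak gradient with the kernel reflected around \<open>x\<close>. This function
  is admissible as soon as the ball of radius \<open>\<epsilon>\<close> around \<open>x\<close> lies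
  in \<open>U\<close>, and the sign produced by the reflection cancels the one in the weak
  formulation.\<close>

lemma cgrad_conv_weak_gradient:
  fixes u :: "'a::euclidean_space \<Rightarrow> real"
  assumes u: "integrable lborel u" and g: "integrable lborel g" and \<rho>: "mollifier \<epsilon> \<rho>"
    and weak: "\<And>\<phi> b. test_fun U \<phi> \<Longrightarrow> b \<in> Basis \<Longrightarrow>
      (\<integral>x. u x * frechet_derivative \<phi> (at x) b \<partial>lborel) = - (\<integral>x. (g x \<bullet> b) * \<phi> x \<partial>lborel)"
    and x: "cball x \<epsilon> \<subseteq> U"
  shows "cgrad (conv u \<rho>) x = conv g \<rho> x"
proof (rule euclidean_eqI)
  fix b :: 'a assume b: "b \<in> Basis"
  note t = mollifier_test_fun[OF \<rho>]
  note sm = test_fun_smooth[OF t]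
  define \<phi> where "\<phi> y = \<rho> (x + (-1) *\<^sub>R y)" for y
  have sm\<phi>: "smooth \<phi>" unfolding \<phi>_def by (rule smooth_affine[OF sm])
  have t\<phi>: "test_fun U \<phi>"
    using sm\<phi> x \<rho> by (intro test_funI[where S="cball x \<epsilon>"]) (auto simp: \<phi>_def mollifier_def dist_norm)
  have D: "frechet_derivative \<phi> (at y) b = - frechet_derivative \<rho> (at (x - y)) b" for y
    using cgrad_affine[OF sm, of x "-1" y] b
    by (simp add: \<phi>_def[abs_def] flip: cgrad_inner)
  have "cgrad (conv u \<rho>) x \<bullet> b = conv u (\<lambda>z. frechet_derivative \<rho> (at z) b) x"
    using b by (simp add: cgrad_inner frechet_derivative_conv[OF u t])
  also have "\<dots> = - (\<integral>y. u y * frechet_derivative \<phi> (at y) b \<partial>lborel)"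
    by (simp add: D conv_def mult.commute)
  also have "\<dots> = (\<integral>y. (g y \<bullet> b) * \<phi> y \<partial>lborel)"
    by (simp add: weak[OF t\<phi> b])
  also have "\<dots> = conv (\<lambda>y. g y \<bullet> b) \<rho> x"
    by (simp add: conv_def \<phi>_def mult.commute)
  also have "\<dots> = conv g \<rho> x \<bullet> b" by (rule conv_inner[OF g t, symmetric])
  finally show "cgrad (conv u \<rho>) x \<bullet> b = conv g \<rho> x \<bullet> b" .
qed

section \<open>Duality between \<open>Lp\<close> and its conjugate space\<close>

text \<open>Compare \<open>d\<close> with \<open>\<delta> * b\<close>: whichever is larger dominates
  the product, and the corresponding summand on the right appears.\<close>

lemma powr_mult_le:
  fixes b d \<delta> :: real
  assumes "0 \<le> b" "0 \<le> d" "0 < \<delta>" "1 \<le> p"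
  shows "b powr (p - 1) * d \<le> \<delta> * b powr p + \<delta> powr (1 - p) * d powr p"
proof (cases "d \<le> \<delta> * b")
  case True
  have "b powr (p - 1) * d \<le> b powr (p - 1) * (\<delta> * b)" using True by (rule mult_left_mono) simp
  also have "\<dots> = \<delta> * b powr p" using powr_mult_base[OF assms(1), of "p - 1"] by (simp add: mult_ac)
  finally show ?thesis by (simp add: add_increasing2)
next
  case False
  then have "b \<le> d / \<delta>" using assms by (simp add: field_simps)
  then have "b powr (p - 1) * d \<le> (d / \<delta>) powr (p - 1) * d"
    using assms by (intro mult_right_mono powr_mono2) auto
  also have "\<dots> = \<delta> powr (1 - p) * d powr p"
  proof -
    have "d powr p = d * d powr (p - 1)" using powr_mult_base[OF assms(2), of "p - 1"] by simp
    moreover have "\<delta> powr (1 - p) = 1 / \<delta> powr (p - 1)"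
      using powr_minus[of \<delta> "p - 1"] by (simp add: divide_inverse)
    moreover have "(d / \<delta>) powr (p - 1) = d powr (p - 1) / \<delta> powr (p - 1)"
      by (simp add: powr_divide)
    ultimately show ?thesis by simp
  qed
  finally show ?thesis using assms by (simp add: add_increasing)
qed

text \<open>An additive substitute for Hoelder's inequality. The domination of \<open>a\<close> by
  \<open>B powr (p - 1)\<close> expresses membership in the conjugate space without a conjugate
  exponent, and so remains meaningful for \<open>p = 1\<close>.\<close>

lemma Lp_duality:
  fixes a w :: "'a::euclidean_space \<Rightarrow> 'b::euclidean_space"
  assumes p: "1 \<le> p" and [measurable]: "a \<in> borel_measurable borel" "w \<in> borel_measurable borel"
    and B: "\<And>x. 0 \<le> B x" "integrable lborel (\<lambda>x. B x powr p)" "\<And>x. norm (a x) \<le> B x powr (p - 1)"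
    and w: "integrable lborel (\<lambda>x. norm (w x) powr p)" and \<delta>: "0 < \<delta>"
  shows "integrable lborel (\<lambda>x. a x \<bullet> w x)"
    "\<bar>\<integral>x. a x \<bullet> w x \<partial>lborel\<bar> \<le> \<delta> * (\<integral>x. B x powr p \<partial>lborel) + \<delta> powr (1 - p) * (\<integral>x. norm (w x) powr p \<partial>lborel)"
proof -
  have i: "integrable lborel (\<lambda>x. \<delta> * B x powr p + \<delta> powr (1 - p) * norm (w x) powr p)"
    using B w by simp
  have pw: "norm (a x \<bullet> w x) \<le> \<delta> * B x powr p + \<delta> powr (1 - p) * norm (w x) powr p" for x
  proof -
    have "norm (a x \<bullet> w x) \<le> norm (a x) * norm (w x)" by (simp add: Cauchy_Schwarz_ineq2)
    also have "\<dots> \<le> B x powr (p - 1) * norm (w x)" using B by (intro mult_right_mono) auto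
    also have "\<dots> \<le> \<delta> * B x powr p + \<delta> powr (1 - p) * norm (w x) powr p"
      by (rule powr_mult_le) (use B \<delta> p in auto)
    finally show ?thesis .
  qed
  show 1: "integrable lborel (\<lambda>x. a x \<bullet> w x)"
    by (rule Bochner_Integration.integrable_bound[OF i]) (use order_trans[OF pw abs_ge_self] in auto)
  have "\<bar>\<integral>x. a x \<bullet> w x \<partial>lborel\<bar> \<le> (\<integral>x. norm (a x \<bullet> w x) \<partial>lborel)"
    using integral_norm_bound[of lborel "\<lambda>x. a x \<bullet> w x"] by simp
  also have "\<dots> \<le> (\<integral>x. \<delta> * B x powr p + \<delta> powr (1 - p) * norm (w x) powr p \<partial>lborel)"
    using 1 by (intro integral_mono[OF _ i pw]) (auto intro: integrable_norm)
  finally show "\<bar>\<integral>x. a x \<bullet> w x \<partial>lborel\<bar> \<le> \<delta> * (\<integral>x. B x powr p \<partial>lborel) + \<delta> powr (1 - p) * (\<integral>x. norm (w x) powr p \<partial>lborel)"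
    using B w by simp
qed

lemma Lp_duality_tendsto:
  fixes a w :: "'a::euclidean_space \<Rightarrow> 'b::euclidean_space"
  assumes p: "1 \<le> p" and am[measurable]: "a \<in> borel_measurable borel" and wm[measurable]: "w \<in> borel_measurable borel"
    and wnm[measurable]: "\<And>n. wn n \<in> borel_measurable borel"
    and B: "\<And>x. 0 \<le> B x" "integrable lborel (\<lambda>x. B x powr p)" "\<And>x. norm (a x) \<le> B x powr (p - 1)"
    and w: "integrable lborel (\<lambda>x. norm (w x) powr p)"
    and wn: "\<And>n. integrable lborel (\<lambda>x. norm (wn n x - w x) powr p)"
    and lim: "(\<lambda>n. \<integral>x. norm (wn n x - w x) powr p \<partial>lborel) \<longlonglongrightarrow> 0"
  shows "(\<lambda>n. \<integral>x. a x \<bullet> wn n x \<partial>lborel) \<longlonglongrightarrow> (\<integral>x. a x \<bullet> w x \<partial>lborel)"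
proof (rule LIMSEQ_I)
  fix e :: real assume e: "e > 0"
  define I where "I = (\<integral>x. B x powr p \<partial>lborel)"
  have I: "I \<ge> 0" by (simp add: I_def)
  \<comment> \<open>The parameter is fixed first, to make the term with the fixed integral
    \<open>I\<close> smaller than \<open>e / 2\<close>; adding 1 covers \<open>I = 0\<close>. The
    second term is then made small by \<open>n\<close>.\<close>
  define \<delta> where "\<delta> = e / (2 * (I + 1))"
  have \<delta>: "\<delta> > 0" using e I by (simp add: \<delta>_def)
  have \<delta>I: "\<delta> * I < e / 2" using e I by (simp add: \<delta>_def divide_simps)
  have dm: "(\<lambda>x. wn n x - w x) \<in> borel_measurable borel" for n by simp
  note d = Lp_duality[OF p am dm B wn \<delta>]
  have "(\<lambda>n. \<delta> powr (1 - p) * (\<integral>x. norm (wn n x - w x) powr p \<partial>lborel)) \<longlonglongrightarrow> 0"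
    using tendsto_mult_right_zero[OF lim] by simp
  from LIMSEQ_D[OF this, of "e/2"] e obtain N where
    N: "\<And>n. n \<ge> N \<Longrightarrow> \<bar>\<delta> powr (1 - p) * (\<integral>x. norm (wn n x - w x) powr p \<partial>lborel)\<bar> < e / 2" by auto
  have "norm ((\<integral>x. a x \<bullet> wn n x \<partial>lborel) - (\<integral>x. a x \<bullet> w x \<partial>lborel)) < e" if "n \<ge> N" for n
  proof -
    have iw: "integrable lborel (\<lambda>x. a x \<bullet> w x)" by (rule Lp_duality(1)[OF p am wm B w \<delta>])
    have "integrable lborel (\<lambda>x. a x \<bullet> (wn n x - w x) + a x \<bullet> w x)"
      by (intro Bochner_Integration.integrable_add d(1) iw)
    then have "integrable lborel (\<lambda>x. a x \<bullet> wn n x)" by (simp add: inner_diff_right)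
    with iw have "(\<integral>x. a x \<bullet> wn n x \<partial>lborel) - (\<integral>x. a x \<bullet> w x \<partial>lborel) = (\<integral>x. a x \<bullet> (wn n x - w x) \<partial>lborel)"
      by (simp add: inner_diff_right)
    then show ?thesis using d(2)[of n] N[OF that] \<delta>I by (simp add: I_def)
  qed
  then show "\<exists>N. \<forall>n\<ge>N. norm ((\<integral>x. a x \<bullet> wn n x \<partial>lborel) - (\<integral>x. a x \<bullet> w x \<partial>lborel)) < e" by blast
qed

section \<open>Difference quotients of Sobolev functions\<close>

text \<open>Borel data on the whole space that carry a Sobolev function near \<open>S\<close>.
  Extension by zero destroys the weak gradient across the boundary of \<open>nbhd S (4 * r)\<close>,
  hence the restriction on the test functions in \<open>weak\<close>.\<close>

locale Sobolev_cut =
  fixes S :: "'a::euclidean_space set" and r p :: real and u :: "'a \<Rightarrow> real" and g :: "'a \<Rightarrow> 'a"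
  assumes S: "compact S" and r: "r > 0" and p: "p \<ge> 2"
    and um[measurable]: "u \<in> borel_measurable borel" and gm[measurable]: "g \<in> borel_measurable borel"
    and u0: "\<And>x. x \<notin> nbhd S (4 * r) \<Longrightarrow> u x = 0" and g0: "\<And>x. x \<notin> nbhd S (4 * r) \<Longrightarrow> g x = 0"
    and uLp: "integrable lborel (\<lambda>x. norm (u x) powr p)" and gLp: "integrable lborel (\<lambda>x. norm (g x) powr p)"
    and weak: "\<And>\<phi> b. test_fun (nbhd S (4 * r)) \<phi> \<Longrightarrow> b \<in> Basis \<Longrightarrow>
      (\<integral>x. u x * frechet_derivative \<phi> (at x) b \<partial>lborel) = - (\<integral>x. (g x \<bullet> b) * \<phi> x \<partial>lborel)"
begin

lemma p0: "0 \<le> p" and p1: "1 \<le> p" using p by auto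

lemma u_int: "integrable lborel u"
  by (rule Lp_compact_support_integrable[OF p1 um uLp compact_nbhd[OF S] u0])

lemma g_int: "integrable lborel g"
  by (rule Lp_compact_support_integrable[OF p1 gm gLp compact_nbhd[OF S] g0])

text \<open>The radii \<open>r / Suc n\<close> are positive and at most \<open>r\<close>, so that
  mollifying costs a single layer of the collar.\<close>

definition \<rho> :: "nat \<Rightarrow> 'a \<Rightarrow> real" where
  "\<rho> n = (SOME \<rho>. mollifier (r / Suc n) \<rho>)"

lemma \<rho>: "mollifier (r / Suc n) (\<rho> n)"
  unfolding \<rho>_def by (rule someI_ex[OF mollifier_exists]) (use r in simp)

lemma \<rho>_test: "test_fun UNIV (\<rho> n)" by (rule mollifier_test_fun[OF \<rho>])

lemma \<rho>_measurable [measurable]: "\<rho> n \<in> borel_measurable borel"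
  by (rule test_fun_measurable[OF \<rho>_test])

lemma radius_tendsto: "(\<lambda>n. r / Suc n) \<longlonglongrightarrow> 0"
  using LIMSEQ_Suc[OF lim_const_over_n[of r]] .

abbreviation "un n \<equiv> conv u (\<rho> n)"
abbreviation "gn n \<equiv> conv g (\<rho> n)"

lemma un_Lp: "integrable lborel (\<lambda>x. norm (un n x - u x) powr p)"
    "(\<lambda>n. \<integral>x. norm (un n x - u x) powr p \<partial>lborel) \<longlonglongrightarrow> 0"
  using conv_Lp_tendsto[OF p1 um uLp compact_nbhd[OF S, of "4 * r"] u0 \<rho> radius_tendsto] by blast+

lemma gn_Lp: "integrable lborel (\<lambda>x. norm (gn n x - g x) powr p)"
    "(\<lambda>n. \<integral>x. norm (gn n x - g x) powr p \<partial>lborel) \<longlonglongrightarrow> 0"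
  using conv_Lp_tendsto[OF p1 gm gLp compact_nbhd[OF S, of "4 * r"] g0 \<rho> radius_tendsto] by blast+

lemma smooth_un: "smooth (un n)"
  by (rule smooth_conv[OF u_int \<rho>_test])

lemma un_measurable [measurable]: "un n \<in> borel_measurable borel"
  and gn_measurable [measurable]: "gn n \<in> borel_measurable borel"
  by measurable

lemma cgrad_un:
  assumes "x \<in> nbhd S (3 * r)" shows "cgrad (un n) x = gn n x"
proof (rule cgrad_conv_weak_gradient[OF u_int g_int \<rho> weak])
  show "cball x (r / real (Suc n)) \<subseteq> nbhd S (4 * r)"
  proof
    fix y assume "y \<in> cball x (r / real (Suc n))"
    then have "norm (y - x) \<le> r / real (Suc n)" by (simp add: dist_norm norm_minus_commute)
    also have "\<dots> \<le> r" using r by (simp add: divide_le_eq)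
    finally show "y \<in> nbhd S (4 * r)" by (rule nbhd_step[OF assms]) simp
  qed
qed

lemma gn_Lp_int: "integrable lborel (\<lambda>x. norm (gn n x) powr p)"
  and gn_Lp_le: "(\<integral>x. norm (gn n x) powr p \<partial>lborel) \<le>
    2 powr p * ((\<integral>x. norm (gn n x - g x) powr p \<partial>lborel) + (\<integral>x. norm (g x) powr p \<partial>lborel))"
proof -
  have i: "integrable lborel (\<lambda>x. 2 powr p * (norm (gn n x - g x) powr p + norm (g x) powr p))"
    using gn_Lp(1) gLp by auto
  have pw: "norm (gn n x) powr p \<le> 2 powr p * (norm (gn n x - g x) powr p + norm (g x) powr p)" for x
    using norm_add_powr_le[OF p0, of "gn n x - g x" "g x"] by simp
  show 1: "integrable lborel (\<lambda>x. norm (gn n x) powr p)"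
    by (rule Bochner_Integration.integrable_bound[OF i]) (use pw in auto)
  show "(\<integral>x. norm (gn n x) powr p \<partial>lborel) \<le>
    2 powr p * ((\<integral>x. norm (gn n x - g x) powr p \<partial>lborel) + (\<integral>x. norm (g x) powr p \<partial>lborel))"
    using integral_mono[OF 1 i pw] gn_Lp(1) gLp by simp
qed

text \<open>The fundamental theorem of calculus on the segment from \<open>x\<close> to
  \<open>h *\<^sub>R e + x\<close>, followed by Jensen's inequality in the parameter
  \<open>t\<close>. The segment stays in the region where the gradient of \<open>un n\<close> is
  \<open>gn n\<close>.\<close>

lemma un_diffquot_le:
  assumes e: "e \<in> Basis" and h: "0 < h" "h \<le> r" and x: "x \<in> nbhd S r"
  shows "ennreal (norm (un n (h *\<^sub>R e + x) - un n x) powr p) \<le>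
    ennreal (h powr p) * (\<integral>\<^sup>+t. ennreal (indicator {0..1} t * norm (gn n ((t * h) *\<^sub>R e + x)) powr p) \<partial>lborel)"
proof -
  let ?D = "\<lambda>t. frechet_derivative (un n) (at ((t * h) *\<^sub>R e + x)) e"
  have cont: "continuous_on UNIV (\<lambda>y. frechet_derivative (un n) (at y) e)"
    by (rule smooth_continuous_frechet[OF smooth_un e])
  have contD: "continuous_on UNIV ?D"
    by (intro continuous_on_compose2[OF cont]) (auto intro!: continuous_intros)
  have "((\<lambda>t. un n ((t * h) *\<^sub>R e + x)) has_real_derivative h * ?D t) (at t)" for t
  proof -
    have "((\<lambda>t. (t * h) *\<^sub>R e + x) has_derivative (\<lambda>s. (s * h) *\<^sub>R e)) (at t)"
      by (auto intro!: derivative_eq_intros)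
    from has_derivative_compose[OF this smooth_has_derivative_cgrad[OF smooth_un[of n]]]
    show ?thesis unfolding has_field_derivative_def
      by (rule has_derivative_eq_rhs) (auto simp: cgrad_inner[OF e] mult_ac)
  qed
  moreover have "isCont (\<lambda>t. h * ?D t) t" for t
    using contD by (intro continuous_intros) (simp add: continuous_on_eq_continuous_at)
  ultimately have "(\<integral>t. (h * ?D t) * indicator {0..1} t \<partial>lborel) = un n ((1 * h) *\<^sub>R e + x) - un n ((0 * h) *\<^sub>R e + x)"
    by (intro integral_FTC_Icc_real) auto
  then have eq: "un n (h *\<^sub>R e + x) - un n x = h * (\<integral>t. indicator {0..1} t * ?D t \<partial>lborel)"
    by (simp add: mult_ac)
  have i: "integrable lborel (\<lambda>t. indicator {0..1} t *\<^sub>R ?D t)"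
    by (rule borel_integrable_compact) (auto intro: continuous_on_subset[OF contD])
  have [measurable]: "?D \<in> borel_measurable borel" by (rule borel_measurable_continuous_onI[OF contD])
  have i1: "integrable lborel (indicat_real {0..1::real})" by (rule compact_indicator_integrable) simp
  have ii: "integrable lborel (\<lambda>t. indicator {0..1} t * \<bar>?D t\<bar>)"
    using integrable_norm[OF i] by (simp add: abs_mult)
  have "\<bar>\<integral>t. indicator {0..1} t * ?D t \<partial>lborel\<bar> \<le> (\<integral>t. indicator {0..1} t * \<bar>?D t\<bar> \<partial>lborel)"
    using integral_norm_bound[of lborel "\<lambda>t. indicator {0..1} t * ?D t"] by (simp add: abs_mult)
  then have "ennreal (\<bar>\<integral>t. indicator {0..1} t * ?D t \<partial>lborel\<bar> powr p) \<le> ennreal ((\<integral>t. indicator {0..1} t * \<bar>?D t\<bar> \<partial>lborel) powr p)"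
    using p by (intro ennreal_leI powr_mono2) auto
  also have "\<dots> \<le> (\<integral>\<^sup>+t. ennreal (indicator {0..1} t * \<bar>?D t\<bar> powr p) \<partial>lborel)"
    by (rule jensen_powr[OF p1 i1]) (use ii in auto)
  also have "\<dots> \<le> (\<integral>\<^sup>+t. ennreal (indicator {0..1} t * norm (gn n ((t * h) *\<^sub>R e + x)) powr p) \<partial>lborel)"
  proof (intro nn_integral_mono ennreal_leI)
    fix t :: real
    show "indicator {0..1} t * \<bar>?D t\<bar> powr p \<le> indicator {0..1} t * norm (gn n ((t * h) *\<^sub>R e + x)) powr p"
    proof (cases "t \<in> {0..1}")
      case True
      then have "norm (((t * h) *\<^sub>R e + x) - x) \<le> r"
        using h e mult_mono[of t 1 h r] by (simp add: abs_mult)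
      then have "(t * h) *\<^sub>R e + x \<in> nbhd S (3 * r)" by (rule nbhd_step[OF x]) (use r in simp)
      from cgrad_un[OF this] have "?D t = gn n ((t * h) *\<^sub>R e + x) \<bullet> e"
        by (simp flip: cgrad_inner[OF e])
      then have "\<bar>?D t\<bar> \<le> norm (gn n ((t * h) *\<^sub>R e + x))" using Basis_le_norm[OF e] by simp
      then show ?thesis using True p by (auto intro!: powr_mono2)
    qed simp
  qed
  finally have "ennreal (h powr p) * ennreal (\<bar>\<integral>t. indicator {0..1} t * ?D t \<partial>lborel\<bar> powr p) \<le>
    ennreal (h powr p) * (\<integral>\<^sup>+t. ennreal (indicator {0..1} t * norm (gn n ((t * h) *\<^sub>R e + x)) powr p) \<partial>lborel)"
    by (rule mult_left_mono) simp
  moreover have "norm (un n (h *\<^sub>R e + x) - un n x) powr p = h powr p * \<bar>\<integral>t. indicator {0..1} t * ?D t \<partial>lborel\<bar> powr p"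
    unfolding eq using h by (simp add: abs_mult powr_mult)
  ultimately show ?thesis by (simp add: ennreal_mult)
qed

text \<open>Integrate the pointwise bound and exchange the integrals: for fixed \<open>t\<close> the
  shift leaves the integral of \<open>gn n\<close> unchanged, and the unit interval has measure
  1.\<close>

lemma un_diffquot_Lp:
  assumes e: "e \<in> Basis" and h: "0 < h" "h \<le> r"
  shows "(\<integral>\<^sup>+x. ennreal (indicator (nbhd S r) x * norm (un n (h *\<^sub>R e + x) - un n x) powr p) \<partial>lborel) \<le>
    ennreal (h powr p * (\<integral>x. norm (gn n x) powr p \<partial>lborel))"
proof -
  have "(\<integral>\<^sup>+x. ennreal (indicator (nbhd S r) x * norm (un n (h *\<^sub>R e + x) - un n x) powr p) \<partial>lborel) \<le>
    (\<integral>\<^sup>+x. ennreal (h powr p) * (\<integral>\<^sup>+t. ennreal (indicator {0..1} t * norm (gn n ((t * h) *\<^sub>R e + x)) powr p) \<partial>lborel) \<partial>lborel)"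
    using un_diffquot_le[OF e h] by (intro nn_integral_mono) (auto simp: indicator_def)
  also have "\<dots> = ennreal (h powr p) * (\<integral>\<^sup>+x. (\<integral>\<^sup>+t. ennreal (indicator {0..1} t * norm (gn n ((t * h) *\<^sub>R e + x)) powr p) \<partial>lborel) \<partial>lborel)"
    by (rule nn_integral_cmult) measurable
  also have "(\<integral>\<^sup>+x. (\<integral>\<^sup>+t. ennreal (indicator {0..1} t * norm (gn n ((t * h) *\<^sub>R e + x)) powr p) \<partial>lborel) \<partial>lborel) =
    (\<integral>\<^sup>+t. (\<integral>\<^sup>+x. ennreal (indicator {0..1} t * norm (gn n ((t * h) *\<^sub>R e + x)) powr p) \<partial>lborel) \<partial>lborel)"
    by (rule lborel_pair.Fubini'[symmetric]) measurable
  also have "\<dots> = (\<integral>\<^sup>+t. ennreal (indicator {0..1::real} t) * (\<integral>\<^sup>+x. ennreal (norm (gn n x) powr p) \<partial>lborel) \<partial>lborel)"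
  proof (intro nn_integral_cong)
    fix t :: real
    have "(\<integral>\<^sup>+x. ennreal (indicator {0..1} t * norm (gn n ((t * h) *\<^sub>R e + x)) powr p) \<partial>lborel) =
      ennreal (indicator {0..1} t) * (\<integral>\<^sup>+x. ennreal (norm (gn n ((t * h) *\<^sub>R e + x)) powr p) \<partial>lborel)"
      by (simp add: ennreal_mult nn_integral_cmult)
    also have "(\<integral>\<^sup>+x. ennreal (norm (gn n ((t * h) *\<^sub>R e + x)) powr p) \<partial>lborel) = (\<integral>\<^sup>+x. ennreal (norm (gn n x) powr p) \<partial>lborel)"
      by (rule nn_integral_lborel_shift[of "\<lambda>x. ennreal (norm (gn n x) powr p)"]) measurable
    finally show "(\<integral>\<^sup>+x. ennreal (indicator {0..1} t * norm (gn n ((t * h) *\<^sub>R e + x)) powr p) \<partial>lborel) =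
      ennreal (indicator {0..1} t) * (\<integral>\<^sup>+x. ennreal (norm (gn n x) powr p) \<partial>lborel)" .
  qed
  also have "\<dots> = (\<integral>\<^sup>+x. ennreal (norm (gn n x) powr p) \<partial>lborel)"
    by (simp add: nn_integral_multc ennreal_indicator)
  also have "\<dots> = ennreal (\<integral>x. norm (gn n x) powr p \<partial>lborel)"
    by (rule nn_integral_eq_integral[OF gn_Lp_int]) simp
  finally show ?thesis by (simp add: ennreal_mult)
qed

text \<open>The limit of the smooth estimate. One factor \<open>2 powr p\<close> comes from
  splitting off the mollification error of \<open>u\<close>, the other from comparing
  \<open>gn n\<close> with \<open>g\<close>.\<close>

lemma u_diffquot_Lp:
  assumes e: "e \<in> Basis" and h: "0 < h" "h \<le> r"
  shows "(\<integral>x. indicator (nbhd S r) x * norm (u (h *\<^sub>R e + x) - u x) powr p \<partial>lborel) \<le>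
    (2 powr p * 2 powr p * (\<integral>x. norm (g x) powr p \<partial>lborel)) * h powr p"
proof -
  define c where "c = (2::real) powr p"
  have c: "c \<ge> 0" by (simp add: c_def)
  let ?I = "indicat_real (nbhd S r)"
  have [measurable]: "nbhd S r \<in> sets borel" using compact_nbhd[OF S] by (rule borel_compact)
  let ?E = "\<lambda>n. \<integral>x. norm (un n x - u x) powr p \<partial>lborel"
  let ?G = "\<lambda>n. \<integral>x. norm (gn n x - g x) powr p \<partial>lborel"
  have dm: "(\<lambda>x. un n x - u x) \<in> borel_measurable borel" for n by simp
  note tr = Lp_translation_le[OF p0 dm un_Lp(1), where h="h *\<^sub>R e"]
  have le: "(\<integral>x. ?I x * norm (u (h *\<^sub>R e + x) - u x) powr p \<partial>lborel) \<le>
    c * (h powr p * (c * (?G n + (\<integral>x. norm (g x) powr p \<partial>lborel))) + 2 * c * ?E n)" for n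
  proof -
    have i1: "integrable lborel (\<lambda>x. ?I x * norm (un n (h *\<^sub>R e + x) - un n x) powr p)"
      using un_diffquot_Lp[OF e h, of n] by (intro integrableI_nonneg) (auto intro: le_less_trans)
    have "ennreal (\<integral>x. ?I x * norm (un n (h *\<^sub>R e + x) - un n x) powr p \<partial>lborel) \<le> ennreal (h powr p * (\<integral>x. norm (gn n x) powr p \<partial>lborel))"
      using un_diffquot_Lp[OF e h, of n] nn_integral_eq_integral[OF i1] by simp
    then have b1: "(\<integral>x. ?I x * norm (un n (h *\<^sub>R e + x) - un n x) powr p \<partial>lborel) \<le> h powr p * (\<integral>x. norm (gn n x) powr p \<partial>lborel)"
      by (subst (asm) ennreal_le_iff) auto
    also have "\<dots> \<le> h powr p * (c * (?G n + (\<integral>x. norm (g x) powr p \<partial>lborel)))"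
      unfolding c_def by (intro mult_left_mono gn_Lp_le) simp
    finally have b2: "(\<integral>x. ?I x * norm (un n (h *\<^sub>R e + x) - un n x) powr p \<partial>lborel) \<le> h powr p * (c * (?G n + (\<integral>x. norm (g x) powr p \<partial>lborel)))" .
    have pw: "?I x * norm (u (h *\<^sub>R e + x) - u x) powr p \<le> c * (?I x * norm (un n (h *\<^sub>R e + x) - un n x) powr p +
      norm ((un n (h *\<^sub>R e + x) - u (h *\<^sub>R e + x)) - (un n x - u x)) powr p)" for x
    proof (cases "x \<in> nbhd S r")
      case True
      have "u (h *\<^sub>R e + x) - u x = (un n (h *\<^sub>R e + x) - un n x) - ((un n (h *\<^sub>R e + x) - u (h *\<^sub>R e + x)) - (un n x - u x))" by simp
      then show ?thesis using norm_diff_powr_le[OF p0, of "un n (h *\<^sub>R e + x) - un n x" "(un n (h *\<^sub>R e + x) - u (h *\<^sub>R e + x)) - (un n x - u x)"] True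
        by (simp add: c_def)
    qed (use c in simp)
    have i2: "integrable lborel (\<lambda>x. c * (?I x * norm (un n (h *\<^sub>R e + x) - un n x) powr p +
      norm ((un n (h *\<^sub>R e + x) - u (h *\<^sub>R e + x)) - (un n x - u x)) powr p))"
      using i1 tr(1)[of n] by auto
    have "(\<integral>x. ?I x * norm (u (h *\<^sub>R e + x) - u x) powr p \<partial>lborel) \<le> (\<integral>x. c * (?I x * norm (un n (h *\<^sub>R e + x) - un n x) powr p +
      norm ((un n (h *\<^sub>R e + x) - u (h *\<^sub>R e + x)) - (un n x - u x)) powr p) \<partial>lborel)"
      using pw c by (intro integral_mono_AE' i2) (auto intro!: AE_I2)
    also have "\<dots> = c * ((\<integral>x. ?I x * norm (un n (h *\<^sub>R e + x) - un n x) powr p \<partial>lborel) +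
      (\<integral>x. norm ((un n (h *\<^sub>R e + x) - u (h *\<^sub>R e + x)) - (un n x - u x)) powr p \<partial>lborel))"
      using i1 tr(1)[of n] by simp
    also have "\<dots> \<le> c * (h powr p * (c * (?G n + (\<integral>x. norm (g x) powr p \<partial>lborel))) + 2 * c * ?E n)"
      using c b2 tr(2)[of n] by (intro mult_left_mono add_mono) (auto simp: c_def)
    finally show ?thesis .
  qed
  have "(\<lambda>n. c * (h powr p * (c * (?G n + (\<integral>x. norm (g x) powr p \<partial>lborel))) + 2 * c * ?E n)) \<longlonglongrightarrow>
    c * (h powr p * (c * (0 + (\<integral>x. norm (g x) powr p \<partial>lborel))) + 2 * c * 0)"
    by (intro tendsto_intros un_Lp(2) gn_Lp(2))
  from LIMSEQ_le_const[OF this] le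
  show ?thesis by (simp add: c_def mult_ac)
qed

end

section \<open>The differenced equation\<close>

text \<open>The expression is the Leibniz formula for the gradient of \<open>\<zeta>\<close> times a
  difference of \<open>v\<close>, where \<open>k\<close> plays the gradient of \<open>v\<close> and
  \<open>Z\<close> that of \<open>\<zeta>\<close>. No such relation is assumed, so the lemma also
  applies to mollification errors and, with \<open>k = 0\<close>, to the test function
  itself.\<close>

lemma Lp_product_diff:
  fixes k :: "'a::euclidean_space \<Rightarrow> 'b::euclidean_space" and v :: "'a \<Rightarrow> real" and Z :: "'a \<Rightarrow> 'b"
  assumes p: "1 \<le> p"
    and [measurable]: "k \<in> borel_measurable borel" "v \<in> borel_measurable borel"
      "\<zeta> \<in> borel_measurable borel" "Z \<in> borel_measurable borel"
    and k: "integrable lborel (\<lambda>x. norm (k x) powr p)" and v: "integrable lborel (\<lambda>x. norm (v x) powr p)"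
    and B: "\<And>x. \<bar>\<zeta> x\<bar> \<le> B" "\<And>x. norm (Z x) \<le> B"
  shows "integrable lborel (\<lambda>x. norm (\<zeta> x *\<^sub>R (k (h + x) - k x) + (v (h + x) - v x) *\<^sub>R Z x) powr p)"
    "(\<integral>x. norm (\<zeta> x *\<^sub>R (k (h + x) - k x) + (v (h + x) - v x) *\<^sub>R Z x) powr p \<partial>lborel) \<le>
      2 powr p * B powr p * (2 * 2 powr p) * ((\<integral>x. norm (k x) powr p \<partial>lborel) + (\<integral>x. norm (v x) powr p \<partial>lborel))"
proof -
  have p0: "0 \<le> p" using p by simp
  have B0: "0 \<le> B" using B(1) by (meson abs_ge_zero order_trans)
  note tk = Lp_translation_le[OF p0 assms(2) k, of h] and tv = Lp_translation_le[OF p0 assms(3) v, of h]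
  let ?f = "\<lambda>x. norm (\<zeta> x *\<^sub>R (k (h + x) - k x) + (v (h + x) - v x) *\<^sub>R Z x) powr p"
  let ?g = "\<lambda>x. 2 powr p * B powr p * (norm (k (h + x) - k x) powr p + norm (v (h + x) - v x) powr p)"
  have i: "integrable lborel ?g" using tk(1) tv(1) by auto
  have pw: "?f x \<le> ?g x" for x
  proof -
    have "?f x \<le> 2 powr p * (norm (\<zeta> x *\<^sub>R (k (h + x) - k x)) powr p + norm ((v (h + x) - v x) *\<^sub>R Z x) powr p)"
      by (rule norm_add_powr_le[OF p0])
    also have "\<dots> \<le> 2 powr p * ((B * norm (k (h + x) - k x)) powr p + (B * norm (v (h + x) - v x)) powr p)"
    proof (intro mult_left_mono add_mono powr_mono2 p0)
      show "norm (\<zeta> x *\<^sub>R (k (h + x) - k x)) \<le> B * norm (k (h + x) - k x)"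
        using mult_right_mono[OF B(1) norm_ge_zero] by simp
      show "norm ((v (h + x) - v x) *\<^sub>R Z x) \<le> B * norm (v (h + x) - v x)"
        using mult_left_mono[OF B(2) abs_ge_zero] by (simp add: mult.commute[of B])
    qed auto
    also have "\<dots> = ?g x" using B0 by (simp add: powr_mult algebra_simps)
    finally show ?thesis .
  qed
  show 1: "integrable lborel ?f"
    by (rule Bochner_Integration.integrable_bound[OF i]) (use order_trans[OF pw abs_ge_self] in auto)
  have "(\<integral>x. ?f x \<partial>lborel) \<le> (\<integral>x. ?g x \<partial>lborel)"
    by (rule integral_mono[OF 1 i pw])
  also have "\<dots> = 2 powr p * B powr p * ((\<integral>x. norm (k (h + x) - k x) powr p \<partial>lborel) + (\<integral>x. norm (v (h + x) - v x) powr p \<partial>lborel))"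
    using tk(1) tv(1) by simp
  also have "\<dots> \<le> 2 powr p * B powr p * (2 * 2 powr p * (\<integral>x. norm (k x) powr p \<partial>lborel) + 2 * 2 powr p * (\<integral>x. norm (v x) powr p \<partial>lborel))"
    by (intro mult_left_mono add_mono tk(2) tv(2)) auto
  finally show "(\<integral>x. ?f x \<partial>lborel) \<le>
      2 powr p * B powr p * (2 * 2 powr p) * ((\<integral>x. norm (k x) powr p \<partial>lborel) + (\<integral>x. norm (v x) powr p \<partial>lborel))"
    by (simp add: algebra_simps)
qed

lemma integrable_bounded_inner:
  fixes f k :: "'a::euclidean_space \<Rightarrow> 'b::euclidean_space"
  assumes f: "integrable lborel f" and k: "k \<in> borel_measurable borel" "\<And>x. norm (k x) \<le> B"
  shows "integrable lborel (\<lambda>x. f x \<bullet> k x)"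
proof (rule Bochner_Integration.integrable_bound)
  show "integrable lborel (\<lambda>x. B * norm (f x))" using f by auto
  show "AE x in lborel. norm (f x \<bullet> k x) \<le> norm (B * norm (f x))"
  proof (rule AE_I2)
    fix x
    have "norm (f x \<bullet> k x) \<le> norm (f x) * norm (k x)" by (simp add: Cauchy_Schwarz_ineq2)
    also have "\<dots> \<le> norm (f x) * B" using k by (intro mult_left_mono) auto
    finally show "norm (f x \<bullet> k x) \<le> norm (B * norm (f x))" by (simp add: mult.commute)
  qed
qed (use f k in \<open>auto dest: borel_measurable_integrable\<close>)

lemma norm_H_le: "0 \<le> \<gamma> \<Longrightarrow> norm (H \<gamma> \<xi>) \<le> norm \<xi> powr \<gamma>"
  unfolding norm_H by (intro powr_mono2 norm_excess_le) auto

text \<open>Here \<open>F\<close> stands for \<open>f x (u x)\<close> after the cut-off. (F1) and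
  (F2) are merged into the single estimate \<open>FL\<close> along \<open>u\<close>, after which the
  two-variable function \<open>f\<close> is no longer visible.\<close>

locale weak_solution_cut = Sobolev_cut +
  fixes F :: "'a::euclidean_space \<Rightarrow> real" and L M C :: real
  assumes Fm[measurable]: "F \<in> borel_measurable borel"
    and F0: "\<And>x. x \<notin> nbhd S (4 * r) \<Longrightarrow> F x = 0" and FC: "\<And>x. \<bar>F x\<bar> \<le> C"
    and LM: "0 \<le> L" "0 \<le> M"
    and FL: "\<And>x y. x \<in> nbhd S (2 * r) \<Longrightarrow> y \<in> nbhd S (2 * r) \<Longrightarrow> \<bar>F x - F y\<bar> \<le> L * \<bar>u x - u y\<bar> + M * norm (x - y)"
    and eq: "\<And>\<phi>. test_fun (nbhd S (4 * r)) \<phi> \<Longrightarrow>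
      (\<integral>x. H (p - 1) (g x) \<bullet> cgrad \<phi> x \<partial>lborel) = (\<integral>x. F x * \<phi> x \<partial>lborel)"
begin

lemma A_int: "integrable lborel (\<lambda>x. H (p - 1) (g x))"
proof (rule Bochner_Integration.integrable_bound)
  show "integrable lborel (\<lambda>x. indicat_real (nbhd S (4 * r)) x + norm (g x) powr p)"
    using compact_indicator_integrable[OF compact_nbhd[OF S]] gLp by auto
  show "AE x in lborel. norm (H (p - 1) (g x)) \<le> norm (indicat_real (nbhd S (4 * r)) x + norm (g x) powr p)"
  proof (rule AE_I2)
    fix x
    show "norm (H (p - 1) (g x)) \<le> norm (indicat_real (nbhd S (4 * r)) x + norm (g x) powr p)"
    proof (cases "x \<in> nbhd S (4 * r)")
      case True
      have "norm (H (p - 1) (g x)) \<le> norm (g x) powr (p - 1)" using p by (intro norm_H_le) auto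
      also have "\<dots> \<le> 1 + norm (g x) powr p"
      proof (cases "norm (g x) \<le> 1")
        case True
        then have "norm (g x) powr (p - 1) \<le> 1" using p by (intro powr_le1) auto
        then show ?thesis by (simp add: add_increasing2)
      next
        case False
        then have "norm (g x) powr (p - 1) \<le> norm (g x) powr p" by (intro powr_mono) auto
        then show ?thesis by simp
      qed
      finally show ?thesis using True by simp
    qed (simp add: g0 H_def)
  qed
qed simp

lemma F_int: "integrable lborel F"
proof (rule Bochner_Integration.integrable_bound)
  show "integrable lborel (\<lambda>x. C * indicat_real (nbhd S (4 * r)) x)"
    using compact_indicator_integrable[OF compact_nbhd[OF S]] by auto
  show "AE x in lborel. norm (F x) \<le> norm (C * indicat_real (nbhd S (4 * r)) x)"
    using FC F0 by (auto intro!: AE_I2 simp: indicator_def intro: order_trans[OF _ abs_ge_self])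
qed simp

context
  fixes e :: 'a and h :: real and \<zeta> :: "'a \<Rightarrow> real"
  assumes e: "e \<in> Basis" and h: "0 < h" "h \<le> r" and \<zeta>: "test_fun (nbhd S r) \<zeta>"
begin

lemma norm_he: "norm (h *\<^sub>R e) = h" using e h by simp

lemma \<zeta>_measurable[measurable]: "\<zeta> \<in> borel_measurable borel" "cgrad \<zeta> \<in> borel_measurable borel"
  using test_fun_measurable[OF \<zeta>] cgrad_measurable[OF test_fun_smooth[OF \<zeta>]] by auto

text \<open>Discrete integration by parts. With \<open>\<psi>\<close> the cut-off times the forward
  difference of \<open>un n\<close>, the equation is tested with the backward difference of
  \<open>\<psi>\<close>; translation invariance moves that difference onto the field and onto
  \<open>F\<close>.\<close>

lemma mollified_difference_equation:
  "(\<integral>x. (H (p - 1) (g (h *\<^sub>R e + x)) - H (p - 1) (g x)) \<bullet>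
      (\<zeta> x *\<^sub>R (gn n (h *\<^sub>R e + x) - gn n x) + (un n (h *\<^sub>R e + x) - un n x) *\<^sub>R cgrad \<zeta> x) \<partial>lborel) =
   (\<integral>x. (F (h *\<^sub>R e + x) - F x) * ((un n (h *\<^sub>R e + x) - un n x) * \<zeta> x) \<partial>lborel)"
proof -
  let ?h = "h *\<^sub>R e"
  define \<psi> where "\<psi> x = (un n (?h + x) - un n x) * \<zeta> x" for x
  have smd: "smooth (\<lambda>x. un n (?h + x) - un n x)"
    by (intro smooth_diff smooth_shift smooth_un)
  have t\<psi>: "test_fun (nbhd S r) \<psi>"
    unfolding \<psi>_def by (rule test_fun_mult[OF smd \<zeta>])
  note sm\<psi> = test_fun_smooth[OF t\<psi>]
  have [measurable]: "\<psi> \<in> borel_measurable borel" "cgrad \<psi> \<in> borel_measurable borel"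
    using test_fun_measurable[OF t\<psi>] cgrad_measurable[OF sm\<psi>] by auto
  have cg: "cgrad \<psi> x = \<zeta> x *\<^sub>R (gn n (?h + x) - gn n x) + (un n (?h + x) - un n x) *\<^sub>R cgrad \<zeta> x" for x
  proof -
    have "cgrad \<psi> x = \<zeta> x *\<^sub>R cgrad (\<lambda>x. un n (?h + x) - un n x) x + (un n (?h + x) - un n x) *\<^sub>R cgrad \<zeta> x"
      unfolding \<psi>_def by (rule cgrad_mult[OF smd test_fun_smooth[OF \<zeta>]])
    \<comment> \<open>The gradient of the mollified function is known only inside the collar;
      elsewhere \<open>\<zeta>\<close> is zero and nothing has to be known.\<close>
    moreover have "\<zeta> x *\<^sub>R cgrad (\<lambda>x. un n (?h + x) - un n x) x = \<zeta> x *\<^sub>R (gn n (?h + x) - gn n x)"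
    proof (cases "x \<in> nbhd S r")
      case True
      have "?h + x \<in> nbhd S (3 * r)" by (rule nbhd_step[OF True, of _ h]) (use norm_he h in auto)
      moreover have "x \<in> nbhd S (3 * r)" using True nbhd_mono[of r "3 * r" S] r by auto
      ultimately show ?thesis
        by (simp add: cgrad_diff smooth_shift smooth_un cgrad_shift cgrad_un)
    qed (use test_fun_outside[OF \<zeta>] in simp)
    ultimately show ?thesis by simp
  qed
  define \<phi> where "\<phi> x = \<psi> (- ?h + x) - \<psi> x" for x
  have t\<phi>: "test_fun (nbhd S (4 * r)) \<phi>"
  proof (rule test_funI[OF _ compact_nbhd[OF S]])
    show "smooth \<phi>" unfolding \<phi>_def by (intro smooth_diff smooth_shift sm\<psi>)
    fix x assume x: "x \<notin> nbhd S (4 * r)"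
    have "- ?h + x \<notin> nbhd S r"
    proof
      assume "- ?h + x \<in> nbhd S r"
      then have "x \<in> nbhd S (4 * r)" by (rule nbhd_step[of _ _ _ _ h]) (use norm_he h r in auto)
      with x show False by simp
    qed
    moreover have "x \<notin> nbhd S r" using x nbhd_mono[of r "4 * r" S] r by auto
    ultimately show "\<phi> x = 0" using test_fun_outside[OF t\<psi>] by (simp add: \<phi>_def)
  qed simp
  obtain B where B: "\<And>x. norm (cgrad \<psi> x) \<le> B" using cgrad_bounded[OF t\<psi>] by blast
  obtain B' where B': "\<And>x. \<bar>\<psi> x\<bar> \<le> B'" using test_fun_bounded[OF t\<psi>] by blast
  have cg\<phi>: "cgrad \<phi> x = cgrad \<psi> (- ?h + x) - cgrad \<psi> x" for x
    unfolding \<phi>_def by (simp only: cgrad_diff[OF smooth_shift[OF sm\<psi>] sm\<psi>] cgrad_shift[OF sm\<psi>])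
  let ?A = "\<lambda>x. H (p - 1) (g x)"
  have iA: "integrable lborel (\<lambda>x. ?A x \<bullet> cgrad \<psi> (- ?h + x))" "integrable lborel (\<lambda>x. ?A x \<bullet> cgrad \<psi> x)"
    by (auto intro!: integrable_bounded_inner[OF A_int, where B=B] B)
  have iA': "integrable lborel (\<lambda>x. ?A (?h + x) \<bullet> cgrad \<psi> x)"
    using integrable_lborel_shift[OF iA(1), of ?h] by simp
  have iF: "integrable lborel (\<lambda>x. F x * \<psi> (- ?h + x))" "integrable lborel (\<lambda>x. F x * \<psi> x)"
    using integrable_bounded_inner[OF F_int, of "\<lambda>x. \<psi> (- ?h + x)" B'] integrable_bounded_inner[OF F_int, of \<psi> B'] B' by auto
  have iF': "integrable lborel (\<lambda>x. F (?h + x) * \<psi> x)"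
    using integrable_lborel_shift[OF iF(1), of ?h] by simp
  have "(\<integral>x. (?A (?h + x) - ?A x) \<bullet> cgrad \<psi> x \<partial>lborel) = (\<integral>x. ?A (?h + x) \<bullet> cgrad \<psi> x \<partial>lborel) - (\<integral>x. ?A x \<bullet> cgrad \<psi> x \<partial>lborel)"
    using iA(2) iA' by (simp add: inner_diff_left)
  also have "(\<integral>x. ?A (?h + x) \<bullet> cgrad \<psi> x \<partial>lborel) = (\<integral>x. ?A x \<bullet> cgrad \<psi> (- ?h + x) \<partial>lborel)"
    using integral_lborel_shift[of "\<lambda>x. ?A x \<bullet> cgrad \<psi> (- ?h + x)" ?h] by simp
  also have "\<dots> - (\<integral>x. ?A x \<bullet> cgrad \<psi> x \<partial>lborel) = (\<integral>x. ?A x \<bullet> cgrad \<phi> x \<partial>lborel)"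
    using iA by (simp add: cg\<phi> inner_diff_right)
  also have "\<dots> = (\<integral>x. F x * \<phi> x \<partial>lborel)" by (rule eq[OF t\<phi>])
  also have "\<dots> = (\<integral>x. F x * \<psi> (- ?h + x) \<partial>lborel) - (\<integral>x. F x * \<psi> x \<partial>lborel)"
    using iF by (simp add: \<phi>_def right_diff_distrib)
  also have "(\<integral>x. F x * \<psi> (- ?h + x) \<partial>lborel) = (\<integral>x. F (?h + x) * \<psi> x \<partial>lborel)"
    using integral_lborel_shift[of "\<lambda>x. F x * \<psi> (- ?h + x)" ?h] by simp
  also have "\<dots> - (\<integral>x. F x * \<psi> x \<partial>lborel) = (\<integral>x. (F (?h + x) - F x) * \<psi> x \<partial>lborel)"
    using iF(2) iF' by (simp add: left_diff_distrib)
  finally show ?thesis unfolding cg unfolding \<psi>_def .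
qed

text \<open>This is the domination that \<open>Lp_duality\<close> asks for, with a base whose
  \<open>p\<close>-th power is integrable.\<close>

lemma A_diff_dual:
  "norm (H (p - 1) (g (k + x)) - H (p - 1) (g x)) \<le> (2 * (norm (g (k + x)) + norm (g x))) powr (p - 1)"
proof -
  let ?m = "norm (g (k + x)) + norm (g x)"
  have "norm (H (p - 1) (g (k + x)) - H (p - 1) (g x)) \<le> norm (g (k + x)) powr (p - 1) + norm (g x) powr (p - 1)"
    using norm_triangle_ineq4[of "H (p - 1) (g (k + x))" "H (p - 1) (g x)"]
      norm_H_le[of "p - 1" "g (k + x)"] norm_H_le[of "p - 1" "g x"] p by simp
  also have "\<dots> \<le> ?m powr (p - 1) + ?m powr (p - 1)"
    using p by (intro add_mono powr_mono2) auto
  also have "\<dots> = 2 * ?m powr (p - 1)" by simp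
  \<comment> \<open>Since \<open>p - 1 \<ge> 1\<close>, the factor 2 can be absorbed into the base
    of the power.\<close>
  also have "\<dots> \<le> 2 powr (p - 1) * ?m powr (p - 1)"
    using powr_mono[of 1 "p - 1" 2] p by (intro mult_right_mono) auto
  also have "\<dots> = (2 * ?m) powr (p - 1)" by (subst powr_mult) auto
  finally show ?thesis .
qed

lemma A_diff_dual_int: "integrable lborel (\<lambda>x. (2 * (norm (g (k + x)) + norm (g x))) powr p)"
proof (rule Bochner_Integration.integrable_bound)
  show "integrable lborel (\<lambda>x. 2 powr p * (2 powr p * (norm (g (k + x)) powr p + norm (g x) powr p)))"
    using gLp integrable_lborel_shift[OF gLp, of k] by auto
  have "(2 * (norm (g (k + x)) + norm (g x))) powr p \<le> 2 powr p * (2 powr p * (norm (g (k + x)) powr p + norm (g x) powr p))" for x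
    using powr_add_le[of "norm (g (k + x))" "norm (g x)" p] p by (subst powr_mult) auto
  then show "AE x in lborel. norm ((2 * (norm (g (k + x)) + norm (g x))) powr p)
    \<le> norm (2 powr p * (2 powr p * (norm (g (k + x)) powr p + norm (g x) powr p)))"
    by auto
qed simp

lemma \<zeta>_bounds: obtains B where "\<And>x. \<bar>\<zeta> x\<bar> \<le> B" "\<And>x. norm (cgrad \<zeta> x) \<le> B"
proof -
  obtain B1 where "\<And>x. \<bar>\<zeta> x\<bar> \<le> B1" using test_fun_bounded[OF \<zeta>] by blast
  moreover obtain B2 where "\<And>x. norm (cgrad \<zeta> x) \<le> B2" using cgrad_bounded[OF \<zeta>] by blast
  ultimately show ?thesis by (intro that[of "max B1 B2"]) (auto simp: le_max_iff_disj)
qed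

text \<open>Limit of the mollified identity. The differences of the field and of \<open>F\<close> do
  not depend on \<open>n\<close> and are dual to \<open>Lp\<close>, while the test gradients
  \<open>wn\<close> and test functions \<open>vn\<close> converge in \<open>Lp\<close>.\<close>

lemma difference_equation:
  "integrable lborel (\<lambda>x. (H (p - 1) (g (h *\<^sub>R e + x)) - H (p - 1) (g x)) \<bullet>
      (\<zeta> x *\<^sub>R (g (h *\<^sub>R e + x) - g x) + (u (h *\<^sub>R e + x) - u x) *\<^sub>R cgrad \<zeta> x))"
  "integrable lborel (\<lambda>x. (F (h *\<^sub>R e + x) - F x) * ((u (h *\<^sub>R e + x) - u x) * \<zeta> x))"
  "(\<integral>x. (H (p - 1) (g (h *\<^sub>R e + x)) - H (p - 1) (g x)) \<bullet>
      (\<zeta> x *\<^sub>R (g (h *\<^sub>R e + x) - g x) + (u (h *\<^sub>R e + x) - u x) *\<^sub>R cgrad \<zeta> x) \<partial>lborel) =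
   (\<integral>x. (F (h *\<^sub>R e + x) - F x) * ((u (h *\<^sub>R e + x) - u x) * \<zeta> x) \<partial>lborel)"
proof -
  let ?h = "h *\<^sub>R e"
  obtain B where B: "\<And>x. \<bar>\<zeta> x\<bar> \<le> B" "\<And>x. norm (cgrad \<zeta> x) \<le> B" using \<zeta>_bounds by blast
  define a where "a x = H (p - 1) (g (?h + x)) - H (p - 1) (g x)" for x
  define b where "b x = F (?h + x) - F x" for x
  define w where "w x = \<zeta> x *\<^sub>R (g (?h + x) - g x) + (u (?h + x) - u x) *\<^sub>R cgrad \<zeta> x" for x
  define wn where "wn n x = \<zeta> x *\<^sub>R (gn n (?h + x) - gn n x) + (un n (?h + x) - un n x) *\<^sub>R cgrad \<zeta> x" for n x
  define v where "v x = (u (?h + x) - u x) * \<zeta> x" for x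
  define vn where "vn n x = (un n (?h + x) - un n x) * \<zeta> x" for n x
  have m: "a \<in> borel_measurable borel" "b \<in> borel_measurable borel" "w \<in> borel_measurable borel"
    "v \<in> borel_measurable borel" "wn n \<in> borel_measurable borel" "vn n \<in> borel_measurable borel" for n
    unfolding a_def[abs_def] b_def[abs_def] w_def[abs_def] v_def[abs_def] wn_def[abs_def] vn_def[abs_def] by measurable
  have wL: "integrable lborel (\<lambda>x. norm (w x) powr p)"
    unfolding w_def by (rule Lp_product_diff(1)[OF p1 _ _ _ _ gLp uLp B]) simp_all
  \<comment> \<open>The test function is the degenerate case of the Leibniz expression: zero
    gradient part, and \<open>\<zeta>\<close> in the place of \<open>Z\<close>.\<close>
  have vL: "integrable lborel (\<lambda>x. norm (v x) powr p)"
    using Lp_product_diff(1)[OF p1, of "\<lambda>_. 0::real" u "\<lambda>_. 0" \<zeta>, where B=B and h="?h"] uLp B(1)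
      order_trans[OF abs_ge_zero B(1)] by (simp add: v_def)
  have dm: "(\<lambda>x. gn n x - g x) \<in> borel_measurable borel" "(\<lambda>x. un n x - u x) \<in> borel_measurable borel" for n by auto
  have wne: "wn n x - w x = \<zeta> x *\<^sub>R ((gn n (?h + x) - g (?h + x)) - (gn n x - g x)) + ((un n (?h + x) - u (?h + x)) - (un n x - u x)) *\<^sub>R cgrad \<zeta> x" for n x
    by (simp add: wn_def w_def algebra_simps)
  have vne: "vn n x - v x = 0 *\<^sub>R (0 - 0) + ((un n (?h + x) - u (?h + x)) - (un n x - u x)) *\<^sub>R \<zeta> x" for n x
    by (simp add: vn_def v_def algebra_simps)
  have W: "integrable lborel (\<lambda>x. norm (wn n x - w x) powr p)"
    "(\<integral>x. norm (wn n x - w x) powr p \<partial>lborel) \<le>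
      2 powr p * B powr p * (2 * 2 powr p) * ((\<integral>x. norm (gn n x - g x) powr p \<partial>lborel) + (\<integral>x. norm (un n x - u x) powr p \<partial>lborel))" for n
    using Lp_product_diff[OF p1 dm(1)[of n] dm(2)[of n] \<zeta>_measurable gn_Lp(1) un_Lp(1) B, where h="?h"]
    by (simp_all only: wne)
  have V: "integrable lborel (\<lambda>x. norm (vn n x - v x) powr p)"
    "(\<integral>x. norm (vn n x - v x) powr p \<partial>lborel) \<le>
      2 powr p * B powr p * (2 * 2 powr p) * (\<integral>x. norm (un n x - u x) powr p \<partial>lborel)" for n
    using Lp_product_diff[OF p1 _ dm(2)[of n], of "\<lambda>_. 0::real" "\<lambda>_. 0" \<zeta> B ?h] un_Lp(1)[of n] B(1)
      order_trans[OF abs_ge_zero B(1)] by (auto simp: vne)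
  define c where "c = 2 powr p * B powr p * (2 * 2 powr p)"
  have Wlim: "(\<lambda>n. \<integral>x. norm (wn n x - w x) powr p \<partial>lborel) \<longlonglongrightarrow> 0"
  proof (rule tendsto_sandwich[OF _ _ tendsto_const])
    show "(\<lambda>n. c * ((\<integral>x. norm (gn n x - g x) powr p \<partial>lborel) + (\<integral>x. norm (un n x - u x) powr p \<partial>lborel))) \<longlonglongrightarrow> 0"
      using tendsto_mult_right_zero[OF tendsto_add_zero[OF gn_Lp(2) un_Lp(2)], of c] by simp
    show "\<forall>\<^sub>F n in sequentially. (\<integral>x. norm (wn n x - w x) powr p \<partial>lborel) \<le> c * ((\<integral>x. norm (gn n x - g x) powr p \<partial>lborel) + (\<integral>x. norm (un n x - u x) powr p \<partial>lborel))"
      unfolding c_def by (intro always_eventually allI W(2))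
  qed simp
  have Vlim: "(\<lambda>n. \<integral>x. norm (vn n x - v x) powr p \<partial>lborel) \<longlonglongrightarrow> 0"
  proof (rule tendsto_sandwich[OF _ _ tendsto_const])
    show "(\<lambda>n. c * (\<integral>x. norm (un n x - u x) powr p \<partial>lborel)) \<longlonglongrightarrow> 0"
      using tendsto_mult_right_zero[OF un_Lp(2), of c] by simp
    show "\<forall>\<^sub>F n in sequentially. (\<integral>x. norm (vn n x - v x) powr p \<partial>lborel) \<le> c * (\<integral>x. norm (un n x - u x) powr p \<partial>lborel)"
      unfolding c_def by (intro always_eventually allI V(2))
  qed simp
  have aB: "norm (a x) \<le> (2 * (norm (g (?h + x)) + norm (g x))) powr (p - 1)" for x
    unfolding a_def by (rule A_diff_dual)
  have aB0: "0 \<le> 2 * (norm (g (?h + x)) + norm (g x))" for x by simp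
  have C0: "0 \<le> C" using FC[of undefined] by linarith
  \<comment> \<open>The summand 1 makes the base at least 1, so raising it to the power
    \<open>p - 1\<close> does not decrease it. The set is \<open>nbhd S (5 * r)\<close> because the
    shifted \<open>F\<close> may be nonzero one step outside \<open>nbhd S (4 * r)\<close>.\<close>
  let ?b = "\<lambda>x. (1 + 2 * C) * indicat_real (nbhd S (5 * r)) x"
  have bB0: "0 \<le> ?b x" for x using C0 by simp
  have bi: "integrable lborel (\<lambda>x. ?b x powr p)"
  proof -
    have "(\<lambda>x. ?b x powr p) = (\<lambda>x. (1 + 2 * C) powr p * indicat_real (nbhd S (5 * r)) x)"
      by (auto simp: fun_eq_iff indicator_def)
    then show ?thesis using compact_indicator_integrable[OF compact_nbhd[OF S]] by auto
  qed
  have bB: "norm (b x) \<le> ?b x powr (p - 1)" for x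
  proof (cases "x \<in> nbhd S (5 * r)")
    case True
    have "norm (b x) \<le> 1 + 2 * C" using FC[of "?h + x"] FC[of x] by (auto simp: b_def)
    also have "\<dots> \<le> (1 + 2 * C) powr (p - 1)" using powr_mono[of 1 "p - 1" "1 + 2 * C"] p C0 by simp
    finally show ?thesis using True by simp
  next
    case False
    have "?h + x \<notin> nbhd S (4 * r)"
    proof
      assume "?h + x \<in> nbhd S (4 * r)"
      then have "x \<in> nbhd S (5 * r)" by (rule nbhd_step[of _ _ _ _ h]) (use norm_he h in auto)
      with False show False by simp
    qed
    moreover have "x \<notin> nbhd S (4 * r)" using False nbhd_mono[of "4 * r" "5 * r" S] r by auto
    ultimately show ?thesis by (simp add: b_def F0)
  qed
  show "integrable lborel (\<lambda>x. (H (p - 1) (g (?h + x)) - H (p - 1) (g x)) \<bullet>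
      (\<zeta> x *\<^sub>R (g (?h + x) - g x) + (u (?h + x) - u x) *\<^sub>R cgrad \<zeta> x))"
    using Lp_duality(1)[OF p1 m(1,3) aB0 A_diff_dual_int aB wL, of 1] by (simp add: a_def w_def)
  show "integrable lborel (\<lambda>x. (F (?h + x) - F x) * ((u (?h + x) - u x) * \<zeta> x))"
    using Lp_duality(1)[OF p1 m(2,4) bB0 bi bB vL, of 1] by (simp add: b_def v_def)
  have 1: "(\<lambda>n. \<integral>x. a x \<bullet> wn n x \<partial>lborel) \<longlonglongrightarrow> (\<integral>x. a x \<bullet> w x \<partial>lborel)"
    by (rule Lp_duality_tendsto[OF p1 m(1,3,5) aB0 A_diff_dual_int aB wL W(1) Wlim])
  have 2: "(\<lambda>n. \<integral>x. b x \<bullet> vn n x \<partial>lborel) \<longlonglongrightarrow> (\<integral>x. b x \<bullet> v x \<partial>lborel)"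
    by (rule Lp_duality_tendsto[OF p1 m(2,4,6) bB0 bi bB vL V(1) Vlim])
  have "(\<integral>x. a x \<bullet> wn n x \<partial>lborel) = (\<integral>x. b x \<bullet> vn n x \<partial>lborel)" for n
    using mollified_difference_equation[of n] by (simp add: a_def b_def wn_def vn_def)
  then have "(\<lambda>n. \<integral>x. a x \<bullet> wn n x \<partial>lborel) \<longlonglongrightarrow> (\<integral>x. b x \<bullet> v x \<partial>lborel)"
    using 2 by simp
  from LIMSEQ_unique[OF 1 this] have "(\<integral>x. a x \<bullet> w x \<partial>lborel) = (\<integral>x. b x \<bullet> v x \<partial>lborel)" .
  then show "(\<integral>x. (H (p - 1) (g (?h + x)) - H (p - 1) (g x)) \<bullet>
      (\<zeta> x *\<^sub>R (g (?h + x) - g x) + (u (?h + x) - u x) *\<^sub>R cgrad \<zeta> x) \<partial>lborel) =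
   (\<integral>x. (F (?h + x) - F x) * ((u (?h + x) - u x) * \<zeta> x) \<partial>lborel)"
    by (simp add: a_def b_def w_def v_def)
qed

end

end

section \<open>The Caccioppoli estimate\<close>

lemma norm_powr_2: "norm x powr 2 = (norm x)\<^sup>2"
  by (cases "x = 0") auto

text \<open>Replace both variables by their maximum and count degrees:
  \<open>2 * (p / 2 - 1) + 2 = p\<close>. It decouples the weight of the growth bound from the
  difference quotient of \<open>u\<close>.\<close>

lemma powr_product_le:
  fixes m t :: real
  assumes "0 \<le> m" "0 \<le> t" "2 \<le> p"
  shows "(m powr (p / 2 - 1) * t)\<^sup>2 \<le> m powr p + t powr p"
proof -
  define k where "k = max m t"
  have k: "m \<le> k" "t \<le> k" "0 \<le> k" using assms by (auto simp: k_def)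
  have "m powr (p / 2 - 1) * t \<le> k powr (p / 2 - 1) * k"
    using k assms by (intro mult_mono powr_mono2) auto
  also have "\<dots> = k powr (p / 2)"
    using powr_mult_base[OF k(3), of "p / 2 - 1"] by (simp add: mult.commute)
  finally have "(m powr (p / 2 - 1) * t)\<^sup>2 \<le> (k powr (p / 2))\<^sup>2"
    using assms by (intro power_mono) auto
  also have "\<dots> = k powr p" by (simp add: power2_eq_square powr_add[symmetric])
  also have "\<dots> \<le> m powr p + t powr p" by (auto simp: k_def max_def)
  finally show ?thesis .
qed

lemma Young_product: "0 < c \<Longrightarrow> x * y \<le> c / 2 * x\<^sup>2 + y\<^sup>2 / (2 * c)" for x y c :: real
proof -
  assume c: "0 < c"
  have "0 \<le> (c * x - y)\<^sup>2 / (2 * c)" using c by simp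
  also have "\<dots> = c / 2 * x\<^sup>2 + y\<^sup>2 / (2 * c) - x * y"
    using c by (simp add: power2_eq_square field_simps)
  finally show ?thesis by simp
qed

lemma integral_linear_combination:
  fixes f g k :: "'a \<Rightarrow> real"
  assumes "integrable M f" "integrable M g" "integrable M k"
  shows "integrable M (\<lambda>x. a * (f x - g x + b * k x))"
    "(\<integral>x. a * (f x - g x + b * k x) \<partial>M) = a * ((\<integral>x. f x \<partial>M) - (\<integral>x. g x \<partial>M) + b * (\<integral>x. k x \<partial>M))"
  using assms by simp_all

context weak_solution_cut
begin

lemma V_Lp2: "integrable lborel (\<lambda>x. (norm (H (p / 2) (g x)))\<^sup>2)"
proof (rule Bochner_Integration.integrable_bound[OF gLp])
  have "(norm (H (p / 2) (g x)))\<^sup>2 \<le> norm (g x) powr p" for x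
  proof -
    have "(norm (H (p / 2) (g x)))\<^sup>2 = norm (excess (g x)) powr p"
      by (simp add: norm_H power2_eq_square powr_add[symmetric])
    also have "\<dots> \<le> norm (g x) powr p" using p by (intro powr_mono2 norm_excess_le) auto
    finally show ?thesis .
  qed
  then show "AE x in lborel. norm ((norm (H (p / 2) (g x)))\<^sup>2) \<le> norm (norm (g x) powr p)" by auto
qed simp

lemma V_diff_int: "integrable lborel (\<lambda>x. (norm (H (p / 2) (g (k + x)) - H (p / 2) (g x)))\<^sup>2)"
  using Lp_translation_le(1)[of 2 "\<lambda>x. H (p / 2) (g x)" k] V_Lp2 by (simp add: norm_powr_2)

text \<open>Everything except the integration. The first two terms on the right are the integrands
  of the difference equation and cancel after integration, so only the remainder with factor
  \<open>h\<^sup>2\<close> survives. The bound on \<open>Z\<close> carries a factor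
  \<open>\<eta>\<close>, as for the gradient of a squared cut-off, and this factor lets the cross
  term be absorbed.\<close>

lemma caccioppoli_pointwise:
  assumes \<eta>: "0 \<le> \<eta>" "\<eta> \<le> B0" "norm Z \<le> 2 * \<eta> * B" and h: "0 < h" and B0: "1 \<le> B0" and B: "0 \<le> B"
    and F: "\<bar>\<tau>F\<bar> \<le> L * \<bar>\<tau>u\<bar> + M * h"
  shows "2 / p\<^sup>2 * (\<eta>\<^sup>2 * (norm (H (p / 2) \<xi>' - H (p / 2) \<xi>))\<^sup>2) \<le>
    (H (p - 1) \<xi>' - H (p - 1) \<xi>) \<bullet> (\<eta>\<^sup>2 *\<^sub>R (\<xi>' - \<xi>) + \<tau>u *\<^sub>R Z) - \<tau>F * (\<tau>u * \<eta>\<^sup>2)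
    + h\<^sup>2 * (2 * p\<^sup>2 * B\<^sup>2 * (norm \<xi>' powr p + norm \<xi> powr p + \<bar>\<tau>u\<bar> powr p / h powr p)
      + B0\<^sup>2 * (L + M) * (1 + \<bar>\<tau>u\<bar> powr p / h powr p))"
proof -
  define c where "c = 4 / p\<^sup>2"
  have c: "c > 0" using p by (simp add: c_def)
  define W where "W = norm (H (p / 2) \<xi>' - H (p / 2) \<xi>)"
  define m where "m = max (norm (excess \<xi>')) (norm (excess \<xi>))"
  have m: "0 \<le> m" by (auto simp: m_def le_max_iff_disj)
  define t where "t = \<bar>\<tau>u\<bar> / h"
  have t: "0 \<le> t" "\<bar>\<tau>u\<bar> = h * t" using h by (auto simp: t_def)
  have tp: "\<bar>\<tau>u\<bar> powr p / h powr p = t powr p" by (simp add: t_def powr_divide)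
  let ?A = "H (p - 1) \<xi>' - H (p - 1) \<xi>"
  have 1: "\<eta>\<^sup>2 * (c * W\<^sup>2) \<le> \<eta>\<^sup>2 * (?A \<bullet> (\<xi>' - \<xi>))"
    unfolding W_def c_def by (intro mult_left_mono H_monotone p) simp
  have 2: "\<bar>?A \<bullet> (\<tau>u *\<^sub>R Z)\<bar> \<le> c / 2 * (\<eta>\<^sup>2 * W\<^sup>2) + h\<^sup>2 * (2 * p\<^sup>2 * B\<^sup>2 * (norm \<xi>' powr p + norm \<xi> powr p + t powr p))"
  proof -
    have "\<bar>?A \<bullet> (\<tau>u *\<^sub>R Z)\<bar> \<le> norm ?A * norm (\<tau>u *\<^sub>R Z)" by (rule Cauchy_Schwarz_ineq2)
    also have "\<dots> \<le> (2 * m powr (p / 2 - 1) * W) * (h * t * (2 * \<eta> * B))"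
    proof (rule mult_mono)
      show "norm ?A \<le> 2 * m powr (p / 2 - 1) * W" unfolding m_def W_def by (rule H_growth[OF p])
      show "norm (\<tau>u *\<^sub>R Z) \<le> h * t * (2 * \<eta> * B)"
        using mult_left_mono[OF \<eta>(3) abs_ge_zero[of \<tau>u]] t by simp
    qed (auto simp: W_def)
    also have "\<dots> = (\<eta> * W) * (4 * B * h * (m powr (p / 2 - 1) * t))" by simp
    also have "\<dots> \<le> c / 2 * (\<eta> * W)\<^sup>2 + (4 * B * h * (m powr (p / 2 - 1) * t))\<^sup>2 / (2 * c)"
      by (rule Young_product[OF c])
    \<comment> \<open>The constant is \<open>16 / (2 * c) = 2 * p\<^sup>2\<close>.\<close>
    also have "(4 * B * h * (m powr (p / 2 - 1) * t))\<^sup>2 / (2 * c) = h\<^sup>2 * (2 * p\<^sup>2 * B\<^sup>2 * (m powr (p / 2 - 1) * t)\<^sup>2)"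
      using p by (simp add: c_def power_mult_distrib)
    also have "\<dots> \<le> h\<^sup>2 * (2 * p\<^sup>2 * B\<^sup>2 * (norm \<xi>' powr p + norm \<xi> powr p + t powr p))"
    proof (intro mult_left_mono)
      have "(m powr (p / 2 - 1) * t)\<^sup>2 \<le> m powr p + t powr p" by (rule powr_product_le[OF m t(1) p])
      also have "m powr p \<le> norm (excess \<xi>') powr p + norm (excess \<xi>) powr p" by (auto simp: m_def max_def)
      also have "\<dots> \<le> norm \<xi>' powr p + norm \<xi> powr p"
        using p by (intro add_mono powr_mono2 norm_excess_le) auto
      finally show "(m powr (p / 2 - 1) * t)\<^sup>2 \<le> norm \<xi>' powr p + norm \<xi> powr p + t powr p" by simp
    qed auto
    finally show ?thesis by (simp add: power_mult_distrib)
  qed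
  have 3: "\<bar>\<tau>F * (\<tau>u * \<eta>\<^sup>2)\<bar> \<le> h\<^sup>2 * (B0\<^sup>2 * (L + M) * (1 + t powr p))"
  proof -
    have "\<bar>\<tau>F * (\<tau>u * \<eta>\<^sup>2)\<bar> = \<bar>\<tau>F\<bar> * (h * t) * \<eta>\<^sup>2" by (simp add: abs_mult t)
    also have "\<dots> \<le> (L * (h * t) + M * h) * (h * t) * B0\<^sup>2"
      using F t h \<eta> LM by (intro mult_mono power_mono) auto
    also have "\<dots> = h\<^sup>2 * (B0\<^sup>2 * (L * t\<^sup>2 + M * t))"
      by (simp add: power2_eq_square algebra_simps)
    also have "\<dots> \<le> h\<^sup>2 * (B0\<^sup>2 * (L * (1 + t powr p) + M * (1 + t powr p)))"
    proof (intro mult_left_mono add_mono)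
      show "t \<le> 1 + t powr p" by (rule le_1_plus_powr[OF t(1) p1])
      \<comment> \<open>The bound \<open>a \<le> 1 + a powr q\<close> for
        \<open>a = t\<^sup>2\<close> and \<open>q = p / 2\<close>, which is at least 1.\<close>
      have "t\<^sup>2 \<le> 1 + (t\<^sup>2) powr (p / 2)" using p by (intro le_1_plus_powr) auto
      also have "(t\<^sup>2) powr (p / 2) = t powr p"
        using t powr_powr[of t 2 "p / 2"] norm_powr_2[of t] by simp
      finally show "t\<^sup>2 \<le> 1 + t powr p" .
    qed (use LM in auto)
    finally show ?thesis by (simp add: algebra_simps)
  qed
  define Q where "Q = ?A \<bullet> (\<eta>\<^sup>2 *\<^sub>R (\<xi>' - \<xi>) + \<tau>u *\<^sub>R Z)"
  define R1 where "R1 = 2 * p\<^sup>2 * B\<^sup>2 * (norm \<xi>' powr p + norm \<xi> powr p + t powr p)"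
  define R2 where "R2 = B0\<^sup>2 * (L + M) * (1 + t powr p)"
  have Q: "Q = \<eta>\<^sup>2 * (?A \<bullet> (\<xi>' - \<xi>)) + ?A \<bullet> (\<tau>u *\<^sub>R Z)"
    by (simp add: Q_def inner_add_right)
  \<comment> \<open>Half of the coercivity constant pays for the cross term; the other half is the
    gain.\<close>
  have "2 / p\<^sup>2 = c - c / 2" by (simp add: c_def)
  then have "2 / p\<^sup>2 * (\<eta>\<^sup>2 * W\<^sup>2) = c * (\<eta>\<^sup>2 * W\<^sup>2) - c / 2 * (\<eta>\<^sup>2 * W\<^sup>2)"
    by (simp only: left_diff_distrib)
  also have "c * (\<eta>\<^sup>2 * W\<^sup>2) = \<eta>\<^sup>2 * (c * W\<^sup>2)" by (rule mult.left_commute)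
  also have "\<dots> - c / 2 * (\<eta>\<^sup>2 * W\<^sup>2) \<le> Q - \<tau>F * (\<tau>u * \<eta>\<^sup>2) + (h\<^sup>2 * R1 + h\<^sup>2 * R2)"
    using 1 2 3 unfolding Q R1_def[symmetric] R2_def[symmetric] by linarith
  also have "h\<^sup>2 * R1 + h\<^sup>2 * R2 = h\<^sup>2 * (R1 + R2)" by (rule distrib_left[symmetric])
  finally show ?thesis unfolding W_def tp Q_def R1_def R2_def .
qed

text \<open>After integration the difference equation removes the terms \<open>?Q\<close> and
  \<open>?P\<close>. The remainder is bounded uniformly in \<open>e\<close> and \<open>h\<close>
  because the difference quotients of \<open>u\<close> are, and this uniformity is the whole point
  of the quantifier order.\<close>

lemma caccioppoli:
  "\<exists>C. \<forall>e\<in>Basis. \<forall>h. 0 < h \<and> h \<le> r \<longrightarrow>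
    (\<integral>x. indicator S x * (norm (H (p / 2) (g (h *\<^sub>R e + x)) - H (p / 2) (g x)))\<^sup>2 \<partial>lborel) \<le> C * h\<^sup>2"
proof -
  obtain \<eta> where \<eta>: "test_fun (nbhd S r) \<eta>" "\<And>x. 0 \<le> \<eta> x" "\<And>x. x \<in> S \<Longrightarrow> \<eta> x = 1"
    using smooth_cutoff[OF S r] by blast
  note sm = test_fun_smooth[OF \<eta>(1)]
  \<comment> \<open>The square of the cut-off, so that its gradient again contains a factor
    \<open>\<eta>\<close>.\<close>
  define \<zeta> where "\<zeta> x = \<eta> x * \<eta> x" for x
  have \<zeta>: "test_fun (nbhd S r) \<zeta>" unfolding \<zeta>_def by (rule test_fun_mult[OF sm \<eta>(1)])
  have Z: "cgrad \<zeta> x = (2 * \<eta> x) *\<^sub>R cgrad \<eta> x" for x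
    unfolding \<zeta>_def mult_2 scaleR_add_left by (rule cgrad_mult[OF sm sm])
  obtain B' where B': "B' > 0" "\<And>x. \<bar>\<eta> x\<bar> \<le> B'" using test_fun_bounded[OF \<eta>(1)] by blast
  define B0 where "B0 = 1 + B'"
  have B0: "1 \<le> B0" "\<eta> x \<le> B0" for x
    using B'(1) B'(2)[of x] unfolding B0_def by linarith+
  obtain B where B: "B > 0" "\<And>x. norm (cgrad \<eta> x) \<le> B" using cgrad_bounded[OF \<eta>(1)] by blast
  have [measurable]: "\<eta> \<in> borel_measurable borel" "S \<in> sets borel" "nbhd S r \<in> sets borel"
    using test_fun_measurable[OF \<eta>(1)] S compact_nbhd[OF S] borel_compact by auto
  define G where "G = (\<integral>x. norm (g x) powr p \<partial>lborel)"
  define D where "D = 2 powr p * 2 powr p * G"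
  define N where "N = measure lborel (nbhd S r)"
  define K where "K = 2 * p\<^sup>2 * B\<^sup>2 * (G + G + D) + B0\<^sup>2 * (L + M) * (N + D)"
  show ?thesis
  proof (intro exI ballI allI impI, elim conjE)
    fix e :: 'a and h :: real assume e: "e \<in> Basis" and h: "0 < h" "h \<le> r"
    let ?h = "h *\<^sub>R e"
    let ?I = "indicat_real (nbhd S r)"
    let ?W = "\<lambda>x. (norm (H (p / 2) (g (?h + x)) - H (p / 2) (g x)))\<^sup>2"
    \<comment> \<open>The difference quotient of \<open>u\<close> is controlled only on
      \<open>nbhd S r\<close>, whence the indicator. Outside this set the cut-off and its gradient
      vanish, and nonnegativity of the remainder suffices.\<close>
    let ?T = "\<lambda>x. ?I x * norm (u (?h + x) - u x) powr p"
    let ?Q = "\<lambda>x. (H (p - 1) (g (?h + x)) - H (p - 1) (g x)) \<bullet>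
      (\<zeta> x *\<^sub>R (g (?h + x) - g x) + (u (?h + x) - u x) *\<^sub>R cgrad \<zeta> x)"
    let ?P = "\<lambda>x. (F (?h + x) - F x) * ((u (?h + x) - u x) * \<zeta> x)"
    let ?R = "\<lambda>x. 2 * p\<^sup>2 * B\<^sup>2 * (norm (g (?h + x)) powr p + norm (g x) powr p + ?T x / h powr p) + B0\<^sup>2 * (L + M) * (?I x + ?T x / h powr p)"
    note E = difference_equation[OF e h \<zeta>]
    have nh: "norm ?h = h" using e h by simp
    have iT: "integrable lborel ?T"
    proof (rule Bochner_Integration.integrable_bound[OF Lp_translation_le(1)[OF p0 um uLp, of ?h]])
      show "AE x in lborel. norm (?T x) \<le> norm (norm (u (?h + x) - u x) powr p)"
        by (auto simp: indicator_def)
    qed simp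
    have T: "(\<integral>x. ?T x \<partial>lborel) / h powr p \<le> D"
      using u_diffquot_Lp[OF e h] h by (simp add: D_def G_def divide_le_eq)
    have iI: "integrable lborel ?I" by (rule compact_indicator_integrable[OF compact_nbhd[OF S]])
    have ig: "integrable lborel (\<lambda>x. norm (g (?h + x)) powr p)" by (rule integrable_lborel_shift[OF gLp])
    have iR: "integrable lborel ?R" using iT iI ig gLp by auto
    have eR: "(\<integral>x. ?R x \<partial>lborel) \<le> K"
    proof -
      have "(\<integral>x. ?R x \<partial>lborel) = 2 * p\<^sup>2 * B\<^sup>2 * (G + G + (\<integral>x. ?T x \<partial>lborel) / h powr p) + B0\<^sup>2 * (L + M) * (N + (\<integral>x. ?T x \<partial>lborel) / h powr p)"
        using iT iI ig gLp integral_lborel_shift[of "\<lambda>x. norm (g x) powr p" ?h] by (simp add: G_def N_def)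
      also have "\<dots> \<le> K" unfolding K_def using T LM by (intro add_mono mult_left_mono) auto
      finally show ?thesis .
    qed
    have pw: "2 / p\<^sup>2 * (\<zeta> x * ?W x) \<le> ?Q x - ?P x + h\<^sup>2 * ?R x" for x
    proof (cases "x \<in> nbhd S r")
      case True
      have "x \<in> nbhd S (2 * r)" using True nbhd_mono[of r "2 * r" S] r by auto
      moreover have "?h + x \<in> nbhd S (2 * r)" by (rule nbhd_step[OF True, of _ h]) (use nh h in auto)
      ultimately have F: "\<bar>F (?h + x) - F x\<bar> \<le> L * \<bar>u (?h + x) - u x\<bar> + M * h"
        using FL[of "?h + x" x] nh by simp
      have "norm (cgrad \<zeta> x) \<le> 2 * \<eta> x * B"
        using mult_left_mono[OF B(2)[of x], of "2 * \<eta> x"] \<eta>(2)[of x] by (simp add: Z)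
      from caccioppoli_pointwise[OF \<eta>(2) B0(2) this h(1) B0(1) less_imp_le[OF B(1)] F, of "g (?h + x)" "g x"] True
      show ?thesis by (simp add: \<zeta>_def power2_eq_square[of "\<eta> x"])
    next
      case False
      then have "\<eta> x = 0" using test_fun_outside[OF \<eta>(1)] by simp
      then have "\<zeta> x = 0" "cgrad \<zeta> x = 0" by (auto simp: \<zeta>_def Z)
      then show ?thesis using False LM by simp
    qed
    have "(\<integral>x. indicator S x * ?W x \<partial>lborel) \<le> (\<integral>x. p\<^sup>2 / 2 * (?Q x - ?P x + h\<^sup>2 * ?R x) \<partial>lborel)"
    proof (rule integral_mono_AE')
      show "integrable lborel (\<lambda>x. p\<^sup>2 / 2 * (?Q x - ?P x + h\<^sup>2 * ?R x))"
        by (rule integral_linear_combination(1)[OF E(1,2) iR])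
      have le: "indicator S x * ?W x \<le> p\<^sup>2 / 2 * (?Q x - ?P x + h\<^sup>2 * ?R x)" for x
      proof -
        have "indicator S x * ?W x \<le> \<zeta> x * ?W x"
          using \<eta>(2,3) by (intro mult_right_mono) (auto simp: indicator_def \<zeta>_def)
        also have "\<dots> = p\<^sup>2 / 2 * (2 / p\<^sup>2 * (\<zeta> x * ?W x))" using p by simp
        also have "\<dots> \<le> p\<^sup>2 / 2 * (?Q x - ?P x + h\<^sup>2 * ?R x)" by (rule mult_left_mono[OF pw]) simp
        finally show ?thesis .
      qed
      then show "AE x in lborel. indicator S x * ?W x \<le> p\<^sup>2 / 2 * (?Q x - ?P x + h\<^sup>2 * ?R x)"
        by (rule AE_I2)
      show "AE x in lborel. 0 \<le> p\<^sup>2 / 2 * (?Q x - ?P x + h\<^sup>2 * ?R x)"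
      proof (rule AE_I2)
        fix x
        have "0 \<le> indicator S x * ?W x" by simp
        also note le
        finally show "0 \<le> p\<^sup>2 / 2 * (?Q x - ?P x + h\<^sup>2 * ?R x)" .
      qed
    qed
    also have "\<dots> = p\<^sup>2 / 2 * ((\<integral>x. ?Q x \<partial>lborel) - (\<integral>x. ?P x \<partial>lborel) + h\<^sup>2 * (\<integral>x. ?R x \<partial>lborel))"
      by (rule integral_linear_combination(2)[OF E(1,2) iR])
    also have "\<dots> = p\<^sup>2 / 2 * (h\<^sup>2 * (\<integral>x. ?R x \<partial>lborel))"
      unfolding E(3) by simp
    also have "\<dots> \<le> p\<^sup>2 / 2 * (h\<^sup>2 * K)"
      by (intro mult_left_mono eR) auto
    finally show "(\<integral>x. indicator S x * ?W x \<partial>lborel) \<le> (p\<^sup>2 / 2 * K) * h\<^sup>2" by (simp add: mult_ac)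
  qed
qed

end

section \<open>Representation of functionals on square-integrable functions\<close>

lemma L2_integrable_product:
  fixes f g :: "'a \<Rightarrow> real"
  assumes [measurable]: "f \<in> borel_measurable M" "g \<in> borel_measurable M"
    and "integrable M (\<lambda>x. (f x)\<^sup>2)" "integrable M (\<lambda>x. (g x)\<^sup>2)"
  shows "integrable M (\<lambda>x. f x * g x)"
proof (rule Bochner_Integration.integrable_bound)
  show "integrable M (\<lambda>x. (f x)\<^sup>2 + (g x)\<^sup>2)" using assms by auto
  have "\<bar>f x * g x\<bar> \<le> (f x)\<^sup>2 + (g x)\<^sup>2" for x
  proof -
    have "2 * (\<bar>f x\<bar> * \<bar>g x\<bar>) \<le> (f x)\<^sup>2 + (g x)\<^sup>2"
      using sum_squares_bound[of "\<bar>f x\<bar>" "\<bar>g x\<bar>"] by (simp add: mult.assoc)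
    moreover have "0 \<le> \<bar>f x\<bar> * \<bar>g x\<bar>" by simp
    ultimately show ?thesis unfolding abs_mult by linarith
  qed
  then show "AE x in M. norm (f x * g x) \<le> norm ((f x)\<^sup>2 + (g x)\<^sup>2)" by auto
qed simp

lemma L2_integrable_combination:
  fixes f g :: "'a \<Rightarrow> real"
  assumes [measurable]: "f \<in> borel_measurable M" "g \<in> borel_measurable M"
    and i: "integrable M (\<lambda>x. (f x)\<^sup>2)" "integrable M (\<lambda>x. (g x)\<^sup>2)"
  shows "integrable M (\<lambda>x. (f x + a * g x)\<^sup>2)"
    "(\<integral>x. (f x + a * g x)\<^sup>2 \<partial>M) = (\<integral>x. (f x)\<^sup>2 \<partial>M) + 2 * a * (\<integral>x. f x * g x \<partial>M) + a\<^sup>2 * (\<integral>x. (g x)\<^sup>2 \<partial>M)"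
proof -
  have e: "(\<lambda>x. (f x + a * g x)\<^sup>2) = (\<lambda>x. (f x)\<^sup>2 + 2 * a * (f x * g x) + a\<^sup>2 * (g x)\<^sup>2)"
    by (simp add: fun_eq_iff power2_eq_square algebra_simps)
  note p = L2_integrable_product[OF assms]
  show "integrable M (\<lambda>x. (f x + a * g x)\<^sup>2)" unfolding e using i p by auto
  show "(\<integral>x. (f x + a * g x)\<^sup>2 \<partial>M) = (\<integral>x. (f x)\<^sup>2 \<partial>M) + 2 * a * (\<integral>x. f x * g x \<partial>M) + a\<^sup>2 * (\<integral>x. (g x)\<^sup>2 \<partial>M)"
    unfolding e using i p by simp
qed

text \<open>The weights force the increments below a geometric sequence of ratio
  \<open>1 / sqrt 2\<close>, so the telescoping series converges absolutely.\<close>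

lemma convergent_if_geometric_differences:
  fixes a :: "nat \<Rightarrow> real"
  assumes "\<And>k. 2 ^ k * (a (Suc k) - a k)\<^sup>2 \<le> B"
  shows "convergent a"
proof -
  define q where "q = 1 / sqrt 2"
  have q: "0 \<le> q" "q < 1" by (auto simp: q_def)
  have "\<bar>a (Suc k) - a k\<bar> \<le> sqrt B * q ^ k" for k
  proof -
    have "(a (Suc k) - a k)\<^sup>2 \<le> B * (1 / 2 ^ k)" using assms[of k] by (simp add: field_simps)
    also have "1 / 2 ^ k = (q ^ k)\<^sup>2"
      by (simp add: q_def power_divide power2_eq_square real_sqrt_mult_self flip: power_mult_distrib)
    finally have "sqrt ((a (Suc k) - a k)\<^sup>2) \<le> sqrt (B * (q ^ k)\<^sup>2)" by (rule real_sqrt_le_mono)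
    then show ?thesis using q by (simp add: real_sqrt_mult)
  qed
  then have "summable (\<lambda>k. a (Suc k) - a k)"
    by (intro summable_comparison_test'[OF summable_mult[OF summable_geometric]]) (use q in auto)
  then have "(\<lambda>n. a 0 + (\<Sum>k<n. a (Suc k) - a k)) \<longlonglongrightarrow> a 0 + (\<Sum>k. a (Suc k) - a k)"
    by (intro tendsto_add tendsto_const summable_LIMSEQ)
  then show ?thesis unfolding sum_lessThan_telescope by (auto simp: convergent_def)
qed

text \<open>Riesz-Fischer. Along a subsequence whose squared distances are at most
  \<open>(1/4) ^ k\<close>, the sum of squared increments with weights \<open>2 ^ k\<close> has
  finite integral, hence is finite almost everywhere and yields a pointwise limit. Fatou's lemma
  returns to the norm.\<close>

lemma L2_complete:
  fixes \<phi> :: "nat \<Rightarrow> 'a \<Rightarrow> real"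
  assumes m[measurable]: "\<And>n. \<phi> n \<in> borel_measurable M" and i: "\<And>n. integrable M (\<lambda>x. (\<phi> n x)\<^sup>2)"
    and Cauchy: "\<And>e. e > 0 \<Longrightarrow> \<exists>N. \<forall>i\<ge>N. \<forall>j\<ge>N. (\<integral>x. (\<phi> i x - \<phi> j x)\<^sup>2 \<partial>M) \<le> e"
  obtains G where "G \<in> borel_measurable M" "integrable M (\<lambda>x. (G x)\<^sup>2)"
    "\<And>n. integrable M (\<lambda>x. (\<phi> n x - G x)\<^sup>2)" "(\<lambda>n. \<integral>x. (\<phi> n x - G x)\<^sup>2 \<partial>M) \<longlonglongrightarrow> 0"
proof -
  have id: "integrable M (\<lambda>x. (\<phi> i x - \<phi> j x)\<^sup>2)" for i j
    using L2_integrable_combination(1)[OF m[of i] m[of j] assms(2)[of i] assms(2)[of j], of "-1"] by simp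
  have nnd: "(\<integral>\<^sup>+x. ennreal ((\<phi> i x - \<phi> j x)\<^sup>2) \<partial>M) = ennreal (\<integral>x. (\<phi> i x - \<phi> j x)\<^sup>2 \<partial>M)" for i j
    by (rule nn_integral_eq_integral[OF id]) simp
  have "\<forall>k. \<exists>N. \<forall>i\<ge>N. \<forall>j\<ge>N. (\<integral>x. (\<phi> i x - \<phi> j x)\<^sup>2 \<partial>M) \<le> (1/4) ^ k"
    by (intro allI Cauchy) simp
  from choice[OF this] obtain N where N: "\<And>k i j. i \<ge> N k \<Longrightarrow> j \<ge> N k \<Longrightarrow> (\<integral>x. (\<phi> i x - \<phi> j x)\<^sup>2 \<partial>M) \<le> (1/4) ^ k"
    by blast
  \<comment> \<open>Cumulative sums make both \<open>s k\<close> and \<open>s (Suc k)\<close> at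
    least \<open>N k\<close>; the summand \<open>k\<close> makes the sequence exceed every
    index.\<close>
  define s where "s k = (\<Sum>i\<le>k. N i) + k" for k
  have sN: "s k \<ge> N k" "s (Suc k) \<ge> N k" "s k \<ge> k" for k
    using member_le_sum[of k "{..k}" N] by (auto simp: s_def)
  have "(\<integral>\<^sup>+x. (\<Sum>k. ennreal (2 ^ k * (\<phi> (s (Suc k)) x - \<phi> (s k) x)\<^sup>2)) \<partial>M) =
    (\<Sum>k. \<integral>\<^sup>+x. ennreal (2 ^ k * (\<phi> (s (Suc k)) x - \<phi> (s k) x)\<^sup>2) \<partial>M)"
    by (rule nn_integral_suminf) measurable
  also have "\<dots> = (\<Sum>k. ennreal (2 ^ k * (\<integral>x. (\<phi> (s (Suc k)) x - \<phi> (s k) x)\<^sup>2 \<partial>M)))"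
    by (intro suminf_cong) (simp add: ennreal_mult nn_integral_cmult nnd)
  also have "\<dots> \<le> (\<Sum>k. ennreal ((1/2) ^ k))"
  proof (intro suminf_le ennreal_leI)
    fix k
    have "2 ^ k * (\<integral>x. (\<phi> (s (Suc k)) x - \<phi> (s k) x)\<^sup>2 \<partial>M) \<le> 2 ^ k * (1/4) ^ k"
      by (intro mult_left_mono N sN) simp
    also have "\<dots> = (2 * (1/4)) ^ k" by (rule power_mult_distrib[symmetric])
    also have "\<dots> = (1/2) ^ k" by simp
    finally show "2 ^ k * (\<integral>x. (\<phi> (s (Suc k)) x - \<phi> (s k) x)\<^sup>2 \<partial>M) \<le> (1/2) ^ k" .
  qed auto
  also have "\<dots> = ennreal 2" by (rule suminf_ennreal_eq) (use geometric_sums[of "1/2::real"] in auto)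
  finally have "(\<integral>\<^sup>+x. (\<Sum>k. ennreal (2 ^ k * (\<phi> (s (Suc k)) x - \<phi> (s k) x)\<^sup>2)) \<partial>M) \<noteq> \<infinity>"
    by (auto simp: top_unique)
  then have "AE x in M. (\<Sum>k. ennreal (2 ^ k * (\<phi> (s (Suc k)) x - \<phi> (s k) x)\<^sup>2)) \<noteq> \<infinity>"
    by (intro nn_integral_PInf_AE) auto
  then have conv: "AE x in M. (\<lambda>k. \<phi> (s k) x) \<longlonglongrightarrow> lim (\<lambda>k. \<phi> (s k) x)"
  proof eventually_elim
    fix x assume fin: "(\<Sum>k. ennreal (2 ^ k * (\<phi> (s (Suc k)) x - \<phi> (s k) x)\<^sup>2)) \<noteq> \<infinity>"
    define X where "X k = 2 ^ k * (\<phi> (s (Suc k)) x - \<phi> (s k) x)\<^sup>2" for k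
    define B where "B = enn2real (\<Sum>k. ennreal (X k))"
    have B: "(\<Sum>k. ennreal (X k)) = ennreal B" "0 \<le> B"
      using fin unfolding X_def[symmetric] B_def infinity_ennreal_def
      by (simp_all only: ennreal_enn2real less_top enn2real_nonneg)
    have X: "X k \<le> B" for k
    proof -
      have "sum (\<lambda>k. ennreal (X k)) {k} \<le> (\<Sum>k. ennreal (X k))"
        by (rule sum_le_suminf) simp_all
      then have "ennreal (X k) \<le> ennreal B" unfolding B by simp
      then show ?thesis using B(2) by (rule ennreal_le_iff[THEN iffD1, rotated])
    qed
    then have "2 ^ k * (\<phi> (s (Suc k)) x - \<phi> (s k) x)\<^sup>2 \<le> B" for k
      unfolding X_def .
    from convergent_if_geometric_differences[OF this] show "(\<lambda>k. \<phi> (s k) x) \<longlonglongrightarrow> lim (\<lambda>k. \<phi> (s k) x)"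
      by (simp add: convergent_LIMSEQ_iff)
  qed
  define G where "G x = lim (\<lambda>k. \<phi> (s k) x)" for x
  have G[measurable]: "G \<in> borel_measurable M" unfolding G_def[abs_def]
    by (rule borel_measurable_lim_metric) simp
  \<comment> \<open>Fatou's lemma along the subsequence; it serves both for integrability, with a
    large \<open>e\<close>, and for convergence, with a small one.\<close>
  have bound: "(\<integral>\<^sup>+x. ennreal ((\<phi> i x - G x)\<^sup>2) \<partial>M) \<le> ennreal e"
    if "\<And>j. j \<ge> n \<Longrightarrow> (\<integral>x. (\<phi> i x - \<phi> j x)\<^sup>2 \<partial>M) \<le> e" for i n e
  proof -
    have "(\<integral>\<^sup>+x. ennreal ((\<phi> i x - G x)\<^sup>2) \<partial>M) = (\<integral>\<^sup>+x. liminf (\<lambda>k. ennreal ((\<phi> i x - \<phi> (s k) x)\<^sup>2)) \<partial>M)"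
    proof (rule nn_integral_cong_AE)
      show "AE x in M. ennreal ((\<phi> i x - G x)\<^sup>2) = liminf (\<lambda>k. ennreal ((\<phi> i x - \<phi> (s k) x)\<^sup>2))"
        using conv
      proof eventually_elim
        fix x assume "(\<lambda>k. \<phi> (s k) x) \<longlonglongrightarrow> lim (\<lambda>k. \<phi> (s k) x)"
        then have "(\<lambda>k. ennreal ((\<phi> i x - \<phi> (s k) x)\<^sup>2)) \<longlonglongrightarrow> ennreal ((\<phi> i x - G x)\<^sup>2)"
          unfolding G_def by (intro tendsto_intros)
        from lim_imp_Liminf[OF sequentially_bot this]
        show "ennreal ((\<phi> i x - G x)\<^sup>2) = liminf (\<lambda>k. ennreal ((\<phi> i x - \<phi> (s k) x)\<^sup>2))" by (rule sym)
      qed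
    qed
    also have "\<dots> \<le> liminf (\<lambda>k. \<integral>\<^sup>+x. ennreal ((\<phi> i x - \<phi> (s k) x)\<^sup>2) \<partial>M)"
      by (rule nn_integral_liminf) measurable
    also have "\<dots> \<le> liminf (\<lambda>k. ennreal e)"
    proof (rule Liminf_mono)
      show "\<forall>\<^sub>F k in sequentially. (\<integral>\<^sup>+x. ennreal ((\<phi> i x - \<phi> (s k) x)\<^sup>2) \<partial>M) \<le> ennreal e"
        unfolding eventually_sequentially nnd
        by (intro exI[of _ n] allI impI ennreal_leI that order_trans[OF _ sN(3)])
    qed
    also have "\<dots> = ennreal e" by (rule Liminf_const) simp
    finally show ?thesis .
  qed
  have iG: "integrable M (\<lambda>x. (\<phi> n x - G x)\<^sup>2)" for n
  proof (rule integrableI_nonneg)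
    obtain K where K: "\<And>i j. i \<ge> K \<Longrightarrow> j \<ge> K \<Longrightarrow> (\<integral>x. (\<phi> i x - \<phi> j x)\<^sup>2 \<partial>M) \<le> 1" using Cauchy[of 1] by auto
    have "(\<integral>x. (\<phi> n x - \<phi> j x)\<^sup>2 \<partial>M) \<le> 2 * (\<integral>x. (\<phi> n x - \<phi> K x)\<^sup>2 \<partial>M) + 2" if "j \<ge> K" for j
    proof -
      have "(\<phi> n x - \<phi> j x)\<^sup>2 \<le> 2 * (\<phi> n x - \<phi> K x)\<^sup>2 + 2 * (\<phi> K x - \<phi> j x)\<^sup>2" for x
        using sum_squares_bound[of "\<phi> n x - \<phi> K x" "\<phi> K x - \<phi> j x"] by (simp add: power2_eq_square algebra_simps)
      then have "(\<integral>x. (\<phi> n x - \<phi> j x)\<^sup>2 \<partial>M) \<le> (\<integral>x. 2 * (\<phi> n x - \<phi> K x)\<^sup>2 + 2 * (\<phi> K x - \<phi> j x)\<^sup>2 \<partial>M)"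
        by (intro integral_mono id Bochner_Integration.integrable_add integrable_mult_right)
      also have "\<dots> = 2 * (\<integral>x. (\<phi> n x - \<phi> K x)\<^sup>2 \<partial>M) + 2 * (\<integral>x. (\<phi> K x - \<phi> j x)\<^sup>2 \<partial>M)"
        using id by simp
      finally show ?thesis using K[of K j] that by simp
    qed
    from le_less_trans[OF bound[of K, OF this]] show "(\<integral>\<^sup>+x. ennreal ((\<phi> n x - G x)\<^sup>2) \<partial>M) < \<infinity>"
      by simp
  qed auto
  have "integrable M (\<lambda>x. (\<phi> 0 x + (-1) * (\<phi> 0 x - G x))\<^sup>2)"
    by (rule L2_integrable_combination(1)) (use i iG in auto)
  then have iG2: "integrable M (\<lambda>x. (G x)\<^sup>2)" by simp
  have "(\<lambda>n. \<integral>x. (\<phi> n x - G x)\<^sup>2 \<partial>M) \<longlonglongrightarrow> 0"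
  proof (rule LIMSEQ_I)
    fix e :: real assume e: "e > 0"
    obtain K where K: "\<And>i j. i \<ge> K \<Longrightarrow> j \<ge> K \<Longrightarrow> (\<integral>x. (\<phi> i x - \<phi> j x)\<^sup>2 \<partial>M) \<le> e/2" using Cauchy[of "e/2"] e by auto
    have "(\<integral>x. (\<phi> n x - G x)\<^sup>2 \<partial>M) \<le> e/2" if "n \<ge> K" for n
    proof -
      have "ennreal (\<integral>x. (\<phi> n x - G x)\<^sup>2 \<partial>M) = (\<integral>\<^sup>+x. ennreal ((\<phi> n x - G x)\<^sup>2) \<partial>M)"
        by (rule nn_integral_eq_integral[OF iG, symmetric]) simp
      also have "\<dots> \<le> ennreal (e/2)" by (rule bound) (rule K[OF that])
      finally show ?thesis using e by (simp add: ennreal_le_iff)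
    qed
    then show "\<exists>K. \<forall>n\<ge>K. norm ((\<integral>x. (\<phi> n x - G x)\<^sup>2 \<partial>M) - 0) < e"
      using e by (intro exI[of _ K]) force
  qed
  then show ?thesis using that[OF G iG2 iG] by blast
qed

text \<open>Riesz representation without Hilbert spaces: a minimizing sequence of
  \<open>\<phi> \<mapsto> \<parallel>\<phi>\<parallel>\<^sup>2 / 2 - T \<phi>\<close> is Cauchy by the parallelogram identity, and its limit represents \<open>T\<close>.
  The bound on \<open>T\<close> is stated in the additive form that makes this functional bounded below.\<close>

lemma L2_representation:
  fixes T :: "('a::euclidean_space \<Rightarrow> real) \<Rightarrow> real"
  assumes ne: "(\<lambda>x. 0) \<in> V"
    and comb: "\<And>\<phi> \<psi> a. \<phi> \<in> V \<Longrightarrow> \<psi> \<in> V \<Longrightarrow> (\<lambda>x. \<phi> x + a * \<psi> x) \<in> V"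
    and lin: "\<And>\<phi> \<psi> a. \<phi> \<in> V \<Longrightarrow> \<psi> \<in> V \<Longrightarrow> T (\<lambda>x. \<phi> x + a * \<psi> x) = T \<phi> + a * T \<psi>"
    and m: "\<And>\<phi>. \<phi> \<in> V \<Longrightarrow> \<phi> \<in> borel_measurable borel"
    and i: "\<And>\<phi>. \<phi> \<in> V \<Longrightarrow> integrable lborel (\<lambda>x. (\<phi> x)\<^sup>2)"
    and bd: "\<And>\<phi>. \<phi> \<in> V \<Longrightarrow> T \<phi> \<le> C + (\<integral>x. (\<phi> x)\<^sup>2 \<partial>lborel) / 2"
  obtains G where "G \<in> borel_measurable borel" "integrable lborel (\<lambda>x. (G x)\<^sup>2)"
    "\<And>\<phi>. \<phi> \<in> V \<Longrightarrow> T \<phi> = (\<integral>x. G x * \<phi> x \<partial>lborel)"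
proof -
  define J where "J \<phi> = (\<integral>x. (\<phi> x)\<^sup>2 \<partial>lborel) / 2 - T \<phi>" for \<phi>
  define \<mu> where "\<mu> = Inf (J ` V)"
  have bb: "bdd_below (J ` V)" by (rule bdd_belowI[of _ "-C"]) (use bd in \<open>force simp: J_def\<close>)
  have \<mu>: "\<mu> \<le> J \<phi>" if "\<phi> \<in> V" for \<phi> unfolding \<mu>_def using bb that by (auto intro: cInf_lower)
  have "\<exists>\<phi>\<in>V. J \<phi> < \<mu> + 1 / Suc n" for n
    using cInf_lessD[of "J ` V" "\<mu> + 1 / Suc n"] ne by (auto simp: \<mu>_def)
  then obtain \<phi> where \<phi>: "\<And>n. \<phi> n \<in> V" "\<And>n. J (\<phi> n) < \<mu> + 1 / Suc n" by metis
  \<comment> \<open>Exact quadratic expansion of \<open>J\<close> along a line. It gives the Cauchy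
    property of a minimizing sequence and, below, the Euler-Lagrange equation of the
    minimizer.\<close>
  have exp: "J (\<lambda>x. f x + a * g x) = J f + a * ((\<integral>x. f x * g x \<partial>lborel) - T g) + a\<^sup>2 / 2 * (\<integral>x. (g x)\<^sup>2 \<partial>lborel)"
    if "f \<in> V" "g \<in> V" for f g a
    using L2_integrable_combination(2)[of f lborel g a] m[OF that(1)] m[OF that(2)] i[OF that(1)] i[OF that(2)] lin[OF that, of a]
    by (simp add: J_def field_simps)
  have par: "(\<integral>x. (\<phi> i x - \<phi> j x)\<^sup>2 \<partial>lborel) \<le> 4 * (1 / Suc i + 1 / Suc j)" for i j
  proof -
    define d where "d x = \<phi> i x + (-1) * \<phi> j x" for x
    have d: "d \<in> V" unfolding d_def[abs_def] by (rule comb[OF \<phi>(1) \<phi>(1)])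
    have mid: "(\<lambda>x. \<phi> j x + (1/2) * d x) \<in> V" by (rule comb[OF \<phi>(1) d])
    have "(\<lambda>x. \<phi> j x + 1 * d x) = \<phi> i" by (simp add: d_def fun_eq_iff)
    then have "J (\<phi> i) = J (\<phi> j) + ((\<integral>x. \<phi> j x * d x \<partial>lborel) - T d) + 1 / 2 * (\<integral>x. (d x)\<^sup>2 \<partial>lborel)"
      using exp[OF \<phi>(1)[of j] d, of 1] by simp
    moreover have "J (\<lambda>x. \<phi> j x + (1/2) * d x) = J (\<phi> j) + (1/2) * ((\<integral>x. \<phi> j x * d x \<partial>lborel) - T d) + 1 / 8 * (\<integral>x. (d x)\<^sup>2 \<partial>lborel)"
      using exp[OF \<phi>(1)[of j] d, of "1/2"] by (simp add: power2_eq_square)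
    ultimately have "(\<integral>x. (d x)\<^sup>2 \<partial>lborel) = 4 * (J (\<phi> i) + J (\<phi> j) - 2 * J (\<lambda>x. \<phi> j x + (1/2) * d x))"
      by (simp add: algebra_simps)
    also have "\<dots> \<le> 4 * (1 / Suc i + 1 / Suc j)" using \<phi>(2)[of i] \<phi>(2)[of j] \<mu>[OF mid] by simp
    finally show ?thesis by (simp add: d_def)
  qed
  obtain G where G: "G \<in> borel_measurable lborel" "integrable lborel (\<lambda>x. (G x)\<^sup>2)"
    "\<And>n. integrable lborel (\<lambda>x. (\<phi> n x - G x)\<^sup>2)" "(\<lambda>n. \<integral>x. (\<phi> n x - G x)\<^sup>2 \<partial>lborel) \<longlonglongrightarrow> 0"
  proof (rule L2_complete[of \<phi> lborel])
    fix e :: real assume e: "e > 0"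
    obtain N where N: "N > 0" "inverse (real N) < e / 8" using ex_inverse_of_nat_less[of "e/8"] e by auto
    have "(\<integral>x. (\<phi> i x - \<phi> j x)\<^sup>2 \<partial>lborel) \<le> e" if "i \<ge> N" "j \<ge> N" for i j
    proof -
      have "1 / real (Suc k) \<le> e / 8" if "k \<ge> N" for k
      proof -
        have "1 / real (Suc k) \<le> inverse (real N)" using N(1) that by (simp add: field_simps)
        then show ?thesis using N(2) by simp
      qed
      from this[OF that(1)] this[OF that(2)] par[of i j] show ?thesis by simp
    qed
    then show "\<exists>N. \<forall>i\<ge>N. \<forall>j\<ge>N. (\<integral>x. (\<phi> i x - \<phi> j x)\<^sup>2 \<partial>lborel) \<le> e" by blast
  qed (use \<phi>(1) m i in auto)
  have Gm: "G \<in> borel_measurable borel" using G(1) by simp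
  show ?thesis
  proof (rule that[OF Gm G(2)])
    fix \<psi> assume \<psi>: "\<psi> \<in> V"
    have lim: "(\<lambda>n. \<integral>x. \<psi> x \<bullet> \<phi> n x \<partial>lborel) \<longlonglongrightarrow> (\<integral>x. \<psi> x \<bullet> G x \<partial>lborel)"
      by (rule Lp_duality_tendsto[where p=2 and B="\<lambda>x. \<bar>\<psi> x\<bar>"])
        (use m[OF \<psi>] m[OF \<phi>(1)] Gm i[OF \<psi>] G in \<open>auto simp: norm_powr_2[where 'a=real, simplified]\<close>)
    define k where "k = (\<integral>x. \<psi> x * G x \<partial>lborel) - T \<psi>"
    define q where "q = (\<integral>x. (\<psi> x)\<^sup>2 \<partial>lborel)"
    have q: "q \<ge> 0" by (simp add: q_def)
    \<comment> \<open>Perturbing \<open>\<phi> n\<close> by \<open>t * \<psi>\<close> cannot lower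
      \<open>J\<close> below the infimum, so the change is at least \<open>- 1 / Suc n\<close>; let
      \<open>n\<close> tend to infinity.\<close>
    have pos: "0 \<le> t * k + t\<^sup>2 / 2 * q" for t
    proof -
      have "(\<lambda>n. 1 / real (Suc n) + (t * ((\<integral>x. \<psi> x * \<phi> n x \<partial>lborel) - T \<psi>) + t\<^sup>2 / 2 * q)) \<longlonglongrightarrow> 0 + (t * k + t\<^sup>2 / 2 * q)"
        unfolding k_def using lim LIMSEQ_Suc[OF lim_1_over_n] by (intro tendsto_intros) auto
      moreover have "0 \<le> 1 / real (Suc n) + (t * ((\<integral>x. \<psi> x * \<phi> n x \<partial>lborel) - T \<psi>) + t\<^sup>2 / 2 * q)" for n
        using exp[OF \<phi>(1)[of n] \<psi>, of t] \<mu>[OF comb[OF \<phi>(1)[of n] \<psi>, of t]] \<phi>(2)[of n]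
        by (simp add: q_def mult.commute)
      ultimately show ?thesis using LIMSEQ_le_const by fastforce
    qed
    have "k = 0"
    proof (rule ccontr)
      assume k: "k \<noteq> 0"
      \<comment> \<open>The minimizer of the quadratic up to the summand 1, which avoids division by
        zero when \<open>\<psi>\<close> vanishes almost everywhere.\<close>
      define t where "t = - k / (q + 1)"
      have tq: "t * (q + 1) = - k" using q by (simp add: t_def)
      have "t * k + t\<^sup>2 / 2 * q \<le> t * k + t\<^sup>2 / 2 * (q + 1)" by (simp add: mult_left_mono)
      also have "t\<^sup>2 / 2 * (q + 1) = t / 2 * (t * (q + 1))" by (simp add: power2_eq_square)
      also have "t * k + \<dots> = t * k / 2" unfolding tq by simp
      also have "\<dots> = - (k\<^sup>2) / (2 * (q + 1))" by (simp add: t_def power2_eq_square)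
      also have "\<dots> < 0" using k q by (intro divide_neg_pos) auto
      finally show False using pos[of t] by simp
    qed
    then show "T \<psi> = (\<integral>x. G x * \<psi> x \<partial>lborel)" by (simp add: k_def mult.commute)
  qed
qed

section \<open>The weak gradient of the nonlinear expression\<close>

text \<open>All smoothness is on the side of \<open>\<phi>\<close>, so \<open>v\<close> is merely
  integrable. The step sizes may be negative, which is used for backward differences.\<close>

lemma directional_limit:
  fixes v :: "'a::euclidean_space \<Rightarrow> real"
  assumes v: "integrable lborel v" and \<phi>: "test_fun UNIV \<phi>" and h: "\<And>n. h n \<noteq> 0" "h \<longlonglongrightarrow> 0"
  shows "(\<lambda>n. ((\<integral>x. v x * \<phi> (h n *\<^sub>R d + x) \<partial>lborel) - (\<integral>x. v x * \<phi> x \<partial>lborel)) / h n)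
    \<longlonglongrightarrow> (\<integral>x. v x * frechet_derivative \<phi> (at x) d \<partial>lborel)"
proof -
  let ?D = "\<lambda>d. \<integral>x. v x * frechet_derivative \<phi> (at (0 + x)) d \<partial>lborel"
  let ?\<Phi> = "\<lambda>y. \<integral>x. v x * \<phi> (y + x) \<partial>lborel"
  have D: "(?\<Phi> has_derivative ?D) (at 0)"
    by (rule has_derivative_integral_translate[OF v \<phi>, of "\<lambda>x. x" 0]) simp
  have "((\<lambda>t. t *\<^sub>R d) has_derivative (\<lambda>t. t *\<^sub>R d)) (at (0::real))"
    by (auto intro!: derivative_eq_intros)
  from has_derivative_compose[OF this, of ?\<Phi> ?D] D
  have "((\<lambda>t. ?\<Phi> (t *\<^sub>R d)) has_derivative (\<lambda>t. ?D (t *\<^sub>R d))) (at 0)" by simp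
  moreover have "(\<lambda>t. ?D (t *\<^sub>R d)) = (\<lambda>t. t * ?D d)"
    using linear_scale[OF has_derivative_linear[OF D]] by (auto simp: fun_eq_iff)
  ultimately have "((\<lambda>t. ?\<Phi> (t *\<^sub>R d)) has_real_derivative ?D d) (at 0)"
    by (simp add: has_field_derivative_def mult_commute_abs)
  then have "((\<lambda>t. (?\<Phi> (t *\<^sub>R d) - ?\<Phi> (0 *\<^sub>R d)) / (t - 0)) \<longlongrightarrow> ?D d) (at 0)"
    by (simp only: has_field_derivative_iff)
  moreover have "filterlim h (at 0) sequentially"
    using h by (intro filterlim_atI) auto
  ultimately have "((\<lambda>n. (?\<Phi> (h n *\<^sub>R d) - ?\<Phi> (0 *\<^sub>R d)) / (h n - 0)) \<longlonglongrightarrow> ?D d)"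
    by (rule filterlim_compose)
  then show ?thesis by simp
qed

text \<open>The integral of a translate does not depend on the shift, so its derivative is zero. The
  constant 1 is not integrable over the space; the indicator of a neighbourhood that contains the
  supports of all shifts by at most \<open>norm b\<close> takes its place.\<close>

lemma integral_frechet_derivative_eq_0:
  assumes "test_fun UNIV \<theta>" shows "(\<integral>x. frechet_derivative \<theta> (at x) b \<partial>lborel) = 0"
proof -
  obtain T where T: "compact T" "\<And>x. x \<notin> T \<Longrightarrow> \<theta> x = 0"
    using test_funE[OF assms] by metis
  let ?v = "indicat_real (nbhd T (norm b))"
  note [measurable] = test_fun_measurable[OF assms]
  have eq: "(\<integral>x. ?v x * \<theta> (h *\<^sub>R b + x) \<partial>lborel) = (\<integral>x. \<theta> x \<partial>lborel)" if "\<bar>h\<bar> \<le> 1" for h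
  proof -
    have "?v x * \<theta> (h *\<^sub>R b + x) = \<theta> (h *\<^sub>R b + x)" for x
    proof (cases "\<theta> (h *\<^sub>R b + x) = 0")
      case False
      then have "h *\<^sub>R b + x \<in> T" using T by blast
      moreover have "norm (x - (h *\<^sub>R b + x)) \<le> norm b" using mult_right_mono[OF that norm_ge_zero[of b]] by simp
      ultimately have "x \<in> nbhd T (norm b)" unfolding nbhd_iff by blast
      then show ?thesis by simp
    qed simp
    then have "(\<integral>x. ?v x * \<theta> (h *\<^sub>R b + x) \<partial>lborel) = (\<integral>x. \<theta> (h *\<^sub>R b + x) \<partial>lborel)" by (simp only:)
    also have "\<dots> = (\<integral>x. \<theta> x \<partial>lborel)" by (rule integral_lborel_shift) simp
    finally show ?thesis .
  qed
  have "(\<lambda>n. ((\<integral>x. ?v x * \<theta> ((1 / real (Suc n)) *\<^sub>R b + x) \<partial>lborel) - (\<integral>x. ?v x * \<theta> x \<partial>lborel)) / (1 / real (Suc n)))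
    \<longlonglongrightarrow> (\<integral>x. ?v x * frechet_derivative \<theta> (at x) b \<partial>lborel)"
    by (rule directional_limit[OF compact_indicator_integrable[OF compact_nbhd[OF T(1)]] assms])
      (use LIMSEQ_Suc[OF lim_1_over_n] in auto)
  moreover have "(\<integral>x. ?v x * \<theta> ((1 / real (Suc n)) *\<^sub>R b + x) \<partial>lborel) - (\<integral>x. ?v x * \<theta> x \<partial>lborel) = 0" for n
    using eq[of "1 / real (Suc n)"] eq[of 0] by simp
  ultimately have "(\<lambda>n. 0) \<longlonglongrightarrow> (\<integral>x. ?v x * frechet_derivative \<theta> (at x) b \<partial>lborel)" by simp
  then have "(\<integral>x. ?v x * frechet_derivative \<theta> (at x) b \<partial>lborel) = 0" using LIMSEQ_unique tendsto_const by blast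
  moreover have "?v x * frechet_derivative \<theta> (at x) b = frechet_derivative \<theta> (at x) b" for x
  proof (cases "x \<in> T")
    case True
    then show ?thesis using subset_nbhd[of "norm b" T] by auto
  next
    case False
    with frechet_derivative_outside_support[OF compact_imp_closed[OF T(1)] T(2)] show ?thesis by simp
  qed
  ultimately show ?thesis by simp
qed

lemma frechet_measurable:
  "smooth \<phi> \<Longrightarrow> b \<in> Basis \<Longrightarrow> (\<lambda>x. frechet_derivative \<phi> (at x) b) \<in> borel_measurable borel"
  by (intro borel_measurable_continuous_onI smooth_continuous_frechet)

lemma integral_by_parts_test_fun:
  assumes \<phi>: "test_fun UNIV \<phi>" and \<psi>: "test_fun UNIV \<psi>" and b: "b \<in> Basis"
  shows "(\<integral>x. \<phi> x * frechet_derivative \<psi> (at x) b \<partial>lborel) = - (\<integral>x. frechet_derivative \<phi> (at x) b * \<psi> x \<partial>lborel)"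
proof -
  note s = test_fun_smooth[OF \<phi>] test_fun_smooth[OF \<psi>]
  have "frechet_derivative (\<lambda>x. \<phi> x * \<psi> x) (at x) b = \<phi> x * frechet_derivative \<psi> (at x) b + frechet_derivative \<phi> (at x) b * \<psi> x" for x
    using cgrad_mult[OF s, of x] by (simp add: b inner_add_left flip: cgrad_inner[OF b])
  moreover have "integrable lborel (\<lambda>x. \<phi> x * frechet_derivative \<psi> (at x) b)"
    "integrable lborel (\<lambda>x. frechet_derivative \<phi> (at x) b * \<psi> x)"
    using test_fun_integrable[OF test_fun_mult[OF s(1) test_fun_frechet[OF \<psi> b]]]
      test_fun_integrable[OF test_fun_mult[OF smooth_frechet[OF s(1) b] \<psi>]] by auto
  ultimately show ?thesis
    using integral_frechet_derivative_eq_0[OF test_fun_mult[OF s(1) \<psi>], of b] by simp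
qed

text \<open>At a point of \<open>K'\<close> the mollification of \<open>D\<close> is an integral
  against a reflected kernel supported in \<open>K\<close>, hence zero. Mollifications converge in
  \<open>L1\<close>, so the limit vanishes almost everywhere on \<open>K'\<close>.\<close>

lemma fundamental_lemma:
  fixes D :: "'a::euclidean_space \<Rightarrow> real"
  assumes D: "integrable lborel D" and K: "compact K" "compact K'" and \<delta>: "\<delta> > 0" "nbhd K' \<delta> \<subseteq> K"
    and z: "\<And>\<phi>. test_fun K \<phi> \<Longrightarrow> (\<integral>x. D x * \<phi> x \<partial>lborel) = 0"
  shows "AE x in lborel. x \<in> K' \<longrightarrow> D x = 0"
proof -
  have [measurable]: "D \<in> borel_measurable borel" "K \<in> sets borel" "K' \<in> sets borel"
    using borel_measurable_integrable[OF D] K borel_compact by auto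
  \<comment> \<open>Restricting \<open>D\<close> to \<open>K\<close> supplies the compact support
    that the convergence of mollifications requires, and no test function on \<open>K\<close> sees
    the change.\<close>
  define E where "E x = indicator K x * D x" for x
  have Em[measurable]: "E \<in> borel_measurable borel" unfolding E_def[abs_def] by measurable
  have E: "integrable lborel E"
    by (rule Bochner_Integration.integrable_bound[OF D]) (auto simp: E_def indicator_def)
  have "\<exists>\<rho>. \<forall>n. mollifier (\<delta> / Suc n) (\<rho> n :: 'a \<Rightarrow> real)"
    by (intro choice allI mollifier_exists) (use \<delta> in simp)
  then obtain \<rho> :: "nat \<Rightarrow> 'a \<Rightarrow> real" where \<rho>: "\<And>n. mollifier (\<delta> / Suc n) (\<rho> n)" by blast
  have c0: "conv E (\<rho> n) x = 0" if x: "x \<in> K'" for n x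
  proof -
    define \<phi> where "\<phi> y = \<rho> n (x + (-1) *\<^sub>R y)" for y
    have sup: "\<phi> y = 0" if "y \<notin> cball x \<delta>" for y
    proof -
      have "\<delta> / Suc n \<le> \<delta>" using \<delta> by (simp add: divide_le_eq)
      then show ?thesis using that \<rho>[of n] by (auto simp: \<phi>_def mollifier_def dist_norm)
    qed
    have sub: "cball x \<delta> \<subseteq> K"
    proof
      fix y assume "y \<in> cball x \<delta>"
      then have "y \<in> nbhd K' \<delta>" using x unfolding nbhd_iff by (auto simp: dist_norm norm_minus_commute)
      then show "y \<in> K" using \<delta> by auto
    qed
    have "test_fun K \<phi>"
    proof (rule test_funI[OF _ _ sub sup])
      show "smooth \<phi>" unfolding \<phi>_def
        by (rule smooth_affine[OF test_fun_smooth[OF mollifier_test_fun[OF \<rho>]]])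
    qed auto
    from z[OF this] have "(\<integral>y. D y * \<phi> y \<partial>lborel) = 0" .
    moreover have "D y * \<phi> y = \<rho> n (x - y) *\<^sub>R E y" for y
      using sup[of y] subsetD[OF sub, of y] by (cases "y \<in> K") (auto simp: E_def \<phi>_def)
    ultimately show ?thesis by (simp add: conv_def)
  qed
  have E1: "integrable lborel (\<lambda>x. norm (E x) powr 1)" using E by simp
  have E0: "x \<notin> K \<Longrightarrow> E x = 0" for x by (simp add: E_def)
  have \<epsilon>: "(\<lambda>n. \<delta> / Suc n) \<longlonglongrightarrow> 0" using LIMSEQ_Suc[OF lim_const_over_n[of \<delta>]] .
  note L = conv_Lp_tendsto[OF order_refl Em E1 K(1) E0 \<rho> \<epsilon>]
  have L1: "integrable lborel (\<lambda>x. \<bar>conv E (\<rho> n) x - E x\<bar>)" for n using L(1)[of n] by simp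
  have L2: "(\<lambda>n. \<integral>x. \<bar>conv E (\<rho> n) x - E x\<bar> \<partial>lborel) \<longlonglongrightarrow> 0" using L(2) by simp
  have nn: "(\<integral>\<^sup>+x. indicator K' x * ennreal \<bar>E x\<bar> \<partial>lborel) \<le> ennreal (\<integral>x. \<bar>conv E (\<rho> n) x - E x\<bar> \<partial>lborel)" for n
  proof -
    have "(\<integral>\<^sup>+x. indicator K' x * ennreal \<bar>E x\<bar> \<partial>lborel) \<le> (\<integral>\<^sup>+x. ennreal \<bar>conv E (\<rho> n) x - E x\<bar> \<partial>lborel)"
      by (intro nn_integral_mono) (auto simp: indicator_def c0)
    also have "\<dots> = ennreal (\<integral>x. \<bar>conv E (\<rho> n) x - E x\<bar> \<partial>lborel)" by (rule nn_integral_eq_integral[OF L1]) simp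
    finally show ?thesis .
  qed
  have "K' \<subseteq> K" using subset_nbhd[of \<delta> K'] \<delta> by auto
  have "(\<lambda>n. ennreal (\<integral>x. \<bar>conv E (\<rho> n) x - E x\<bar> \<partial>lborel)) \<longlonglongrightarrow> ennreal 0"
    by (rule tendsto_ennrealI[OF L2])
  from LIMSEQ_le_const[OF this] nn
  have "(\<integral>\<^sup>+x. indicator K' x * ennreal \<bar>E x\<bar> \<partial>lborel) = 0" by auto
  then have "AE x in lborel. indicator K' x * ennreal \<bar>E x\<bar> = 0"
    by (subst (asm) nn_integral_0_iff_AE) auto
  then show ?thesis
    by eventually_elim (use \<open>K' \<subseteq> K\<close> in \<open>auto simp: E_def indicator_def split: if_splits\<close>)
qed

section \<open>Square-integrable weak derivatives of the nonlinear field on \<open>S\<close>\<close>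

context weak_solution_cut
begin

lemma V_zero: "x \<notin> nbhd S (4 * r) \<Longrightarrow> H (p / 2) (g x) = 0"
  by (simp add: g0 H_def)

lemma V_component_Lp2:
  assumes "b \<in> Basis" shows "integrable lborel (\<lambda>x. (H (p / 2) (g x) \<bullet> b)\<^sup>2)"
proof (rule Bochner_Integration.integrable_bound[OF V_Lp2])
  have "(H (p / 2) (g x) \<bullet> b)\<^sup>2 \<le> (norm (H (p / 2) (g x)))\<^sup>2" for x
    using Basis_le_norm[OF assms, of "H (p / 2) (g x)"] by (simp add: abs_le_square_iff[symmetric])
  then show "AE x in lborel. norm ((H (p / 2) (g x) \<bullet> b)\<^sup>2) \<le> norm ((norm (H (p / 2) (g x)))\<^sup>2)" by auto
qed simp

lemma V_component_int:
  assumes b: "b \<in> Basis" shows "integrable lborel (\<lambda>x. H (p / 2) (g x) \<bullet> b)"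
proof (rule Lp_compact_support_integrable[where p=2 and K="nbhd S (4 * r)"])
  show "integrable lborel (\<lambda>x. norm (H (p / 2) (g x) \<bullet> b) powr 2)"
    using V_component_Lp2[OF b] by (simp only: norm_powr_2) simp
qed (use V_zero compact_nbhd[OF S] in auto)

text \<open>The difference quotient is moved from the test function to the field, where the
  Caccioppoli estimate bounds it in \<open>L2\<close>. Young's inequality with equal weights
  produces exactly the additive bound under which a functional on test functions is represented by
  an \<open>L2\<close> function.\<close>

lemma weak_partial_derivative_H:
  assumes b: "b \<in> Basis" and c: "c \<in> Basis"
  shows "\<exists>G. G \<in> borel_measurable borel \<and> integrable lborel (\<lambda>x. (G x)\<^sup>2) \<and>
    (\<forall>\<phi>. test_fun S \<phi> \<longrightarrow> (\<integral>x. (H (p / 2) (g x) \<bullet> b) * frechet_derivative \<phi> (at x) c \<partial>lborel) = - (\<integral>x. G x * \<phi> x \<partial>lborel))"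
proof -
  define v where "v x = H (p / 2) (g x) \<bullet> b" for x
  have v: "integrable lborel v" unfolding v_def by (rule V_component_int[OF b])
  have vm[measurable]: "v \<in> borel_measurable borel" unfolding v_def[abs_def] by measurable
  have [measurable]: "S \<in> sets borel" using S by (rule borel_compact)
  \<comment> \<open>The sign makes \<open>T\<close> the functional that the weak derivative itself
    represents.\<close>
  define T where "T \<phi> = - (\<integral>x. v x * frechet_derivative \<phi> (at x) c \<partial>lborel)" for \<phi>
  obtain C' where C': "\<And>h. 0 < h \<Longrightarrow> h \<le> r \<Longrightarrow>
    (\<integral>x. indicator S x * (norm (H (p / 2) (g (h *\<^sub>R c + x)) - H (p / 2) (g x)))\<^sup>2 \<partial>lborel) \<le> C' * h\<^sup>2"
    using caccioppoli c by blast
  have UN: "test_fun UNIV \<phi>" if "test_fun S \<phi>" for \<phi> using test_fun_mono[OF that] by simp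
  have sq: "integrable lborel (\<lambda>x. (\<phi> x)\<^sup>2)" if "test_fun S \<phi>" for \<phi>
    using test_fun_integrable[OF test_fun_mult[OF test_fun_smooth[OF that] that]] by (simp add: power2_eq_square)
  have iv: "integrable lborel (\<lambda>x. v x * \<psi> x)" if "test_fun U \<psi>" for \<psi> U
    using integrable_mult_test_fun[OF v that, of "\<lambda>x. x"] by (simp add: mult.commute)
  have bound: "T \<phi> \<le> C' / 2 + (\<integral>x. (\<phi> x)\<^sup>2 \<partial>lborel) / 2" if \<phi>: "test_fun S \<phi>" for \<phi>
  proof -
    define h where "h n = r / Suc n" for n
    have h: "0 < h n" "h n \<le> r" for n using r by (auto simp: h_def divide_le_eq)
    have h0: "h \<longlonglongrightarrow> 0" unfolding h_def by (rule radius_tendsto)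
    note [measurable] = test_fun_measurable[OF \<phi>]
    \<comment> \<open>Backward steps on the test function become forward steps on \<open>v\<close>,
      the ones for which the Caccioppoli estimate is stated.\<close>
    have "(\<lambda>n. ((\<integral>x. v x * \<phi> ((- h n) *\<^sub>R c + x) \<partial>lborel) - (\<integral>x. v x * \<phi> x \<partial>lborel)) / (- h n))
      \<longlonglongrightarrow> (\<integral>x. v x * frechet_derivative \<phi> (at x) c \<partial>lborel)"
    proof (rule directional_limit[OF v UN[OF \<phi>]])
      show "- h n \<noteq> 0" for n using h(1)[of n] by simp
      show "(\<lambda>n. - h n) \<longlonglongrightarrow> 0" using tendsto_minus[OF h0] by simp
    qed
    from tendsto_minus[OF this]
    have lim: "(\<lambda>n. ((\<integral>x. v x * \<phi> ((- h n) *\<^sub>R c + x) \<partial>lborel) - (\<integral>x. v x * \<phi> x \<partial>lborel)) / h n) \<longlonglongrightarrow> T \<phi>"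
      by (simp add: T_def)
    have "((\<integral>x. v x * \<phi> ((- h n) *\<^sub>R c + x) \<partial>lborel) - (\<integral>x. v x * \<phi> x \<partial>lborel)) / h n \<le> C' / 2 + (\<integral>x. (\<phi> x)\<^sup>2 \<partial>lborel) / 2" for n
    proof -
      let ?h = "h n *\<^sub>R c"
      let ?W = "\<lambda>x. indicator S x * (norm (H (p / 2) (g (?h + x)) - H (p / 2) (g x)))\<^sup>2"
      have t': "test_fun UNIV (\<lambda>x. \<phi> (- ?h + x))"
      proof (rule test_funI[OF smooth_shift[OF test_fun_smooth[OF \<phi>]] compact_nbhd[OF S, of r]])
        fix x assume "x \<notin> nbhd S r"
        moreover have "x \<in> nbhd S r" if "- ?h + x \<in> S"
          unfolding nbhd_iff by (rule bexI[OF _ that]) (use h[of n] c in simp)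
        ultimately show "\<phi> (- ?h + x) = 0" using test_fun_outside[OF \<phi>] by blast
      qed simp
      have i1: "integrable lborel (\<lambda>x. v x * \<phi> (- ?h + x))" by (rule iv[OF t'])
      have i2: "integrable lborel (\<lambda>x. v (?h + x) * \<phi> x)"
        using integrable_lborel_shift[OF i1, of ?h] by simp
      have "(\<integral>x. v x * \<phi> ((- h n) *\<^sub>R c + x) \<partial>lborel) = (\<integral>x. v (?h + x) * \<phi> x \<partial>lborel)"
        using integral_lborel_shift[of "\<lambda>x. v x * \<phi> (- ?h + x)" ?h] by simp
      then have "((\<integral>x. v x * \<phi> ((- h n) *\<^sub>R c + x) \<partial>lborel) - (\<integral>x. v x * \<phi> x \<partial>lborel)) / h n =
        (\<integral>x. (v (?h + x) - v x) * \<phi> x / h n \<partial>lborel)"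
        using i2 iv[OF \<phi>] by (simp add: left_diff_distrib)
      also have "\<dots> \<le> (\<integral>x. ?W x / (2 * (h n)\<^sup>2) + (\<phi> x)\<^sup>2 / 2 \<partial>lborel)"
      proof (rule integral_mono_AE')
        have "integrable lborel ?W"
        proof (rule Bochner_Integration.integrable_bound[OF V_diff_int[of ?h]])
          show "AE x in lborel. norm (?W x) \<le> norm ((norm (H (p / 2) (g (?h + x)) - H (p / 2) (g x)))\<^sup>2)"
            by (auto simp: indicator_def)
        qed simp
        then show "integrable lborel (\<lambda>x. ?W x / (2 * (h n)\<^sup>2) + (\<phi> x)\<^sup>2 / 2)"
          using sq[OF \<phi>] by simp
        \<comment> \<open>Off \<open>S\<close> the test function vanishes, so the differences of the
          field are needed only on the set where they are controlled.\<close>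
        have "(v (?h + x) - v x) * \<phi> x / h n \<le> ?W x / (2 * (h n)\<^sup>2) + (\<phi> x)\<^sup>2 / 2" for x
        proof (cases "x \<in> S")
          case True
          let ?d = "v (?h + x) - v x"
          have "\<bar>?d\<bar> \<le> norm (H (p / 2) (g (?h + x)) - H (p / 2) (g x))"
            using Basis_le_norm[OF b, of "H (p / 2) (g (?h + x)) - H (p / 2) (g x)"] by (simp add: v_def inner_diff_left)
          then have W: "?d\<^sup>2 \<le> ?W x" using True by (simp add: abs_le_square_iff[symmetric])
          have "?d * \<phi> x / h n = (?d / h n) * \<phi> x" by simp
          also have "\<dots> \<le> 1 / 2 * (?d / h n)\<^sup>2 + (\<phi> x)\<^sup>2 / (2 * 1)" by (rule Young_product) simp
          also have "1 / 2 * (?d / h n)\<^sup>2 = ?d\<^sup>2 / (2 * (h n)\<^sup>2)" by (simp add: power_divide)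
          also have "\<dots> \<le> ?W x / (2 * (h n)\<^sup>2)" using W by (intro divide_right_mono) auto
          finally show ?thesis by simp
        qed (use test_fun_outside[OF \<phi>] in simp)
        then show "AE x in lborel. (v (?h + x) - v x) * \<phi> x / h n \<le> ?W x / (2 * (h n)\<^sup>2) + (\<phi> x)\<^sup>2 / 2" by simp
        show "AE x in lborel. 0 \<le> ?W x / (2 * (h n)\<^sup>2) + (\<phi> x)\<^sup>2 / 2" by simp
      qed
      also have "\<dots> = (\<integral>x. ?W x \<partial>lborel) / (2 * (h n)\<^sup>2) + (\<integral>x. (\<phi> x)\<^sup>2 \<partial>lborel) / 2"
      proof -
        have "integrable lborel ?W"
        proof (rule Bochner_Integration.integrable_bound[OF V_diff_int[of ?h]])
          show "AE x in lborel. norm (?W x) \<le> norm ((norm (H (p / 2) (g (?h + x)) - H (p / 2) (g x)))\<^sup>2)"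
            by (auto simp: indicator_def)
        qed simp
        then show ?thesis using sq[OF \<phi>] by simp
      qed
      also have "(\<integral>x. ?W x \<partial>lborel) / (2 * (h n)\<^sup>2) \<le> (C' * (h n)\<^sup>2) / (2 * (h n)\<^sup>2)"
        by (intro divide_right_mono C' h) simp
      also have "\<dots> = C' / 2" using h(1)[of n] by simp
      finally show ?thesis by simp
    qed
    then show ?thesis by (intro LIMSEQ_le_const2[OF lim]) auto
  qed
  obtain G where G: "G \<in> borel_measurable borel" "integrable lborel (\<lambda>x. (G x)\<^sup>2)"
    "\<And>\<phi>. \<phi> \<in> Collect (test_fun S) \<Longrightarrow> T \<phi> = (\<integral>x. G x * \<phi> x \<partial>lborel)"
  proof (rule L2_representation[of "Collect (test_fun S)" T "C' / 2"])
    show "(\<lambda>x. 0) \<in> Collect (test_fun S)" using test_fun_zero by simp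
    fix \<phi> assume \<phi>: "\<phi> \<in> Collect (test_fun S)"
    show "\<phi> \<in> borel_measurable borel" using test_fun_measurable[of S \<phi>] \<phi> by simp
    show "integrable lborel (\<lambda>x. (\<phi> x)\<^sup>2)" using sq \<phi> by simp
    show "T \<phi> \<le> C' / 2 + (\<integral>x. (\<phi> x)\<^sup>2 \<partial>lborel) / 2" using bound \<phi> by simp
    fix \<psi> a assume \<psi>: "\<psi> \<in> Collect (test_fun S)"
    have a\<psi>: "test_fun S (\<lambda>x. a * \<psi> x)" using \<psi> by (intro test_fun_mult[OF smooth_const]) simp
    then show "(\<lambda>x. \<phi> x + a * \<psi> x) \<in> Collect (test_fun S)"
      using \<phi> test_fun_add[of S \<phi> "\<lambda>x. a * \<psi> x"] by simp
    have s: "smooth \<phi>" "smooth \<psi>" using \<phi> \<psi> test_fun_smooth by auto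
    have D: "((\<lambda>x. \<phi> x + a * \<psi> x) has_derivative (\<lambda>h. frechet_derivative \<phi> (at x) h + a * frechet_derivative \<psi> (at x) h)) (at x)" for x
      by (intro has_derivative_add has_derivative_mult_right smooth_has_derivative s)
    have "frechet_derivative (\<lambda>x. \<phi> x + a * \<psi> x) (at x) c = frechet_derivative \<phi> (at x) c + a * frechet_derivative \<psi> (at x) c" for x
      using fun_cong[OF frechet_derivative_at[OF D[of x]], of c] by (rule sym)
    moreover have "integrable lborel (\<lambda>x. v x * frechet_derivative \<phi> (at x) c)" "integrable lborel (\<lambda>x. v x * frechet_derivative \<psi> (at x) c)"
      using iv[OF test_fun_frechet[OF _ c], of S \<phi>] iv[OF test_fun_frechet[OF _ c], of S \<psi>] \<phi> \<psi> by simp_all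
    ultimately show "T (\<lambda>x. \<phi> x + a * \<psi> x) = T \<phi> + a * T \<psi>"
      by (simp add: T_def distrib_left mult.left_commute)
  qed blast
  have "(\<integral>x. (H (p / 2) (g x) \<bullet> b) * frechet_derivative \<phi> (at x) c \<partial>lborel) = - (\<integral>x. G x * \<phi> x \<partial>lborel)"
    if "test_fun S \<phi>" for \<phi>
    using G(3)[of \<phi>] that unfolding T_def v_def by simp
  with G(1,2) show ?thesis by blast
qed

lemma weak_gradient_H:
  assumes b: "b \<in> Basis"
  shows "\<exists>G :: 'a \<Rightarrow> 'a. G \<in> borel_measurable borel \<and> integrable lborel (\<lambda>x. (norm (G x))\<^sup>2) \<and>
    (\<forall>\<phi>. \<forall>c\<in>Basis. test_fun S \<phi> \<longrightarrow> (\<integral>x. (H (p / 2) (g x) \<bullet> b) * frechet_derivative \<phi> (at x) c \<partial>lborel) = - (\<integral>x. (G x \<bullet> c) * \<phi> x \<partial>lborel))"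
proof -
  obtain G where G0: "\<forall>c\<in>Basis. G c \<in> borel_measurable borel \<and> integrable lborel (\<lambda>x. (G c x)\<^sup>2) \<and>
    (\<forall>\<phi>. test_fun S \<phi> \<longrightarrow> (\<integral>x. (H (p / 2) (g x) \<bullet> b) * frechet_derivative \<phi> (at x) c \<partial>lborel) = - (\<integral>x. G c x * \<phi> x \<partial>lborel))"
    by (rule exE[OF bchoice[OF ballI[OF weak_partial_derivative_H[OF b]]]])
  have G: "G c \<in> borel_measurable borel" "integrable lborel (\<lambda>x. (G c x)\<^sup>2)"
    "test_fun S \<phi> \<Longrightarrow> (\<integral>x. (H (p / 2) (g x) \<bullet> b) * frechet_derivative \<phi> (at x) c \<partial>lborel) = - (\<integral>x. G c x * \<phi> x \<partial>lborel)"
    if "c \<in> Basis" for c \<phi>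
    using bspec[OF G0 that] by simp_all
  define g' :: "'a \<Rightarrow> 'a" where "g' x = (\<Sum>c\<in>Basis. G c x *\<^sub>R c)" for x
  have comp: "g' x \<bullet> c = G c x" if "c \<in> Basis" for x c
    using that by (simp add: g'_def inner_sum_left inner_Basis if_distrib sum.delta cong: if_cong)
  have "(norm (g' x))\<^sup>2 = (\<Sum>c\<in>Basis. (G c x)\<^sup>2)" for x
    unfolding power2_norm_eq_inner by (subst euclidean_inner) (simp add: comp power2_eq_square)
  then have "integrable lborel (\<lambda>x. (norm (g' x))\<^sup>2)" using G(2) by simp
  moreover have "g' \<in> borel_measurable borel" unfolding g'_def[abs_def]
    by (intro borel_measurable_sum borel_measurable_scaleR G(1) borel_measurable_const)
  moreover have "(\<integral>x. (H (p / 2) (g x) \<bullet> b) * frechet_derivative \<phi> (at x) c \<partial>lborel) = - (\<integral>x. (g' x \<bullet> c) * \<phi> x \<partial>lborel)"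
    if "c \<in> Basis" "test_fun S \<phi>" for \<phi> c
    unfolding comp[OF that(1)] by (rule G(3)[OF that])
  ultimately show ?thesis by blast
qed

end

section \<open>From Lebesgue to Borel representatives\<close>

text \<open>Each preimage differs from a Borel set only inside a null set, and the completion
  contains all subsets of null sets.\<close>

lemma borel_measurable_lebesgue_AE:
  fixes k k0 :: "'a::euclidean_space \<Rightarrow> 'b::{second_countable_topology, t2_space}"
  assumes k0: "k0 \<in> borel_measurable borel" and eq: "AE x in lborel. k x = k0 x"
  shows "k \<in> borel_measurable lebesgue"
proof (rule borel_measurableI)
  fix B :: "'b set" assume "open B"
  have k0': "k0 \<in> borel_measurable lebesgue" using k0 by (simp add: measurable_completion)
  have 1: "Measurable.pred lebesgue (\<lambda>x. k0 x \<in> B)"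
    using measurable_sets[OF k0', of B] \<open>open B\<close> by (simp add: pred_def vimage_def)
  have 2: "Measurable.pred lebesgue (\<lambda>x. k x \<noteq> k0 x)"
    by (rule sets_completion_AE) (use eq in simp)
  have 3: "Measurable.pred lebesgue (\<lambda>x. k x \<noteq> k0 x \<and> k x \<in> B)"
    by (rule sets_completion_AE) (use eq in \<open>auto elim: eventually_mono\<close>)
  have "Measurable.pred lebesgue (\<lambda>x. (k0 x \<in> B \<and> \<not> (k x \<noteq> k0 x)) \<or> (k x \<noteq> k0 x \<and> k x \<in> B))"
    using 1 2 3 by measurable
  also have "(\<lambda>x. (k0 x \<in> B \<and> \<not> (k x \<noteq> k0 x)) \<or> (k x \<noteq> k0 x \<and> k x \<in> B)) = (\<lambda>x. k x \<in> B)" by auto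
  finally show "k -` B \<inter> space lebesgue \<in> sets lebesgue"
    by (simp add: pred_def vimage_def)
qed

text \<open>The bridge between the integrals over \<open>lebesgue_on\<close> in the definitions and
  the integrals of Borel functions over the whole space in the estimates; the restriction to
  \<open>U\<close> is part of \<open>k0\<close>.\<close>

lemma integral_lebesgue_on_eq:
  fixes k k0 :: "'a::euclidean_space \<Rightarrow> real"
  assumes U: "U \<in> sets lebesgue" and k0: "k0 \<in> borel_measurable borel"
    and eq: "AE x in lborel. indicator U x * k x = k0 x"
  shows "(LINT x|lebesgue_on U. k x) = (\<integral>x. k0 x \<partial>lborel)"
proof -
  have "(LINT x|lebesgue_on U. k x) = (LINT x|lebesgue. indicator U x *\<^sub>R k x)"
    using U by (intro integral_restrict_space) simp
  also have "\<dots> = (LINT x|lebesgue. k0 x)"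
  proof (rule integral_cong_AE)
    show "(\<lambda>x. indicator U x *\<^sub>R k x) \<in> borel_measurable lebesgue"
      by (rule borel_measurable_lebesgue_AE[OF k0]) (use eq in simp)
    show "k0 \<in> borel_measurable lebesgue" using k0 by (simp add: measurable_completion)
    show "AE x in lebesgue. indicator U x *\<^sub>R k x = k0 x" using AE_completion[OF eq] by simp
  qed
  also have "\<dots> = (\<integral>x. k0 x \<partial>lborel)" using k0 by (intro integral_completion) simp
  finally show ?thesis .
qed

lemma Lp_on_AE:
  fixes k k0 :: "'a::euclidean_space \<Rightarrow> 'b::{real_normed_vector, second_countable_topology}"
  assumes U: "U \<in> sets borel" and k0: "k0 \<in> borel_measurable borel"
    and eq: "AE x in lborel. x \<in> U \<longrightarrow> k x = k0 x" and i: "integrable lborel (\<lambda>x. norm (k0 x) powr q)"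
  shows "Lp_on q U k"
proof -
  have UL: "U \<inter> space lebesgue \<in> sets lebesgue" using U by simp
  have km: "(\<lambda>x. indicator U x *\<^sub>R k x) \<in> borel_measurable lebesgue"
    by (rule borel_measurable_lebesgue_AE[of "\<lambda>x. indicator U x *\<^sub>R k0 x"])
      (use U k0 eq in \<open>auto elim!: eventually_mono simp: indicator_def\<close>)
  then have 1: "k \<in> borel_measurable (lebesgue_on U)"
    using borel_measurable_restrict_space_iff[OF UL, of k] by simp
  have i0: "integrable lborel (\<lambda>x. indicator U x *\<^sub>R (norm (k0 x) powr q))"
    using U i by (intro integrable_mult_indicator) auto
  have "integrable lebesgue (\<lambda>x. indicator U x *\<^sub>R (norm (k x) powr q))"
  proof (subst integrable_cong_AE)
    have a: "AE x in lborel. indicator U x *\<^sub>R (norm (k x) powr q) = indicator U x *\<^sub>R (norm (k0 x) powr q)"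
      using eq by (auto elim!: eventually_mono simp: indicator_def)
    show "AE x in lebesgue. indicator U x *\<^sub>R (norm (k x) powr q) = indicator U x *\<^sub>R (norm (k0 x) powr q)"
      by (rule AE_completion[OF a])
    have m0: "(\<lambda>x. indicator U x *\<^sub>R (norm (k0 x) powr q)) \<in> borel_measurable borel"
      using U k0 by measurable
    then show "(\<lambda>x. indicator U x *\<^sub>R (norm (k0 x) powr q)) \<in> borel_measurable lebesgue"
      by (simp add: measurable_completion)
    show "(\<lambda>x. indicator U x *\<^sub>R (norm (k x) powr q)) \<in> borel_measurable lebesgue"
      by (rule borel_measurable_lebesgue_AE[OF m0 a])
    show "integrable lebesgue (\<lambda>x. indicator U x *\<^sub>R (norm (k0 x) powr q))"
      using i0 m0 by (simp add: integrable_completion)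
  qed
  then have "integrable (lebesgue_on U) (\<lambda>x. norm (k x) powr q)"
    using UL by (simp add: integrable_restrict_space)
  with 1 show ?thesis by (simp add: Lp_on_def)
qed

lemma bounded_powr_integrable:
  fixes k :: "'a::euclidean_space \<Rightarrow> 'b::euclidean_space"
  assumes k: "k \<in> borel_measurable borel" "\<And>x. norm (k x) \<le> B" and z: "\<And>x. x \<notin> U \<Longrightarrow> k x = 0"
    and K: "compact U" and q: "0 \<le> q"
  shows "integrable lborel (\<lambda>x. norm (k x) powr q)"
proof (rule Bochner_Integration.integrable_bound)
  show "integrable lborel (\<lambda>x. B powr q * indicat_real U x)"
    using compact_indicator_integrable[OF K] by simp
  have "norm (k x) powr q \<le> B powr q * indicat_real U x" for x
    using z[of x] k(2)[of x] q by (cases "x \<in> U") (auto intro!: powr_mono2)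
  then show "AE x in lborel. norm (norm (k x) powr q) \<le> norm (B powr q * indicat_real U x)" by simp
  show "(\<lambda>x. norm (k x) powr q) \<in> borel_measurable lborel" using k(1) by measurable
qed

lemma test_fun_frechet_outside:
  assumes "b \<in> Basis" "test_fun U \<phi>" "x \<notin> U"
  shows "frechet_derivative \<phi> (at x) b = 0"
  using cgrad_outside[OF assms(2,3)] assms(1) by (simp flip: cgrad_inner)

text \<open>A test function approximates itself, so the content is that its classical gradient is a
  weak gradient.\<close>

lemma test_fun_W0p:
  assumes \<phi>: "test_fun K \<phi>" and K: "compact K" "K \<subseteq> V" and V: "open V" and p: "1 \<le> p"
  shows "W0p p V \<phi> (cgrad \<phi>)"
proof -
  note sm = test_fun_smooth[OF \<phi>]
  have Vb: "V \<in> sets borel" using V by simp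
  have m: "\<phi> \<in> borel_measurable borel" "cgrad \<phi> \<in> borel_measurable borel"
    using test_fun_measurable[OF \<phi>] cgrad_measurable[OF sm] by auto
  obtain B where B: "\<And>x. norm (\<phi> x) \<le> B" using test_fun_bounded[OF \<phi>] by (metis real_norm_def)
  obtain B' where B': "\<And>x. norm (cgrad \<phi> x) \<le> B'" using cgrad_bounded[OF \<phi>] by metis
  have L: "Lp_on q U \<phi>" "Lp_on q U (cgrad \<phi>)" if "U \<in> sets borel" "0 \<le> q" for U q
    using bounded_powr_integrable[OF m(1) B test_fun_outside[OF \<phi>] K(1) that(2)]
      bounded_powr_integrable[OF m(2) B' cgrad_outside[OF \<phi>] K(1) that(2)]
    by (auto intro!: Lp_on_AE[OF that(1)] m)
  have \<phi>U: "test_fun UNIV \<phi>" using test_fun_mono[OF \<phi>] by simp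
  have "weak_grad V \<phi> (cgrad \<phi>)"
    unfolding weak_grad_def Lp_loc_def
  proof (intro conjI allI impI ballI)
    show "Lp_on 1 U \<phi>" "Lp_on 1 U (cgrad \<phi>)" if "compact U \<and> U \<subseteq> V" for U
      using L[of U 1] that borel_compact by auto
    fix \<psi> b assume \<psi>: "test_fun V \<psi>" and b: "b \<in> (Basis :: 'a set)"
    have \<psi>U: "test_fun UNIV \<psi>" using test_fun_mono[OF \<psi>] by simp
    note [measurable] = m test_fun_measurable[OF \<psi>] frechet_measurable[OF test_fun_smooth[OF \<psi>] b]
    have z: "\<phi> x = 0" "cgrad \<phi> x = 0" if "x \<notin> V" for x
      using that test_fun_outside[OF \<phi>, of x] cgrad_outside[OF \<phi>, of x] K(2) by auto
    have z1: "indicator V x * (\<phi> x * frechet_derivative \<psi> (at x) b) = \<phi> x * frechet_derivative \<psi> (at x) b" for x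
      using z(1)[of x] by (cases "x \<in> V") auto
    have z2: "indicator V x * ((cgrad \<phi> x \<bullet> b) * \<psi> x) = (cgrad \<phi> x \<bullet> b) * \<psi> x" for x
      using z(2)[of x] by (cases "x \<in> V") auto
    have "(LINT x|lebesgue_on V. \<phi> x * frechet_derivative \<psi> (at x) b) = (\<integral>x. \<phi> x * frechet_derivative \<psi> (at x) b \<partial>lborel)"
      by (rule integral_lebesgue_on_eq) (use V z1 in auto)
    also have "\<dots> = - (\<integral>x. (cgrad \<phi> x \<bullet> b) * \<psi> x \<partial>lborel)"
      using integral_by_parts_test_fun[OF \<phi>U \<psi>U b] by (simp add: cgrad_inner[OF b])
    also have "(\<integral>x. (cgrad \<phi> x \<bullet> b) * \<psi> x \<partial>lborel) = (LINT x|lebesgue_on V. (cgrad \<phi> x \<bullet> b) * \<psi> x)"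
      by (rule integral_lebesgue_on_eq[symmetric]) (use V z2 in auto)
    finally show "(LINT x|lebesgue_on V. \<phi> x * frechet_derivative \<psi> (at x) b) = - (LINT x|lebesgue_on V. (cgrad \<phi> x \<bullet> b) * \<psi> x)" .
  qed
  moreover have "Lp_on p V \<phi>" "Lp_on p V (cgrad \<phi>)" using L[OF Vb, of p] p by auto
  ultimately have "W1p p V \<phi> (cgrad \<phi>)" by (simp add: W1p_def)
  moreover have "test_fun V \<phi>" by (rule test_fun_mono[OF \<phi> K(2)])
  ultimately show ?thesis unfolding W0p_def by (intro conjI exI[of _ "\<lambda>k. \<phi>"]) simp_all
qed

text \<open>A Borel version is chosen for each coordinate of the restriction to \<open>K\<close>;
  finitely many exceptional null sets are united.\<close>

lemma Lp_on_borel_representative: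
  fixes k :: "'a::euclidean_space \<Rightarrow> 'b::euclidean_space"
  assumes k: "Lp_on p K k" and K: "K \<in> sets borel"
  obtains k0 where "k0 \<in> borel_measurable borel" "AE x in lborel. x \<in> K \<longrightarrow> k x = k0 x"
    "\<And>x. x \<notin> K \<Longrightarrow> k0 x = 0" "integrable lborel (\<lambda>x. norm (k0 x) powr p)"
proof -
  have KL: "K \<inter> space lebesgue \<in> sets lebesgue" using K by simp
  have km: "(\<lambda>x. indicator K x *\<^sub>R k x) \<in> borel_measurable lebesgue"
    using k borel_measurable_restrict_space_iff[OF KL, of k] by (simp add: Lp_on_def)
  have ex: "\<exists>k'. k' \<in> borel_measurable lborel \<and> (AE x in lborel. (indicator K x *\<^sub>R k x) \<bullet> b = k' x)" for b
  proof -
    have "(\<lambda>x. (indicator K x *\<^sub>R k x) \<bullet> b) \<in> borel_measurable lebesgue"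
      by (intro borel_measurable_inner km borel_measurable_const)
    from completion_ex_borel_measurable_real[OF this] show ?thesis by blast
  qed
  define k' where "k' b = (SOME k'. k' \<in> borel_measurable lborel \<and> (AE x in lborel. (indicator K x *\<^sub>R k x) \<bullet> b = k' x))" for b
  have k': "k' b \<in> borel_measurable lborel" "AE x in lborel. (indicator K x *\<^sub>R k x) \<bullet> b = k' b x" for b
    unfolding k'_def using someI_ex[OF ex[of b]] by blast+
  define k0 where "k0 x = indicator K x *\<^sub>R (\<Sum>b\<in>Basis. k' b x *\<^sub>R b)" for x
  have m: "k0 \<in> borel_measurable borel" unfolding k0_def[abs_def]
    using k'(1) K by (intro borel_measurable_scaleR borel_measurable_sum borel_measurable_indicator borel_measurable_const) auto
  have "AE x in lborel. \<forall>b\<in>Basis. (indicator K x *\<^sub>R k x) \<bullet> b = k' b x"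
    by (rule AE_finite_allI[OF finite_Basis k'(2)])
  then have ae: "AE x in lborel. indicator K x *\<^sub>R k x = k0 x"
  proof eventually_elim
    fix x assume *: "\<forall>b\<in>Basis. (indicator K x *\<^sub>R k x) \<bullet> b = k' b x"
    have "k0 x = indicator K x *\<^sub>R (\<Sum>b\<in>Basis. ((indicator K x *\<^sub>R k x) \<bullet> b) *\<^sub>R b)"
      unfolding k0_def using * by simp
    also have "\<dots> = indicator K x *\<^sub>R k x"
      by (simp only: euclidean_representation) (simp add: indicator_def)
    finally show "indicator K x *\<^sub>R k x = k0 x" by simp
  qed
  have "integrable lebesgue (\<lambda>x. indicator K x *\<^sub>R (norm (k x) powr p))"
    using k KL by (simp add: Lp_on_def integrable_restrict_space)
  moreover have "AE x in lborel. indicator K x *\<^sub>R (norm (k x) powr p) = norm (k0 x) powr p"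
    using ae
  proof eventually_elim
    fix x assume "indicator K x *\<^sub>R k x = k0 x"
    then have "k0 x = indicator K x *\<^sub>R k x" by simp
    then show "indicator K x *\<^sub>R (norm (k x) powr p) = norm (k0 x) powr p" by (simp add: indicator_def)
  qed
  moreover have m': "(\<lambda>x. norm (k0 x) powr p) \<in> borel_measurable borel" using m by measurable
  ultimately have "integrable lebesgue (\<lambda>x. norm (k0 x) powr p)"
  proof (subst integrable_cong_AE[symmetric])
    assume a: "AE x in lborel. indicator K x *\<^sub>R (norm (k x) powr p) = norm (k0 x) powr p"
    show "AE x in lebesgue. indicator K x *\<^sub>R (norm (k x) powr p) = norm (k0 x) powr p" by (rule AE_completion[OF a])
    show "(\<lambda>x. indicator K x *\<^sub>R (norm (k x) powr p)) \<in> borel_measurable lebesgue" by (rule borel_measurable_lebesgue_AE[OF m' a])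
    show "(\<lambda>x. norm (k0 x) powr p) \<in> borel_measurable lebesgue" by (rule measurable_completion) (use m' in simp)
  qed
  then have "integrable lborel (\<lambda>x. norm (k0 x) powr p)"
    using m' by (simp add: integrable_completion)
  moreover have "AE x in lborel. x \<in> K \<longrightarrow> k x = k0 x" using ae by (auto elim!: eventually_mono)
  moreover have "k0 x = 0" if "x \<notin> K" for x using that by (simp add: k0_def)
  ultimately show ?thesis using that m by blast
qed

section \<open>From a solution on the domain to the cut-off data\<close>

text \<open>Separate Lipschitz bounds make \<open>f\<close> jointly Lipschitz on the compact set
  \<open>K \<times> {-B..B}\<close>, hence continuous and bounded there, and the graph of
  \<open>u\<close> over \<open>K\<close> stays inside it.\<close>

lemma lipschitz_coefficient:
  fixes f :: "'a::euclidean_space \<Rightarrow> real \<Rightarrow> real"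
  assumes f: "\<And>x y s t. x \<in> K \<Longrightarrow> y \<in> K \<Longrightarrow> \<bar>s\<bar> \<le> B \<Longrightarrow> \<bar>t\<bar> \<le> B \<Longrightarrow>
      \<bar>f x s - f x t\<bar> \<le> L * \<bar>s - t\<bar> \<and> \<bar>f x s - f y s\<bar> \<le> M * dist x y"
    and LM: "0 \<le> L" "0 \<le> M" and K: "compact K"
    and u: "u \<in> borel_measurable borel" "\<And>x. \<bar>u x\<bar> \<le> B"
  shows "(\<lambda>x. indicator K x * f x (u x)) \<in> borel_measurable borel"
    "\<exists>C. \<forall>x. \<bar>indicator K x * f x (u x)\<bar> \<le> C"
proof -
  let ?Q = "K \<times> {-B..B}"
  let ?q = "\<lambda>z. f (fst z) (snd z)"
  have Q: "compact ?Q" using K by (intro compact_Times) auto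
  have "(L + M)-lipschitz_on ?Q ?q"
  proof (rule lipschitz_onI)
    fix z w assume z: "z \<in> ?Q" and w: "w \<in> ?Q"
    obtain x s y t where zw: "z = (x, s)" "w = (y, t)" by (cases z, cases w) auto
    have xy: "x \<in> K" "y \<in> K" "\<bar>s\<bar> \<le> B" "\<bar>t\<bar> \<le> B" using z w by (auto simp: zw)
    have 1: "\<bar>f x s - f x t\<bar> \<le> L * \<bar>s - t\<bar>" "\<bar>f x t - f y t\<bar> \<le> M * dist x y"
      using f[OF xy] f[OF xy(1,2,4,4)] by auto
    have "\<bar>s - t\<bar> \<le> dist z w" "dist x y \<le> dist z w"
      using dist_snd_le[of z w] dist_fst_le[of z w] by (auto simp: zw dist_real_def)
    then have 2: "L * \<bar>s - t\<bar> \<le> L * dist z w" "M * dist x y \<le> M * dist z w"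
      using LM by (auto intro: mult_left_mono)
    have "dist (?q z) (?q w) = \<bar>f x s - f y t\<bar>" by (simp add: zw dist_real_def)
    also have "\<dots> \<le> (L + M) * dist z w"
      using 1 2 unfolding distrib_right by linarith
    finally show "dist (?q z) (?q w) \<le> (L + M) * dist z w" .
  qed (use LM in simp)
  then have cont: "continuous_on ?Q ?q" by (rule lipschitz_on_continuous_on)
  have uQ: "(x, u x) \<in> ?Q \<longleftrightarrow> x \<in> K" for x using u(2)[of x] by (auto simp: abs_le_iff)
  have eq: "indicator K x * f x (u x) = indicator ?Q (x, u x) *\<^sub>R ?q (x, u x)" for x
    using uQ[of x] by (auto simp: indicator_def)
  have "(\<lambda>z. indicator ?Q z *\<^sub>R ?q z) \<in> borel_measurable borel"
    by (rule borel_measurable_continuous_on_indicator[OF borel_compact[OF Q] cont])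
  moreover have "(\<lambda>x. (x, u x)) \<in> borel_measurable borel" using u(1) by simp
  ultimately have "(\<lambda>x. indicator ?Q (x, u x) *\<^sub>R ?q (x, u x)) \<in> borel_measurable borel"
    by (rule measurable_compose_rev)
  then show "(\<lambda>x. indicator K x * f x (u x)) \<in> borel_measurable borel" by (simp only: eq)
  obtain C where C: "\<And>z. z \<in> ?Q \<Longrightarrow> norm (?q z) \<le> C" and "C > 0"
    using compact_imp_bounded[OF compact_continuous_image[OF cont Q]] unfolding bounded_pos by blast
  have "\<bar>indicator K x * f x (u x)\<bar> \<le> C" for x
    using C[of "(x, u x)"] uQ[of x] \<open>C > 0\<close> by (cases "x \<in> K") auto
  then show "\<exists>C. \<forall>x. \<bar>indicator K x * f x (u x)\<bar> \<le> C" by blast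
qed

lemma local_weak_gradient_H:
  fixes \<Omega> :: "'a::euclidean_space set"
  assumes \<Omega>: "open \<Omega>" and p: "p \<ge> 2" and f: "F1_F2 \<Omega> f" and W: "W1p_loc p \<Omega> u Du"
    and Li: "Linf_loc \<Omega> u" and sol: "local_weak_solution p \<Omega> f u Du"
    and S: "compact S" "S \<subseteq> \<Omega>" and b: "b \<in> Basis"
  shows "\<exists>g G. g \<in> borel_measurable borel \<and> (AE x in lborel. x \<in> S \<longrightarrow> Du x = g x) \<and>
    integrable lborel (\<lambda>x. (H (p / 2) (g x) \<bullet> b)\<^sup>2) \<and>
    G \<in> borel_measurable borel \<and> integrable lborel (\<lambda>x. (norm (G x :: 'a))\<^sup>2) \<and>
    (\<forall>\<phi>. \<forall>c\<in>Basis. test_fun S \<phi> \<longrightarrow>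
      (\<integral>x. (H (p / 2) (g x) \<bullet> b) * frechet_derivative \<phi> (at x) c \<partial>lborel) = - (\<integral>x. (G x \<bullet> c) * \<phi> x \<partial>lborel))"
proof -
  obtain e where e: "e > 0" "(\<Union>x\<in>S. cball x e) \<subseteq> \<Omega>"
    using compact_subset_open_imp_cball_epsilon_subset[OF S(1) \<Omega> S(2)] by blast
  \<comment> \<open>Four layers carry the cut-off data; the fifth leaves room for the open set
    \<open>V\<close> between \<open>K\<close> and the complement of the domain, on which the
    equation and the Lipschitz constants are available.\<close>
  define r where "r = e / 5"
  have r: "r > 0" using e by (simp add: r_def)
  define K where "K = nbhd S (4 * r)"
  define V where "V = interior (nbhd S (5 * r))"
  have N5: "nbhd S (5 * r) \<subseteq> \<Omega>"
  proof
    fix x assume "x \<in> nbhd S (5 * r)"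
    then obtain y where "y \<in> S" "norm (x - y) \<le> e" unfolding nbhd_iff r_def by auto
    then have "x \<in> (\<Union>x\<in>S. cball x e)" by (auto simp: dist_norm norm_minus_commute)
    with e show "x \<in> \<Omega>" by blast
  qed
  have K: "compact K" unfolding K_def by (rule compact_nbhd[OF S(1)])
  have SK: "S \<subseteq> K" unfolding K_def using subset_nbhd[of "4 * r" S] r by simp
  have KV: "K \<subseteq> V"
  proof -
    have "(\<Union>x\<in>K. ball x r) \<subseteq> nbhd S (5 * r)"
    proof
      fix y assume "y \<in> (\<Union>x\<in>K. ball x r)"
      then obtain x where x: "x \<in> nbhd S (4 * r)" "norm (y - x) \<le> r" by (auto simp: K_def dist_norm norm_minus_commute)
      show "y \<in> nbhd S (5 * r)" by (rule nbhd_step[OF x]) simp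
    qed
    then have "(\<Union>x\<in>K. ball x r) \<subseteq> V" unfolding V_def by (rule interior_maximal) auto
    moreover have "x \<in> ball x r" for x :: 'a using r by simp
    ultimately show ?thesis by blast
  qed
  have clV: "closure V \<subseteq> nbhd S (5 * r)"
    unfolding V_def by (intro closure_minimal interior_subset compact_imp_closed compact_nbhd S(1))
  have ccV: "cc_open V \<Omega>"
    unfolding cc_open_def
  proof (intro conjI)
    show "open V" by (simp add: V_def)
    show "compact (closure V)"
      using clV compact_nbhd[OF S(1)] by (meson bounded_subset closed_closure compact_eq_bounded_closed)
    show "closure V \<subseteq> \<Omega>" using clV N5 by blast
  qed
  have K\<Omega>: "K \<subseteq> \<Omega>" using KV ccV closure_subset unfolding cc_open_def by blast
  have Kb: "K \<in> sets borel" by (rule borel_compact[OF K])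
  have KL: "K \<inter> space lebesgue \<in> sets lebesgue" using Kb by simp
  have wg: "weak_grad \<Omega> u Du" and Lpu: "Lp_on p K u" and Lpg: "Lp_on p K Du"
    using W K K\<Omega> unfolding W1p_loc_def Lp_loc_def by auto
  obtain u1 where u1: "u1 \<in> borel_measurable borel" "AE x in lborel. x \<in> K \<longrightarrow> u x = u1 x"
    by (rule Lp_on_borel_representative[OF Lpu Kb]) blast
  obtain g where g: "g \<in> borel_measurable borel" "AE x in lborel. x \<in> K \<longrightarrow> Du x = g x"
    "\<And>x. x \<notin> K \<Longrightarrow> g x = 0" "integrable lborel (\<lambda>x. norm (g x) powr p)"
    by (rule Lp_on_borel_representative[OF Lpg Kb]) blast
  obtain C1 where "AE x in lebesgue_on K. \<bar>u x\<bar> \<le> C1" using Li K K\<Omega> unfolding Linf_loc_def by blast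
  then have "AE x in lebesgue. x \<in> K \<longrightarrow> \<bar>u x\<bar> \<le> C1"
    by (simp only: AE_restrict_space_iff[OF KL])
  then have C1: "AE x in lborel. x \<in> K \<longrightarrow> \<bar>u x\<bar> \<le> C1"
    by (simp only: AE_completion_iff)
  \<comment> \<open>The maximum ensures the positive bound for which (F1) and (F2) are
    formulated.\<close>
  define B where "B = max C1 1"
  have B: "B > 0" "C1 \<le> B" by (auto simp: B_def)
  \<comment> \<open>The essential bound on \<open>u\<close> becomes a bound at every point by
    truncation, which changes the function only on a null set of \<open>K\<close>.\<close>
  define u0 where "u0 x = indicator K x * max (- B) (min B (u1 x))" for x
  have u0m: "u0 \<in> borel_measurable borel" unfolding u0_def[abs_def] using u1(1) Kb by measurable
  have u0B: "\<bar>u0 x\<bar> \<le> B" for x using B by (auto simp: u0_def indicator_def)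
  have u0: "AE x in lborel. x \<in> K \<longrightarrow> u x = u0 x"
    using u1(2) C1 by eventually_elim (use B in \<open>auto simp: u0_def\<close>)
  have u00: "x \<notin> K \<Longrightarrow> u0 x = 0" for x by (simp add: u0_def)
  have u0p: "integrable lborel (\<lambda>x. norm (u0 x) powr p)"
    by (rule bounded_powr_integrable[OF u0m _ u00 K]) (use u0B p in auto)
  have "\<exists>L>0. \<exists>M>0. \<forall>x\<in>V. \<forall>y\<in>V. \<forall>s t. \<bar>s\<bar> \<le> B \<and> \<bar>t\<bar> \<le> B \<longrightarrow>
      \<bar>f x s - f x t\<bar> \<le> L * \<bar>s - t\<bar> \<and> \<bar>f x s - f y s\<bar> \<le> M * dist x y"
    using f[unfolded F1_F2_def, THEN spec, THEN mp, OF ccV, THEN spec, THEN mp, OF B(1)] .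
  then obtain L M where LM: "L > 0" "M > 0" and fV0: "\<forall>x\<in>V. \<forall>y\<in>V. \<forall>s t. \<bar>s\<bar> \<le> B \<and> \<bar>t\<bar> \<le> B \<longrightarrow>
      \<bar>f x s - f x t\<bar> \<le> L * \<bar>s - t\<bar> \<and> \<bar>f x s - f y s\<bar> \<le> M * dist x y"
    by (elim exE conjE) (rule that)
  have LM0: "0 \<le> L" "0 \<le> M" using LM by auto
  have fK: "\<bar>f x s - f x t\<bar> \<le> L * \<bar>s - t\<bar> \<and> \<bar>f x s - f y s\<bar> \<le> M * dist x y"
    if "x \<in> K" "y \<in> K" "\<bar>s\<bar> \<le> B" "\<bar>t\<bar> \<le> B" for x y s t
    using fV0[rule_format, OF subsetD[OF KV that(1)] subsetD[OF KV that(2)] conjI[OF that(3,4)]] .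
  define F where "F x = indicator K x * f x (u0 x)" for x
  have Fm: "F \<in> borel_measurable borel"
    unfolding F_def[abs_def] by (rule lipschitz_coefficient(1)[OF fK LM0 K u0m u0B])
  have "\<exists>C. \<forall>x. \<bar>F x\<bar> \<le> C"
    unfolding F_def by (rule lipschitz_coefficient(2)[OF fK LM0 K u0m u0B])
  then obtain C where C: "\<And>x. \<bar>F x\<bar> \<le> C" by blast
  interpret weak_solution_cut S r p u0 g F L M C
  proof
    show "x \<notin> nbhd S (4 * r) \<Longrightarrow> u0 x = 0" "x \<notin> nbhd S (4 * r) \<Longrightarrow> g x = 0" for x
      using u00 g(3) by (simp_all add: K_def)
    show "x \<notin> nbhd S (4 * r) \<Longrightarrow> F x = 0" for x by (simp add: F_def K_def)
    show "\<bar>F x - F y\<bar> \<le> L * \<bar>u0 x - u0 y\<bar> + M * norm (x - y)"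
      if "x \<in> nbhd S (2 * r)" "y \<in> nbhd S (2 * r)" for x y
    proof -
      have xy: "x \<in> K" "y \<in> K" using that nbhd_mono[of "2 * r" "4 * r" S] r by (auto simp: K_def)
      have "\<bar>f x (u0 x) - f x (u0 y)\<bar> \<le> L * \<bar>u0 x - u0 y\<bar>" "\<bar>f x (u0 y) - f y (u0 y)\<bar> \<le> M * dist x y"
        using fK[OF xy u0B u0B] fK[OF xy u0B[of y] u0B[of y]] by auto
      then show ?thesis using xy by (simp add: F_def dist_norm)
    qed
    show "(\<integral>x. u0 x * frechet_derivative \<phi> (at x) c \<partial>lborel) = - (\<integral>x. (g x \<bullet> c) * \<phi> x \<partial>lborel)"
      if \<phi>: "test_fun (nbhd S (4 * r)) \<phi>" and c: "c \<in> Basis" for \<phi> c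
    proof -
      have \<phi>K: "test_fun K \<phi>" using \<phi> by (simp add: K_def)
      have t\<Omega>: "test_fun \<Omega> \<phi>" by (rule test_fun_mono[OF \<phi>K K\<Omega>])
      have \<Omega>L: "\<Omega> \<in> sets lebesgue" using \<Omega> by simp
      have "(LINT x|lebesgue_on \<Omega>. u x * frechet_derivative \<phi> (at x) c) = (\<integral>x. u0 x * frechet_derivative \<phi> (at x) c \<partial>lborel)"
      proof (rule integral_lebesgue_on_eq[OF \<Omega>L])
        show "(\<lambda>x. u0 x * frechet_derivative \<phi> (at x) c) \<in> borel_measurable borel"
          by (intro borel_measurable_times u0m frechet_measurable[OF test_fun_smooth[OF \<phi>] c])
        show "AE x in lborel. indicator \<Omega> x * (u x * frechet_derivative \<phi> (at x) c) = u0 x * frechet_derivative \<phi> (at x) c"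
          using u0
        proof eventually_elim
          fix x assume "x \<in> K \<longrightarrow> u x = u0 x"
          then show "indicator \<Omega> x * (u x * frechet_derivative \<phi> (at x) c) = u0 x * frechet_derivative \<phi> (at x) c"
            using K\<Omega> test_fun_frechet_outside[OF c \<phi>K, of x] by (cases "x \<in> K") auto
        qed
      qed
      moreover have "(LINT x|lebesgue_on \<Omega>. (Du x \<bullet> c) * \<phi> x) = (\<integral>x. (g x \<bullet> c) * \<phi> x \<partial>lborel)"
      proof (rule integral_lebesgue_on_eq[OF \<Omega>L])
        show "(\<lambda>x. (g x \<bullet> c) * \<phi> x) \<in> borel_measurable borel"
          using g(1) test_fun_measurable[OF \<phi>] by measurable
        show "AE x in lborel. indicator \<Omega> x * ((Du x \<bullet> c) * \<phi> x) = (g x \<bullet> c) * \<phi> x"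
          using g(2)
        proof eventually_elim
          fix x assume "x \<in> K \<longrightarrow> Du x = g x"
          then show "indicator \<Omega> x * ((Du x \<bullet> c) * \<phi> x) = (g x \<bullet> c) * \<phi> x"
            using K\<Omega> test_fun_outside[OF \<phi>K, of x] by (cases "x \<in> K") auto
        qed
      qed
      ultimately show ?thesis using wg t\<Omega> c unfolding weak_grad_def by simp
    qed
    show "(\<integral>x. H (p - 1) (g x) \<bullet> cgrad \<phi> x \<partial>lborel) = (\<integral>x. F x * \<phi> x \<partial>lborel)"
      if \<phi>: "test_fun (nbhd S (4 * r)) \<phi>" for \<phi>
    proof -
      have \<phi>K: "test_fun K \<phi>" using \<phi> by (simp add: K_def)
      have V: "open V" "V \<in> sets lebesgue" by (auto simp: V_def)
      have W0: "W0p p V \<phi> (cgrad \<phi>)" by (rule test_fun_W0p[OF \<phi>K K KV V(1)]) (use p in simp)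
      have "(LINT x|lebesgue_on V. H (p - 1) (Du x) \<bullet> cgrad \<phi> x) = (\<integral>x. H (p - 1) (g x) \<bullet> cgrad \<phi> x \<partial>lborel)"
      proof (rule integral_lebesgue_on_eq[OF V(2)])
        show "(\<lambda>x. H (p - 1) (g x) \<bullet> cgrad \<phi> x) \<in> borel_measurable borel"
          using g(1) cgrad_measurable[OF test_fun_smooth[OF \<phi>]] by measurable
        show "AE x in lborel. indicator V x * (H (p - 1) (Du x) \<bullet> cgrad \<phi> x) = H (p - 1) (g x) \<bullet> cgrad \<phi> x"
          using g(2)
        proof eventually_elim
          fix x assume "x \<in> K \<longrightarrow> Du x = g x"
          then show "indicator V x * (H (p - 1) (Du x) \<bullet> cgrad \<phi> x) = H (p - 1) (g x) \<bullet> cgrad \<phi> x"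
            using KV cgrad_outside[OF \<phi>K, of x] by (cases "x \<in> K") auto
        qed
      qed
      moreover have "(LINT x|lebesgue_on V. f x (u x) * \<phi> x) = (\<integral>x. F x * \<phi> x \<partial>lborel)"
      proof (rule integral_lebesgue_on_eq[OF V(2)])
        show "(\<lambda>x. F x * \<phi> x) \<in> borel_measurable borel"
          using Fm test_fun_measurable[OF \<phi>] by measurable
        show "AE x in lborel. indicator V x * (f x (u x) * \<phi> x) = F x * \<phi> x"
          using u0
        proof eventually_elim
          fix x assume "x \<in> K \<longrightarrow> u x = u0 x"
          then show "indicator V x * (f x (u x) * \<phi> x) = F x * \<phi> x"
            using KV test_fun_outside[OF \<phi>K, of x] by (cases "x \<in> K") (auto simp: F_def)
        qed
      qed
      moreover have "(LINT x|lebesgue_on V. H (p - 1) (Du x) \<bullet> cgrad \<phi> x) = (LINT x|lebesgue_on V. f x (u x) * \<phi> x)"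
        using sol ccV W0 unfolding local_weak_solution_def by blast
      ultimately show ?thesis by simp
    qed
    show "compact S" by (rule S(1))
    show "0 < r" by (rule r)
    show "2 \<le> p" by (rule p)
    show "u0 \<in> borel_measurable borel" by (rule u0m)
    show "g \<in> borel_measurable borel" by (rule g(1))
    show "integrable lborel (\<lambda>x. norm (u0 x) powr p)" by (rule u0p)
    show "integrable lborel (\<lambda>x. norm (g x) powr p)" by (rule g(4))
    show "F \<in> borel_measurable borel" by (rule Fm)
    show "\<bar>F x\<bar> \<le> C" for x by (rule C)
    show "0 \<le> L" "0 \<le> M" by (rule LM0)+
  qed
  have ae: "AE x in lborel. x \<in> S \<longrightarrow> Du x = g x"
    using g(2) by (rule eventually_mono) (use SK in auto)
  show ?thesis
    by (rule exE[OF weak_gradient_H[OF b]], intro exI conjI, rule g(1), rule ae, rule V_component_Lp2[OF b])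
      (elim conjE, assumption)+
qed

section \<open>Gluing the local gradients\<close>

lemma L2_restrict_compact:
  fixes k :: "'a::euclidean_space \<Rightarrow> 'b::euclidean_space"
  assumes k: "k \<in> borel_measurable borel" and i: "integrable lborel (\<lambda>x. (norm (k x))\<^sup>2)" and K: "compact K"
  shows "integrable lborel (\<lambda>x. norm (indicator K x *\<^sub>R k x) powr 2)"
    "integrable lborel (\<lambda>x. indicator K x *\<^sub>R k x)"
proof -
  have Kb: "K \<in> sets borel" by (rule borel_compact[OF K])
  have m: "(\<lambda>x. indicator K x *\<^sub>R k x) \<in> borel_measurable borel" using k Kb by measurable
  show 1: "integrable lborel (\<lambda>x. norm (indicator K x *\<^sub>R k x) powr 2)"
  proof (rule Bochner_Integration.integrable_bound[OF i])
    show "AE x in lborel. norm (norm (indicator K x *\<^sub>R k x) powr 2) \<le> norm ((norm (k x))\<^sup>2)"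
      unfolding norm_powr_2 by (simp add: indicator_def)
    show "(\<lambda>x. norm (indicator K x *\<^sub>R k x) powr 2) \<in> borel_measurable lborel" using m by measurable
  qed
  show "integrable lborel (\<lambda>x. indicator K x *\<^sub>R k x)"
    by (rule Lp_compact_support_integrable[OF _ m 1 K]) simp_all
qed

lemma Lp_loc_of_L2_representatives:
  fixes k :: "'a::euclidean_space \<Rightarrow> 'b::euclidean_space"
  assumes cov: "\<And>K. compact K \<Longrightarrow> K \<subseteq> \<Omega> \<Longrightarrow> \<exists>k0. k0 \<in> borel_measurable borel \<and>
      integrable lborel (\<lambda>x. (norm (k0 x))\<^sup>2) \<and> (AE x in lborel. x \<in> K \<longrightarrow> k x = k0 x)"
  shows "Lp_loc 1 \<Omega> k" "Lp_loc 2 \<Omega> k"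
proof -
  have "Lp_on 1 K k \<and> Lp_on 2 K k" if K: "compact K" "K \<subseteq> \<Omega>" for K
  proof -
    obtain k0 where k0: "k0 \<in> borel_measurable borel" "integrable lborel (\<lambda>x. (norm (k0 x))\<^sup>2)"
      "AE x in lborel. x \<in> K \<longrightarrow> k x = k0 x"
      using cov[OF K] by (elim exE conjE) (rule that)
    have Kb: "K \<in> sets borel" by (rule borel_compact[OF K(1)])
    have m: "(\<lambda>x. indicator K x *\<^sub>R k0 x) \<in> borel_measurable borel" using k0(1) Kb by measurable
    have ae: "AE x in lborel. x \<in> K \<longrightarrow> k x = indicator K x *\<^sub>R k0 x"
      using k0(3) by (rule eventually_mono) simp
    note L = L2_restrict_compact[OF k0(1,2) K(1)]
    have "integrable lborel (\<lambda>x. norm (indicator K x *\<^sub>R k0 x) powr 1)"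
      using integrable_norm[OF L(2)] by simp
    then show ?thesis using Lp_on_AE[OF Kb m ae] L(1) by simp
  qed
  then show "Lp_loc 1 \<Omega> k" "Lp_loc 2 \<Omega> k" by (auto simp: Lp_loc_def)
qed

text \<open>The difference of the two gradients is orthogonal to every test function on
  \<open>K\<close>. The fundamental lemma needs room for a kernel around each point, so equality is
  obtained only on a compact part of the interior.\<close>

lemma weak_gradient_unique:
  fixes v1 v2 :: "'a::euclidean_space \<Rightarrow> real" and G1 G2 :: "'a \<Rightarrow> 'a"
  assumes K: "compact K" "compact K'" "K' \<subseteq> interior K"
    and v: "v1 \<in> borel_measurable borel" "v2 \<in> borel_measurable borel" "AE x in lborel. x \<in> K \<longrightarrow> v1 x = v2 x"
    and G1: "G1 \<in> borel_measurable borel" "integrable lborel (\<lambda>x. (norm (G1 x))\<^sup>2)"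
    and G2: "G2 \<in> borel_measurable borel" "integrable lborel (\<lambda>x. (norm (G2 x))\<^sup>2)"
    and w1: "\<And>\<phi> c. c \<in> Basis \<Longrightarrow> test_fun K \<phi> \<Longrightarrow> (\<integral>x. v1 x * frechet_derivative \<phi> (at x) c \<partial>lborel) = - (\<integral>x. (G1 x \<bullet> c) * \<phi> x \<partial>lborel)"
    and w2: "\<And>\<phi> c. c \<in> Basis \<Longrightarrow> test_fun K \<phi> \<Longrightarrow> (\<integral>x. v2 x * frechet_derivative \<phi> (at x) c \<partial>lborel) = - (\<integral>x. (G2 x \<bullet> c) * \<phi> x \<partial>lborel)"
  shows "AE x in lborel. x \<in> K' \<longrightarrow> G1 x = G2 x"
proof -
  obtain \<delta> where \<delta>: "\<delta> > 0" "(\<Union>x\<in>K'. cball x \<delta>) \<subseteq> interior K"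
    using compact_subset_open_imp_cball_epsilon_subset[OF K(2) open_interior K(3)] by blast
  have nb: "nbhd K' \<delta> \<subseteq> K"
  proof
    fix x assume "x \<in> nbhd K' \<delta>"
    then obtain y where "y \<in> K'" "norm (x - y) \<le> \<delta>" unfolding nbhd_iff by blast
    then have "x \<in> (\<Union>x\<in>K'. cball x \<delta>)" by (auto simp: dist_norm norm_minus_commute)
    then show "x \<in> K" using \<delta>(2) interior_subset by blast
  qed
  note I1 = L2_restrict_compact(2)[OF G1 K(1)] and I2 = L2_restrict_compact(2)[OF G2 K(1)]
  have comp: "AE x in lborel. x \<in> K' \<longrightarrow> indicator K x * (G1 x \<bullet> c) - indicator K x * (G2 x \<bullet> c) = 0" if c: "c \<in> Basis" for c
  proof (rule fundamental_lemma[OF _ K(1,2) \<delta>(1) nb])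
    have i1: "integrable lborel (\<lambda>x. indicator K x * (G1 x \<bullet> c))" and i2: "integrable lborel (\<lambda>x. indicator K x * (G2 x \<bullet> c))"
      using integrable_inner_left[OF I1, of c] integrable_inner_left[OF I2, of c] by simp_all
    then show "integrable lborel (\<lambda>x. indicator K x * (G1 x \<bullet> c) - indicator K x * (G2 x \<bullet> c))" by simp
    fix \<phi> assume \<phi>: "test_fun K \<phi>"
    have ip: "integrable lborel (\<lambda>x. (indicator K x * (G1 x \<bullet> c)) * \<phi> x)" "integrable lborel (\<lambda>x. (indicator K x * (G2 x \<bullet> c)) * \<phi> x)"
      using integrable_mult_test_fun[OF i1 \<phi>, of "\<lambda>x. x"] integrable_mult_test_fun[OF i2 \<phi>, of "\<lambda>x. x"] by (simp_all add: mult.commute)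
    have drop: "(indicator K x * y) * \<phi> x = y * \<phi> x" for x and y :: real
      using test_fun_outside[OF \<phi>, of x] by (cases "x \<in> K") auto
    have "(\<integral>x. (indicator K x * (G1 x \<bullet> c) - indicator K x * (G2 x \<bullet> c)) * \<phi> x \<partial>lborel) =
      (\<integral>x. (indicator K x * (G1 x \<bullet> c)) * \<phi> x \<partial>lborel) - (\<integral>x. (indicator K x * (G2 x \<bullet> c)) * \<phi> x \<partial>lborel)"
      using ip by (simp add: left_diff_distrib)
    also have "\<dots> = (\<integral>x. v2 x * frechet_derivative \<phi> (at x) c \<partial>lborel) - (\<integral>x. v1 x * frechet_derivative \<phi> (at x) c \<partial>lborel)"
      unfolding drop w1[OF c \<phi>] w2[OF c \<phi>] by simp
    also have "(\<integral>x. v2 x * frechet_derivative \<phi> (at x) c \<partial>lborel) = (\<integral>x. v1 x * frechet_derivative \<phi> (at x) c \<partial>lborel)"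
    proof (rule integral_cong_AE)
      note [measurable] = v(1,2) frechet_measurable[OF test_fun_smooth[OF \<phi>] c]
      show "(\<lambda>x. v2 x * frechet_derivative \<phi> (at x) c) \<in> borel_measurable lborel"
        "(\<lambda>x. v1 x * frechet_derivative \<phi> (at x) c) \<in> borel_measurable lborel" by measurable
      show "AE x in lborel. v2 x * frechet_derivative \<phi> (at x) c = v1 x * frechet_derivative \<phi> (at x) c"
        using v(3)
      proof eventually_elim
        fix x assume "x \<in> K \<longrightarrow> v1 x = v2 x"
        then show "v2 x * frechet_derivative \<phi> (at x) c = v1 x * frechet_derivative \<phi> (at x) c"
          using test_fun_frechet_outside[OF c \<phi>, of x] by (cases "x \<in> K") auto
      qed
    qed
    finally show "(\<integral>x. (indicator K x * (G1 x \<bullet> c) - indicator K x * (G2 x \<bullet> c)) * \<phi> x \<partial>lborel) = 0" by simp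
  qed
  have "AE x in lborel. \<forall>c\<in>Basis. x \<in> K' \<longrightarrow> indicator K x * (G1 x \<bullet> c) - indicator K x * (G2 x \<bullet> c) = 0"
    by (rule AE_finite_allI[OF finite_Basis comp])
  then show ?thesis
  proof (rule eventually_mono, intro impI)
    fix x assume *: "\<forall>c\<in>Basis. x \<in> K' \<longrightarrow> indicator K x * (G1 x \<bullet> c) - indicator K x * (G2 x \<bullet> c) = 0" and x: "x \<in> K'"
    have "x \<in> K" using x K(3) interior_subset by blast
    then have eqc: "\<forall>c\<in>Basis. G1 x \<bullet> c = G2 x \<bullet> c" using * x by simp
    show "G1 x = G2 x" by (rule euclidean_eqI, rule bspec[OF eqc])
  qed
qed

text \<open>Weak gradients are defined for scalar functions, so the vector field is treated one
  coordinate at a time.\<close>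

theorem theorem3p1:
  fixes \<Omega> :: "'a::euclidean_space set"
    and f :: "'a \<Rightarrow> real \<Rightarrow> real"
    and u :: "'a \<Rightarrow> real"
    and Du :: "'a \<Rightarrow> 'a"
    and p :: real
  assumes "open \<Omega>"
    and "DIM('a) \<ge> 2"
    and "p \<ge> 2"
    and "F1_F2 \<Omega> f"
    and "W1p_loc p \<Omega> u Du"
    and "Linf_loc \<Omega> u"
    and "local_weak_solution p \<Omega> f u Du"
  shows "\<forall>b\<in>Basis. \<exists>G. W1p_loc 2 \<Omega> (\<lambda>x. H (p / 2) (Du x) \<bullet> b) G"
proof
  fix b :: 'a assume b: "b \<in> Basis"
  define v where "v x = H (p / 2) (Du x) \<bullet> b" for x
  obtain C where C: "\<And>n. compact (C n)" "\<And>n. C n \<subseteq> \<Omega>" "\<And>n. C n \<subseteq> interior (C (Suc n))"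
    "\<Union>(range C) = \<Omega>" "\<And>K. compact K \<Longrightarrow> K \<subseteq> \<Omega> \<Longrightarrow> \<exists>N. \<forall>n\<ge>N. K \<subseteq> C n"
    by (rule open_Union_compact_subsets[OF assms(1)]) (rule that; assumption)
  have C_mono: "C m \<subseteq> C n" if "m \<le> n" for m n
    by (rule lift_Suc_mono_le[OF _ that]) (use C(3) interior_subset in blast)
  define P where "P n g G \<longleftrightarrow> g \<in> borel_measurable borel \<and> (AE x in lborel. x \<in> C n \<longrightarrow> Du x = g x) \<and>
    integrable lborel (\<lambda>x. (H (p / 2) (g x) \<bullet> b)\<^sup>2) \<and>
    G \<in> borel_measurable borel \<and> integrable lborel (\<lambda>x. (norm (G x :: 'a))\<^sup>2) \<and>
    (\<forall>\<phi>. \<forall>c\<in>Basis. test_fun (C n) \<phi> \<longrightarrow>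
      (\<integral>x. (H (p / 2) (g x) \<bullet> b) * frechet_derivative \<phi> (at x) c \<partial>lborel) = - (\<integral>x. (G x \<bullet> c) * \<phi> x \<partial>lborel))" for n g G
  have "\<forall>n. \<exists>g G. P n g G"
    unfolding P_def by (intro allI local_weak_gradient_H[OF assms(1,3,4,5,6,7) C(1,2) b])
  then obtain g G where P: "\<And>n. P n (g n) (G n)" by metis
  define w where "w n x = H (p / 2) (g n x) \<bullet> b" for n x
  have w: "w n \<in> borel_measurable borel" "integrable lborel (\<lambda>x. (norm (w n x))\<^sup>2)" for n
  proof -
    have [measurable]: "g n \<in> borel_measurable borel" using P[of n] by (simp add: P_def)
    show "w n \<in> borel_measurable borel" unfolding w_def[abs_def] by measurable
    show "integrable lborel (\<lambda>x. (norm (w n x))\<^sup>2)" using P[of n] by (simp add: P_def w_def)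
  qed
  have vw: "AE x in lborel. x \<in> C n \<longrightarrow> v x = w n x" for n
  proof -
    have "AE x in lborel. x \<in> C n \<longrightarrow> Du x = g n x" using P[of n] by (simp add: P_def)
    then show ?thesis by (rule eventually_mono) (simp add: v_def w_def)
  qed
  have G: "G n \<in> borel_measurable borel" "integrable lborel (\<lambda>x. (norm (G n x))\<^sup>2)" for n
    using P[of n] by (simp_all add: P_def)
  have wG: "(\<integral>x. w n x * frechet_derivative \<phi> (at x) c \<partial>lborel) = - (\<integral>x. (G n x \<bullet> c) * \<phi> x \<partial>lborel)"
    if "c \<in> Basis" "test_fun (C n) \<phi>" for c n \<phi>
    using P[of n] that by (simp add: P_def w_def)
  \<comment> \<open>Both weak identities hold on \<open>C (Suc m)\<close>, and the uniqueness lemma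
    loses a boundary layer, which leaves \<open>C m\<close>.\<close>
  have uniq: "AE x in lborel. x \<in> C m \<longrightarrow> G (Suc m) x = G (Suc n) x" if "m \<le> n" for m n
  proof (rule weak_gradient_unique[OF C(1)[of "Suc m"] C(1)[of m] C(3) w(1)[of "Suc m"] w(1)[of "Suc n"] _ G G])
    have "C (Suc m) \<subseteq> C (Suc n)" using that by (intro C_mono) simp
    then show "test_fun (C (Suc m)) \<phi> \<Longrightarrow> c \<in> Basis \<Longrightarrow> (\<integral>x. w (Suc n) x * frechet_derivative \<phi> (at x) c \<partial>lborel) = - (\<integral>x. (G (Suc n) x \<bullet> c) * \<phi> x \<partial>lborel)" for \<phi> c
      using wG[of c "Suc n" \<phi>] test_fun_mono by blast
    show "AE x in lborel. x \<in> C (Suc m) \<longrightarrow> w (Suc m) x = w (Suc n) x"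
      using vw[of "Suc m"] vw[of "Suc n"]
    proof eventually_elim
      fix x assume "x \<in> C (Suc m) \<longrightarrow> v x = w (Suc m) x" "x \<in> C (Suc n) \<longrightarrow> v x = w (Suc n) x"
      with \<open>C (Suc m) \<subseteq> C (Suc n)\<close> show "x \<in> C (Suc m) \<longrightarrow> w (Suc m) x = w (Suc n) x" by auto
    qed
  qed (rule wG)
  \<comment> \<open>The successor makes up for that loss: at a point of \<open>C k\<close> the value
    is taken from the gradient that belongs to \<open>C (Suc k)\<close>. Outside the domain the
    value is arbitrary.\<close>
  define \<Gamma> where "\<Gamma> x = G (Suc (LEAST k. x \<in> C k)) x" for x
  \<comment> \<open>One null set for all pairs of indices, since the least index in
    \<open>\<Gamma>\<close> varies with the point.\<close>
  have "AE x in lborel. \<forall>m n. m \<le> n \<longrightarrow> x \<in> C m \<longrightarrow> G (Suc m) x = G (Suc n) x"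
  proof (subst AE_all_countable, intro allI, subst AE_all_countable, intro allI)
    fix m n :: nat
    show "AE x in lborel. m \<le> n \<longrightarrow> x \<in> C m \<longrightarrow> G (Suc m) x = G (Suc n) x"
      by (cases "m \<le> n") (use uniq in simp_all)
  qed
  then have \<Gamma>: "AE x in lborel. x \<in> C m \<longrightarrow> \<Gamma> x = G (Suc m) x" for m
  proof (rule eventually_mono, intro impI)
    fix x assume *: "\<forall>m n. m \<le> n \<longrightarrow> x \<in> C m \<longrightarrow> G (Suc m) x = G (Suc n) x" and x: "x \<in> C m"
    show "\<Gamma> x = G (Suc m) x"
      unfolding \<Gamma>_def using * Least_le[of "\<lambda>k. x \<in> C k", OF x] LeastI[of "\<lambda>k. x \<in> C k", OF x] by blast
  qed
  have Lv: "Lp_loc 1 \<Omega> v" "Lp_loc 2 \<Omega> v"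
  proof -
    have "\<exists>k0. k0 \<in> borel_measurable borel \<and> integrable lborel (\<lambda>x. (norm (k0 x))\<^sup>2) \<and> (AE x in lborel. x \<in> K \<longrightarrow> v x = k0 x)"
      if K: "compact K" "K \<subseteq> \<Omega>" for K
    proof -
      obtain N where "K \<subseteq> C N" using C(5)[OF K] by blast
      then have "AE x in lborel. x \<in> K \<longrightarrow> v x = w N x" using vw[of N] by (auto elim!: eventually_mono)
      with w show ?thesis by (intro exI[of _ "w N"] conjI)
    qed
    from Lp_loc_of_L2_representatives[OF this] show "Lp_loc 1 \<Omega> v" "Lp_loc 2 \<Omega> v" by simp_all
  qed
  have L\<Gamma>: "Lp_loc 1 \<Omega> \<Gamma>" "Lp_loc 2 \<Omega> \<Gamma>"
  proof -
    have "\<exists>k0. k0 \<in> borel_measurable borel \<and> integrable lborel (\<lambda>x. (norm (k0 x))\<^sup>2) \<and> (AE x in lborel. x \<in> K \<longrightarrow> \<Gamma> x = k0 x)"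
      if K: "compact K" "K \<subseteq> \<Omega>" for K
    proof -
      obtain N where "K \<subseteq> C N" using C(5)[OF K] by blast
      then have "AE x in lborel. x \<in> K \<longrightarrow> \<Gamma> x = G (Suc N) x" using \<Gamma>[of N] by (auto elim!: eventually_mono)
      with G show ?thesis by (intro exI[of _ "G (Suc N)"] conjI)
    qed
    from Lp_loc_of_L2_representatives[OF this] show "Lp_loc 1 \<Omega> \<Gamma>" "Lp_loc 2 \<Omega> \<Gamma>" by simp_all
  qed
  have "weak_grad \<Omega> v \<Gamma>"
    unfolding weak_grad_def
  proof (intro conjI Lv L\<Gamma> allI impI ballI)
    fix \<phi> and c :: 'a assume \<phi>: "test_fun \<Omega> \<phi>" and c: "c \<in> Basis"
    obtain T where T: "smooth \<phi>" "compact T" "T \<subseteq> \<Omega>" "\<And>x. x \<notin> T \<Longrightarrow> \<phi> x = 0"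
      by (rule test_funE[OF \<phi>]) blast
    obtain m where m: "T \<subseteq> C m" using C(5)[OF T(2,3)] by blast
    have \<phi>m: "test_fun (C m) \<phi>" by (rule test_funI[OF T(1,2) m T(4)])
    \<comment> \<open>The weak identity is taken on \<open>C (Suc m)\<close>, whereas
      \<open>\<Gamma>\<close> is known to equal \<open>G (Suc m)\<close> on \<open>C m\<close>,
      which still contains the support of \<open>\<phi>\<close>.\<close>
    have \<phi>m': "test_fun (C (Suc m)) \<phi>" by (rule test_fun_mono[OF \<phi>m C_mono]) simp
    have \<Omega>L: "\<Omega> \<in> sets lebesgue" using assms(1) by simp
    have "(LINT x|lebesgue_on \<Omega>. v x * frechet_derivative \<phi> (at x) c) = (\<integral>x. w (Suc m) x * frechet_derivative \<phi> (at x) c \<partial>lborel)"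
    proof (rule integral_lebesgue_on_eq[OF \<Omega>L])
      show "(\<lambda>x. w (Suc m) x * frechet_derivative \<phi> (at x) c) \<in> borel_measurable borel"
        by (intro borel_measurable_times w frechet_measurable[OF T(1) c])
      show "AE x in lborel. indicator \<Omega> x * (v x * frechet_derivative \<phi> (at x) c) = w (Suc m) x * frechet_derivative \<phi> (at x) c"
        using vw[of "Suc m"]
      proof eventually_elim
        fix x assume "x \<in> C (Suc m) \<longrightarrow> v x = w (Suc m) x"
        then show "indicator \<Omega> x * (v x * frechet_derivative \<phi> (at x) c) = w (Suc m) x * frechet_derivative \<phi> (at x) c"
          using C(2)[of "Suc m"] test_fun_frechet_outside[OF c \<phi>m', of x] by (cases "x \<in> C (Suc m)") auto
      qed
    qed
    also have "\<dots> = - (\<integral>x. (G (Suc m) x \<bullet> c) * \<phi> x \<partial>lborel)"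
      by (rule wG[OF c \<phi>m'])
    also have "(\<integral>x. (G (Suc m) x \<bullet> c) * \<phi> x \<partial>lborel) = (LINT x|lebesgue_on \<Omega>. (\<Gamma> x \<bullet> c) * \<phi> x)"
    proof (rule integral_lebesgue_on_eq[OF \<Omega>L, symmetric])
      show "(\<lambda>x. (G (Suc m) x \<bullet> c) * \<phi> x) \<in> borel_measurable borel"
        by (intro borel_measurable_times borel_measurable_inner G borel_measurable_const test_fun_measurable[OF \<phi>])
      show "AE x in lborel. indicator \<Omega> x * ((\<Gamma> x \<bullet> c) * \<phi> x) = (G (Suc m) x \<bullet> c) * \<phi> x"
        using \<Gamma>[of m]
      proof eventually_elim
        fix x assume "x \<in> C m \<longrightarrow> \<Gamma> x = G (Suc m) x"
        then show "indicator \<Omega> x * ((\<Gamma> x \<bullet> c) * \<phi> x) = (G (Suc m) x \<bullet> c) * \<phi> x"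
          using C(2)[of m] test_fun_outside[OF \<phi>m, of x] by (cases "x \<in> C m") auto
      qed
    qed
    finally show "(LINT x|lebesgue_on \<Omega>. v x * frechet_derivative \<phi> (at x) c) = - (LINT x|lebesgue_on \<Omega>. (\<Gamma> x \<bullet> c) * \<phi> x)" .
  qed
  then have "W1p_loc 2 \<Omega> v \<Gamma>" using Lv L\<Gamma> by (simp add: W1p_loc_def)
  then show "\<exists>G. W1p_loc 2 \<Omega> (\<lambda>x. H (p / 2) (Du x) \<bullet> b) G"
    unfolding v_def by blast
qed

end
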